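(* Let $\theta=(f,p,G)$ and $\hat\theta=(\hat f,\hat p,\hat G)$ be two smooth graphical latent models. Assume: 1. (Observational equivalence) $\theta\sim_{\rm obs}\hat\theta$. 2. (Sufficient influence of $z$) For Lebesgue-almost every $z\in\mathbb R^{d_z}$ there exist tuples $(t_{(r)},\tau_{(r)},z_{(r)},a_{(r)})$, $r=1,\dots,\|G^z\|_0$, with $t_{(r)}\in[T]$, $1\le\tau_{(r)}<t_{(r)}$, $z_{(r)}\in\mathbb R^{d_z\times(t_{(r)}-1)}$, $a_{(r)}\in\mathcal A^{t_{(r)}}$, such that the $\tau_{(r)}$-th column of $z_{(r)}$ equals $z$, i.e. $z_{(r)}^{\tau_{(r)}}=z$, for every $r$, and $$\mathrm{span}\Big\{H^{t_{(r)},\tau_{(r)}}_{z,z}\log p(z\mid z_{(r)},a_{(r)})\Big\}_{r=1}^{\|G^z\|_0}=\mathbb R^{d_z\times d_z}_{G^z}.$$ Then there exists a $d_z\times d_z$ permutation matrix $P$ such that $PG^zP^\top\subseteq\hat G^z$. If in addition 3. (Sparsity) $\|\hat G^z\|_0\le\|G^z\|_0$, then $\theta\sim^{z}_{\rm con}\hat\theta$ ($\theta$ and $\hat\theta$ are $z$-consistent).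
   Context: **Notation.** $[n]=\{1,\dots,n\}$. Fix positive integers $T,d_x,d_z,d_a$ with $d_z\le d_x$, a constant $\sigma^2\ge0$ and a nonempty set $\mathcal A\subseteq\mathbb R^{d_a}$. Write $z^{<t}=(z^1,\dots,z^{t-1})\in\mathbb R^{d_z\times(t-1)}$ and $a^{<t}=(a^0,\dots,a^{t-1})\in\mathcal A^t$ (columns indexed by time). For binary matrices, $A\subseteq B$ means every nonzero position of $A$ is a nonzero position of $B$; $\|A\|_0$ is the number of nonzero entries. For $B\in\{0,1\}^{m\times n}$, $\mathbb R^{m\times n}_B=\{M\in\mathbb R^{m\times n}:B_{i,j}=0\Rightarrow M_{i,j}=0\}$. A map defined on an arbitrary subset of $\mathbb R^n$ is $C^k$ if it extends to a $C^k$ map on an open set containing that subset. A diffeomorphism is a $C^1$ bijection with $C^1$ inverse. A permutation matrix is identified with the linear map it defines. **Graphical latent model.** A triple $\theta=(f,p,G)$, $G=[G^z,G^a]$, $G^z\in\{0,1\}^{d_z\times d_z}$, $G^a\in\{0,1\}^{d_z\times d_a}$, such that: (i) $f:\mathbb R^{d_z}\to\mathbb R^{d_x}$ is a diffeomorphism onto its image, and $f(\mathbb R^{d_z})$ is closed in $\mathbb R^{d_x}$; observations are $x^t=f(z^t)+n^t$, $t\in[T]$, where the $n^t\sim\mathcal N(0,\sigma^2I)$ are independent across time and independent of all $z$'s and $a$'s; (ii) for each $t\in[T]$, the latent vector $z^t$ has, given $z^{<t}$ and $a^{<t}$, a conditional density with respect to Lebesgue measure $p(z^t\mid z^{<t},a^{<t})=\prod_{i=1}^{d_z}p(z^t_i\mid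 z^{<t},a^{<t})$, each factor being strictly positive on $\mathbb R$ (for $t=1$ the conditioning is on $a^0$ only); (iii) for each $i$ and $t$, $p(z^t_i\mid z^{<t},a^{<t})$ depends on $(z^{<t},a^{<t})$ only through the rows $z_j^{<t}$ with $G^z_{i,j}=1$ and the rows $a_\ell^{<t}$ with $G^a_{i,\ell}=1$. **Smooth** means: either $a$ is continuous, in which case $\mathcal A$ is regular closed ($\overline{\mathcal A^\circ}=\mathcal A$) and each $p(z_i^t\mid z^{<t},a^{<t})$ is $C^2$ on $\mathbb R\times\mathbb R^{d_z\times(t-1)}\times\mathcal A^t$; or $a$ is discrete, in which case for each fixed $a^{<t}$ it is $C^2$ on $\mathbb R\times\mathbb R^{d_z\times(t-1)}$. **Hessian.** $H^{t,\tau}_{z,z}\log p(z^t\mid z^{<t},a^{<t})\in\mathbb R^{d_z\times d_z}$ has $(i,j)$ entry $\frac{\partial^2}{\partial z^\tau_j\,\partial z^t_i}\log p(z^t\mid z^{<t},a^{<t})$. **Observational equivalence.** $\theta\sim_{\rm obs}\tilde\theta$ iff for every $a^{<T}\in\mathcal A^T$ the conditional distributions of $(x^1,\dots,x^T)$ given $a^{<T}$ induced by $\theta$ and $\tilde\theta$ (same $\sigma^2$) coincide. **Equivalence up to diffeomorphism.** $\theta\sim_{\rm diff}\tilde\theta$ iff $f(\mathbb R^{d_z})=\tilde f(\mathbb R^{d_z})$ and, with $v:=f^{-1}\circ\tilde f$ (the entanglement map, a diffeomorphism of $\mathbb R^{d_z}$), for all $t\in[T]$, $a^{<t}\in\mathcal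 A^t$, $z^{\le t}\in\mathbb R^{d_z\times t}$: $\tilde p(z^t\mid z^{<t},a^{<t})=p(v(z^t)\mid v(z^{<t}),a^{<t})\,|\det Dv(z^t)|$, where $v$ is applied columnwise to $z^{<t}$. **Dependency graph and $G$-preservation.** The dependency graph of $h:\mathbb R^n\to\mathbb R^m$ is $H\in\{0,1\}^{m\times n}$ with $H_{i,j}=0$ iff $h_i$ does not depend on its $j$-th argument (i.e. $h_i(a)=\bar h_i(a_{-j})$ for all $a$ for some function $\bar h_i$ of the remaining coordinates). For $B\in\{0,1\}^{m\times n}$, a matrix $C\in\mathbb R^{m\times m}$ is $B$-preserving if $C^\top\mathbb R^{m\times n}_B\subseteq\mathbb R^{m\times n}_B$; a function $c:\mathbb R^m\to\mathbb R^m$ is $B$-preserving if its dependency graph is a $B$-preserving matrix. **$z$-consistency.** $\theta\sim^z_{\rm con}\tilde\theta$ iff there is a permutation matrix $P$ such that $\theta\sim_{\rm diff}\tilde\theta$, $\tilde G^z=PG^zP^\top$, and $v=f^{-1}\circ\tilde f$ can be written $v=c\circ P^\top$ with $c$ a diffeomorphism that is both $G^z$-preserving and $(G^z)^\top$-preserving. *)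

theory Defs
  imports "HOL-Probability.Probability"
begin

subsection \<open>Binary matrices\<close>

text \<open>An $m \times n$ matrix is an element of \<open>real ^ 'n ^ 'm\<close>, entry $(i,j)$ being \<open>M $ i $ j\<close>.\<close>

definition binary_matrix :: "real ^ 'n ^ 'm \<Rightarrow> bool" where
  "binary_matrix B \<longleftrightarrow> (\<forall>i j. B $ i $ j \<in> {0, 1})"

definition norm0 :: "real ^ 'n ^ 'm \<Rightarrow> nat" where
  "norm0 B = card {(i, j). B $ i $ j \<noteq> 0}"

definition pattern_le :: "real ^ 'n ^ 'm \<Rightarrow> real ^ 'n ^ 'm \<Rightarrow> bool" where
  "pattern_le A B \<longleftrightarrow> (\<forall>i j. A $ i $ j \<noteq> 0 \<longrightarrow> B $ i $ j \<noteq> 0)"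

definition masked_space :: "real ^ 'n ^ 'm \<Rightarrow> (real ^ 'n ^ 'm) set" where
  "masked_space B = {M. \<forall>i j. B $ i $ j = 0 \<longrightarrow> M $ i $ j = 0}"

definition permutation_matrix :: "real ^ 'n ^ 'n \<Rightarrow> bool" where
  "permutation_matrix P \<longleftrightarrow> (\<exists>\<pi>. bij \<pi> \<and> P = (\<chi> i j. if j = \<pi> i then 1 else 0))"


subsection \<open>Differentiability classes\<close>

text \<open>On an open set, being $C^k$; in finite dimensions the strong continuity of
  $x \mapsto D f(x)\,v$ for each $v$ is the same as continuity of $D f$.\<close>

primrec Ck_open ::
  "nat \<Rightarrow> 'a::euclidean_space set \<Rightarrow> ('a \<Rightarrow> 'b::euclidean_space) \<Rightarrow> bool" where
  "Ck_open 0 U f \<longleftrightarrow> continuous_on U f"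
| "Ck_open (Suc k) U f \<longleftrightarrow>
     (\<forall>x\<in>U. f differentiable (at x)) \<and>
     (\<forall>v. Ck_open k U (\<lambda>x. frechet_derivative f (at x) v))"

definition Ck_on ::
  "nat \<Rightarrow> 'a::euclidean_space set \<Rightarrow> ('a \<Rightarrow> 'b::euclidean_space) \<Rightarrow> bool" where
  "Ck_on k S f \<longleftrightarrow> (\<exists>U g. open U \<and> S \<subseteq> U \<and> Ck_open k U g \<and> (\<forall>x\<in>S. g x = f x))"

definition diffeomorphism ::
  "'a::euclidean_space set \<Rightarrow> 'b::euclidean_space set \<Rightarrow> ('a \<Rightarrow> 'b) \<Rightarrow> bool" where
  "diffeomorphism S R f \<longleftrightarrow> bij_betw f S R \<and> Ck_on 1 S f \<and> Ck_on 1 R (inv_into S f)"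


subsection \<open>Graphical latent models\<close>

type_synonym ('n, 't) trajectory = "((real, 'n) vec, 't) vec"

text \<open>
  The finite linearly ordered type \<open>'t\<close> plays the role of the time index set $\{1,\dots,T\}$.
  A latent trajectory is \<open>z :: ('z, 't) trajectory\<close> with \<open>z $ t\<close> $= z^t$. An auxiliary trajectory is
  \<open>a :: ('a, 't) trajectory\<close>, with times shifted by one: \<open>a $ t\<close> $= a^{t-1}$, so that $a^{<t}$ consists
  of the columns \<open>a $ s\<close> with \<open>s \<le> t\<close>.

  Histories are passed as full trajectories: \<open>factor M t i y z a\<close> is
  $p(z^t_i = y \mid z^{<t}, a^{<t})$. By the dependency condition in \<open>graphical_model\<close> only the
  columns \<open>z $ s\<close> with \<open>s < t\<close> and \<open>a $ s\<close> with \<open>s \<le> t\<close> matter.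
\<close>

record ('z, 'x, 'a, 't) latent_model =
  mixing :: "real ^ 'z \<Rightarrow> real ^ 'x"
  factor :: "'t \<Rightarrow> 'z \<Rightarrow> real \<Rightarrow> ('z, 't) trajectory \<Rightarrow> ('a, 't) trajectory \<Rightarrow> real"
  Gz :: "real ^ 'z ^ 'z"
  Ga :: "real ^ 'a ^ 'z"

text \<open>Trajectories whose part $a^{<t}$ lies in $\mathcal A^t$.\<close>

definition actions_before :: "(real ^ 'a) set \<Rightarrow> 't::{finite,linorder} \<Rightarrow> ('a, 't) trajectory set" where
  "actions_before A t = {a. \<forall>s\<le>t. a $ s \<in> A}"

definition trans_density ::
  "('z::finite, 'x::finite, 'a::finite, 't::{finite,linorder}) latent_model \<Rightarrow>
    't \<Rightarrow> real ^ 'z \<Rightarrow> ('z, 't) trajectory \<Rightarrow> ('a, 't) trajectory \<Rightarrow> real" where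
  "trans_density M t w z a = (\<Prod>i\<in>UNIV. factor M t i (w $ i) z a)"

definition graphical_model ::
  "(real ^ 'a) set \<Rightarrow>
    ('z::finite, 'x::finite, 'a::finite, 't::{finite,linorder}) latent_model \<Rightarrow> bool" where
  "graphical_model A M \<longleftrightarrow>
     binary_matrix (Gz M) \<and> binary_matrix (Ga M) \<and>
     diffeomorphism UNIV (range (mixing M)) (mixing M) \<and>
     closed (range (mixing M)) \<and>
     (\<forall>t i. \<forall>a \<in> actions_before A t.
        (\<lambda>(y, z). factor M t i y z a) \<in> borel_measurable borel \<and>
        (\<forall>z. (\<forall>y. factor M t i y z a > 0) \<and>
             (\<integral>\<^sup>+ y. ennreal (factor M t i y z a) \<partial>lborel) = 1)) \<and>
     (\<forall>t i y z z'. \<forall>a \<in> actions_before A t. \<forall>a' \<in> actions_before A t.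
        (\<forall>s<t. \<forall>j. Gz M $ i $ j = 1 \<longrightarrow> z $ s $ j = z' $ s $ j) \<longrightarrow>
        (\<forall>s\<le>t. \<forall>l. Ga M $ i $ l = 1 \<longrightarrow> a $ s $ l = a' $ s $ l) \<longrightarrow>
        factor M t i y z a = factor M t i y z' a')"

text \<open>
  The two cases are: \<open>a\<close> continuous, and \<open>a\<close> discrete, meaning that it takes at most countably many
  values. Being $C^2$ on $\mathbb R \times \mathbb R^{d_z \times (t-1)} \times \mathcal A^t$ is
  expressed on full trajectories, the superfluous columns being unconstrained and irrelevant.
\<close>

definition smooth_model ::
  "(real ^ 'a) set \<Rightarrow>
    ('z::finite, 'x::finite, 'a::finite, 't::{finite,linorder}) latent_model \<Rightarrow> bool" where
  "smooth_model A M \<longleftrightarrow>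
     (closure (interior A) = A \<and>
      (\<forall>t i. Ck_on 2 (UNIV \<times> UNIV \<times> actions_before A t) (\<lambda>(y, z, a). factor M t i y z a))) \<or>
     (countable A \<and>
      (\<forall>t i. \<forall>a \<in> actions_before A t. Ck_on 2 UNIV (\<lambda>(y, z). factor M t i y z a)))"

definition partial_deriv :: "'v::real_normed_vector \<Rightarrow> ('v \<Rightarrow> real) \<Rightarrow> 'v \<Rightarrow> real" where
  "partial_deriv b F x = deriv (\<lambda>h. F (x + h *\<^sub>R b)) 0"

text \<open>The direction \<open>axis \<tau> (axis j 1)\<close> is that of the coordinate $z^\tau_j$ of the history.\<close>

definition hessian_zz ::
  "('z::finite, 'x::finite, 'a::finite, 't::{finite,linorder}) latent_model \<Rightarrow>
    't \<Rightarrow> 't \<Rightarrow> real ^ 'z \<Rightarrow> ('z, 't) trajectory \<Rightarrow> ('a, 't) trajectory \<Rightarrow> real ^ 'z ^ 'z" where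
  "hessian_zz M t \<tau> w z a =
     (\<chi> i j. partial_deriv (axis \<tau> (axis j 1))
        (\<lambda>z'. partial_deriv (axis i 1) (\<lambda>w'. ln (trans_density M t w' z' a)) w) z)"

definition sufficient_influence_z ::
  "(real ^ 'a) set \<Rightarrow>
    ('z::finite, 'x::finite, 'a::finite, 't::{finite,linorder}) latent_model \<Rightarrow> bool" where
  "sufficient_influence_z A M \<longleftrightarrow>
     (AE z in lebesgue.
        \<exists>(t :: nat \<Rightarrow> 't) (\<tau> :: nat \<Rightarrow> 't)
          (zs :: nat \<Rightarrow> ('z, 't) trajectory) (as :: nat \<Rightarrow> ('a, 't) trajectory).
          (\<forall>r \<in> {1..norm0 (Gz M)}.
             \<tau> r < t r \<and> as r \<in> actions_before A (t r) \<and> zs r $ \<tau> r = z) \<and>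
          span ((\<lambda>r. hessian_zz M (t r) (\<tau> r) z (zs r) (as r)) ` {1..norm0 (Gz M)})
            = masked_space (Gz M))"


subsection \<open>Observational equivalence\<close>

text \<open>The conditional law of $(z^1,\dots,z^T)$ given $a^{<T}$, by the chain rule.\<close>

definition latent_law ::
  "('z::finite, 'x::finite, 'a::finite, 't::{finite,linorder}) latent_model \<Rightarrow>
    ('a, 't) trajectory \<Rightarrow> ('z, 't) trajectory measure" where
  "latent_law M a = density lborel (\<lambda>z. ennreal (\<Prod>t\<in>UNIV. trans_density M t (z $ t) z a))"

text \<open>The joint law of the noise $(n^1,\dots,n^T)$, as a scaled standard Gaussian so that
  \<open>\<sigma>2 = 0\<close> gives the point mass at zero.\<close>

definition noise_law :: "real \<Rightarrow> ('x::finite, 't::finite) trajectory measure" where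
  "noise_law \<sigma>2 =
     distr (density lborel
              (\<lambda>n. ennreal (\<Prod>t\<in>UNIV. \<Prod>k\<in>UNIV. std_normal_density (n $ t $ k))))
       borel (\<lambda>n. sqrt \<sigma>2 *\<^sub>R n)"

definition observation_law ::
  "real \<Rightarrow> ('z::finite, 'x::finite, 'a::finite, 't::{finite,linorder}) latent_model \<Rightarrow>
    ('a, 't) trajectory \<Rightarrow> ('x, 't) trajectory measure" where
  "observation_law \<sigma>2 M a =
     distr (latent_law M a \<Otimes>\<^sub>M noise_law \<sigma>2) borel
       (\<lambda>(z, n). \<chi> t. mixing M (z $ t) + n $ t)"

definition obs_equiv ::
  "real \<Rightarrow> (real ^ 'a) set \<Rightarrow>
    ('z::finite, 'x::finite, 'a::finite, 't::{finite,linorder}) latent_model \<Rightarrow>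
    ('z, 'x, 'a, 't) latent_model \<Rightarrow> bool" where
  "obs_equiv \<sigma>2 A M M' \<longleftrightarrow>
     (\<forall>a. (\<forall>t. a $ t \<in> A) \<longrightarrow> observation_law \<sigma>2 M a = observation_law \<sigma>2 M' a)"


subsection \<open>Equivalence up to diffeomorphism and consistency\<close>

definition entanglement ::
  "('z::finite, 'x::finite, 'a::finite, 't::{finite,linorder}) latent_model \<Rightarrow>
    ('z, 'x, 'a, 't) latent_model \<Rightarrow> real ^ 'z \<Rightarrow> real ^ 'z" where
  "entanglement M M' = inv (mixing M) \<circ> mixing M'"

definition diff_equiv ::
  "(real ^ 'a) set \<Rightarrow>
    ('z::finite, 'x::finite, 'a::finite, 't::{finite,linorder}) latent_model \<Rightarrow>
    ('z, 'x, 'a, 't) latent_model \<Rightarrow> bool" where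
  "diff_equiv A M M' \<longleftrightarrow>
     range (mixing M) = range (mixing M') \<and>
     (let v = entanglement M M' in
       \<forall>t. \<forall>a \<in> actions_before A t. \<forall>z.
         trans_density M' t (z $ t) z a =
         trans_density M t (v (z $ t)) (\<chi> s. v (z $ s)) a * \<bar>det (jacobian v (at (z $ t)))\<bar>)"

definition dependency_graph :: "(real ^ 'n \<Rightarrow> real ^ 'm) \<Rightarrow> real ^ 'n ^ 'm" where
  "dependency_graph h =
     (\<chi> i j. if \<exists>hbar. \<forall>x. h x $ i = hbar (restrict (\<lambda>k. x $ k) (- {j})) then 0 else 1)"

definition preserving_matrix :: "real ^ 'n ^ 'm::finite \<Rightarrow> real ^ 'm ^ 'm \<Rightarrow> bool" where
  "preserving_matrix B C \<longleftrightarrow> (\<lambda>M. transpose C ** M) ` masked_space B \<subseteq> masked_space B"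

definition preserving_map :: "real ^ 'n ^ 'm::finite \<Rightarrow> (real ^ 'm \<Rightarrow> real ^ 'm) \<Rightarrow> bool" where
  "preserving_map B c \<longleftrightarrow> preserving_matrix B (dependency_graph c)"

definition z_consistent ::
  "(real ^ 'a) set \<Rightarrow>
    ('z::finite, 'x::finite, 'a::finite, 't::{finite,linorder}) latent_model \<Rightarrow>
    ('z, 'x, 'a, 't) latent_model \<Rightarrow> bool" where
  "z_consistent A M M' \<longleftrightarrow>
     (\<exists>P. permutation_matrix P \<and> diff_equiv A M M' \<and>
          Gz M' = P ** Gz M ** transpose P \<and>
          (\<exists>c. entanglement M M' = c \<circ> (\<lambda>x. transpose P *v x) \<and>
               diffeomorphism UNIV UNIV c \<and>
               preserving_map (Gz M) c \<and> preserving_map (transpose (Gz M)) c))"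

end

theory Submission
  imports Defs
begin

text \<open>
  Gaussian noise has a nowhere vanishing characteristic function, so observational equivalence forces
  the noiseless laws of \<open>(f z\<^sup>1, \<dots>, f z\<^sup>T)\<close> to agree. Positivity of the densities and closedness of the
  images give equal ranges of the mixing maps, and the change of variables along the entanglement map
  \<open>v\<close>, followed by integrating out the latest times, gives equivalence up to diffeomorphism.
  Differentiating the resulting identity of log-densities in \<open>z\<^sup>t\<close> and \<open>z\<^sup>\<tau>\<close> yields
  \<open>H' = Dv(z\<^sup>t)\<^sup>T H Dv(z\<^sup>\<tau>)\<close>. By sufficient influence, density and continuity, \<open>X \<mapsto> Dv(u)\<^sup>T X Dv(u)\<close>
  maps the space of matrices supported on \<open>G\<close> into that for \<open>G'\<close>, for every \<open>u\<close>. A nonvanishing term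
  of \<open>det Dv(u)\<close> is a permutation embedding \<open>G\<close> into \<open>G'\<close>. Under the sparsity assumption this is an
  isomorphism, and connectedness of the domain shows that one and the same permutation, up to indices
  with equal neighbourhoods, serves all \<open>u\<close>.
\<close>

section \<open>Matrix patterns\<close>

text \<open>The congruence by a Jacobian sees its entries only in pairs, and only at one common
  point \<open>u\<close>: this is why the influence hypothesis makes column \<open>\<tau>\<close> of
  the history equal to the current latent vector. A dependency graph, by contrast, collects the
  nonzero entries over all points, and different points may have different transversals, so supports
  at distant points cannot be compared by algebra alone. The bridge is domination of indices:
  \<open>m\<close> dominates \<open>i\<close> when the row and column neighbourhoods of
  \<open>i\<close> lie in those of \<open>m\<close>. This relation does not mention
  \<open>u\<close>, so it can be propagated from the point 0, at which the permutation is chosen,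
  and it is what preservation of \<open>G\<close> and of its transpose asks of an entry
  \<open>(i, m)\<close>. Sparsity lets the propagation start: equality of \<open>H\<close> with the
  relabelled \<open>G\<close> turns transport from \<open>G\<close> to \<open>H\<close> into
  transport from \<open>G\<close> to itself.\<close>

definition transports_pattern :: "real ^ 'n ^ 'n \<Rightarrow> real ^ 'n ^ 'n \<Rightarrow> real ^ 'n ^ 'n \<Rightarrow> bool" where
  "transports_pattern G H L \<longleftrightarrow>
     (\<forall>i j k l. L $ i $ k \<noteq> 0 \<longrightarrow> L $ j $ l \<noteq> 0 \<longrightarrow> G $ i $ j \<noteq> 0 \<longrightarrow> H $ k $ l \<noteq> 0)"

lemma invertible_imp_nonzero_transversal:
  fixes L :: "real ^ 'n ^ 'n"
  assumes "invertible L"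
  obtains \<sigma> where "bij \<sigma>" "\<And>i. L $ i $ \<sigma> i \<noteq> 0"
proof -
  have "det L \<noteq> 0"
    using assms invertible_det_nz by blast
  then obtain p where "p permutes (UNIV :: 'n set)" "of_int (sign p) * (\<Prod>i\<in>UNIV. L $ i $ p i) \<noteq> 0"
    unfolding det_def by (metis (no_types, lifting) mem_Collect_eq sum.neutral)
  with that[of p] show thesis
    by (auto simp: permutes_bij)
qed

text \<open>The condition is tested on matrix units: for the unit \<open>E\<close> at
  \<open>(i, j)\<close>, which lies in the space of \<open>G\<close> when
  \<open>G $ i $ j \<noteq> 0\<close>, entry \<open>(k, l)\<close> of the congruence is the single
  product \<open>L $ i $ k * L $ j $ l\<close>.\<close>

lemma transports_patternI:
  fixes L :: "real ^ 'n ^ 'n"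
  assumes "(\<lambda>M. transpose L ** M ** L) ` masked_space G \<subseteq> masked_space H"
  shows "transports_pattern G H L"
  unfolding transports_pattern_def
proof (intro allI impI)
  fix i j k l assume L: "L $ i $ k \<noteq> 0" "L $ j $ l \<noteq> 0" and G: "G $ i $ j \<noteq> 0"
  define E :: "real ^ 'n ^ 'n" where "E = (\<chi> a b. if a = i \<and> b = j then 1 else 0)"
  have "E \<in> masked_space G"
    using G by (auto simp: masked_space_def E_def)
  hence mem: "transpose L ** E ** L \<in> masked_space H"
    using assms by blast
  have "(transpose L ** E ** L) $ k $ l = (\<Sum>b\<in>UNIV. (\<Sum>a\<in>UNIV. L $ a $ k * E $ a $ b) * L $ b $ l)"
    by (simp add: matrix_matrix_mult_def transpose_def)
  also have "\<dots> = (\<Sum>b\<in>UNIV. if b = j then L $ i $ k * L $ b $ l else 0)"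
  proof (rule sum.cong)
    fix b
    have "(\<Sum>a\<in>UNIV. L $ a $ k * E $ a $ b) = (\<Sum>a\<in>UNIV. if a = i then (if b = j then L $ i $ k else 0) else 0)"
      by (rule sum.cong) (auto simp: E_def)
    thus "(\<Sum>a\<in>UNIV. L $ a $ k * E $ a $ b) * L $ b $ l = (if b = j then L $ i $ k * L $ b $ l else 0)"
      by simp
  qed simp
  also have "\<dots> = L $ i $ k * L $ j $ l"
    by simp
  finally show "H $ k $ l \<noteq> 0"
    using mem L by (auto simp: masked_space_def)
qed

text \<open>A finite set contained in another of no larger cardinality equals it; a binary matrix is
  determined by its support.\<close>

lemma pattern_le_imp_eq:
  fixes A B :: "real ^ 'n::finite ^ 'm::finite"
  assumes "pattern_le A B" "norm0 B \<le> norm0 A" "binary_matrix A" "binary_matrix B"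
  shows "A = B"
proof -
  have "{(i, j). A $ i $ j \<noteq> 0} = {(i, j). B $ i $ j \<noteq> 0}"
    using assms(1,2) unfolding norm0_def by (intro card_seteq) (auto simp: pattern_le_def)
  hence "A $ i $ j \<noteq> 0 \<longleftrightarrow> B $ i $ j \<noteq> 0" for i j
    by (auto simp: set_eq_iff)
  thus ?thesis
    using assms(3,4) unfolding vec_eq_iff binary_matrix_def by (metis insertE singletonD)
qed

section \<open>Relabelling by permutation matrices, and preservation of patterns\<close>

lemma permutation_conj_nth:
  fixes G :: "real ^ 'n ^ 'n"
  assumes "P = (\<chi> i j. if j = \<pi> i then 1 else 0)"
  shows "(P ** G ** transpose P) $ a $ b = G $ \<pi> a $ \<pi> b"
proof -
  have "(P ** G) $ a $ c = G $ \<pi> a $ c" for c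
    by (simp add: assms matrix_matrix_mult_def mult_delta_left)
  moreover have "(P ** G ** transpose P) $ a $ b = (\<Sum>c\<in>UNIV. (P ** G) $ a $ c * P $ b $ c)"
    by (simp add: matrix_matrix_mult_def transpose_def)
  ultimately show ?thesis
    by (simp add: assms mult_delta_right)
qed

lemma norm0_permutation_conj:
  fixes G :: "real ^ 'n ^ 'n"
  assumes "P = (\<chi> i j. if j = \<pi> i then 1 else 0)" "bij \<pi>"
  shows "norm0 (P ** G ** transpose P) = norm0 G"
  unfolding norm0_def permutation_conj_nth[OF assms(1)]
proof (rule bij_betw_same_card)
  have "inj (map_prod \<pi> \<pi>)"
    using assms(2) by (simp add: bij_is_inj prod.inj_map)
  moreover have "map_prod \<pi> \<pi> ` {(i, j). G $ \<pi> i $ \<pi> j \<noteq> 0} = {(i, j). G $ i $ j \<noteq> 0}"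
  proof -
    have "(k, l) \<in> map_prod \<pi> \<pi> ` {(i, j). G $ \<pi> i $ \<pi> j \<noteq> 0}" if "G $ k $ l \<noteq> 0" for k l
      using that by (intro image_eqI[of _ _ "(inv \<pi> k, inv \<pi> l)"])
        (simp_all add: bij_is_surj[OF assms(2)] surj_f_inv_f)
    thus ?thesis by fastforce
  qed
  ultimately show "bij_betw (map_prod \<pi> \<pi>) {(i, j). G $ \<pi> i $ \<pi> j \<noteq> 0} {(i, j). G $ i $ j \<noteq> 0}"
    unfolding bij_betw_def using inj_on_subset[OF _ subset_UNIV] by blast
qed

text \<open>Entry \<open>(m, j)\<close> of \<open>transpose C ** M\<close> is the sum over
  \<open>i\<close> of \<open>C $ i $ m * M $ i $ j\<close>. The condition kills every summand
  separately: a nonzero \<open>C $ i $ m\<close> may add row \<open>i\<close> to row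
  \<open>m\<close> only if row \<open>m\<close> of \<open>B\<close> has room for it.\<close>

lemma preserving_matrixI:
  fixes B :: "real ^ 'n ^ 'm::finite"
  assumes "\<And>i m j. C $ i $ m \<noteq> 0 \<Longrightarrow> B $ i $ j \<noteq> 0 \<Longrightarrow> B $ m $ j \<noteq> 0"
  shows "preserving_matrix B C"
  unfolding preserving_matrix_def
proof clarify
  fix M assume M: "M \<in> masked_space B"
  have "(transpose C ** M) $ m $ j = 0" if 0: "B $ m $ j = 0" for m j
  proof -
    have "C $ i $ m * M $ i $ j = 0" for i
      using assms[of i m j] 0 M by (auto simp: masked_space_def)
    thus ?thesis
      by (auto simp: matrix_matrix_mult_def transpose_def intro!: sum.neutral)
  qed
  thus "transpose C ** M \<in> masked_space B"
    by (auto simp: masked_space_def)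
qed

text \<open>The two halves are the conditions of \<open>preserving_matrixI\<close> on a nonzero
  entry \<open>(i, m)\<close>, for \<open>G\<close> and for its transpose respectively.\<close>

definition dominated :: "real ^ 'n ^ 'n \<Rightarrow> 'n \<Rightarrow> 'n \<Rightarrow> bool" where
  "dominated G i m \<longleftrightarrow> (\<forall>j. (G $ i $ j \<noteq> 0 \<longrightarrow> G $ m $ j \<noteq> 0) \<and> (G $ j $ i \<noteq> 0 \<longrightarrow> G $ j $ m \<noteq> 0))"

text \<open>Reindexing by \<open>\<rho>\<close> leaves the total of the cardinalities unchanged, so
  none of the inclusions can be strict.\<close>

lemma card_le_bij_imp_eq:
  fixes N :: "'n::finite \<Rightarrow> 'b::finite set"
  assumes "bij \<rho>" "\<And>i. N i \<subseteq> N (\<rho> i)"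
  shows "N (\<rho> i) = N i"
proof -
  have "(\<Sum>i\<in>UNIV. card (N (\<rho> i)) - card (N i)) = 0"
  proof -
    have "(\<Sum>i\<in>UNIV. card (N (\<rho> i))) = (\<Sum>i\<in>UNIV. card (N i))"
      using sum.reindex_bij_betw[OF assms(1), of "\<lambda>i. card (N i)"] .
    thus ?thesis
      by (simp add: sum_subtractf_nat card_mono assms(2))
  qed
  hence "card (N (\<rho> i)) \<le> card (N i)"
    by simp
  thus ?thesis
    using card_seteq[OF _ assms(2)[of i]] by simp
qed

text \<open>Domination is one-sided, but along a bijection it becomes an equality of neighbourhoods.
  This lets \<open>\<rho> j\<close> be replaced by \<open>j\<close> in rows and columns of
  \<open>G\<close>.\<close>

lemma dominated_bij_imp_eq:
  fixes G :: "real ^ 'n ^ 'n"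
  assumes "bij \<rho>" "\<And>i. dominated G i (\<rho> i)"
  shows "G $ \<rho> i $ j \<noteq> 0 \<longleftrightarrow> G $ i $ j \<noteq> 0" "G $ j $ \<rho> i \<noteq> 0 \<longleftrightarrow> G $ j $ i \<noteq> 0"
proof -
  have "{j. G $ \<rho> i $ j \<noteq> 0} = {j. G $ i $ j \<noteq> 0}"
    by (rule card_le_bij_imp_eq[OF assms(1)]) (use assms(2) in \<open>auto simp: dominated_def\<close>)
  thus "G $ \<rho> i $ j \<noteq> 0 \<longleftrightarrow> G $ i $ j \<noteq> 0" by blast
  have "{j. G $ j $ \<rho> i \<noteq> 0} = {j. G $ j $ i \<noteq> 0}"
    by (rule card_le_bij_imp_eq[OF assms(1)]) (use assms(2) in \<open>auto simp: dominated_def\<close>)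
  thus "G $ j $ \<rho> i \<noteq> 0 \<longleftrightarrow> G $ j $ i \<noteq> 0" by blast
qed

text \<open>The set of points where the support of \<open>C\<close> respects domination is closed by continuity. It is
  also open: near such a point a nonvanishing transversal \<open>\<rho>\<close> of \<open>C\<close> persists, and since \<open>\<rho>\<close> only
  permutes indices with equal neighbourhoods, the transport condition along \<open>\<rho>\<close> yields domination.\<close>

lemma transports_pattern_self_dominated:
  fixes C :: "'a::euclidean_space \<Rightarrow> real ^ 'n ^ 'n"
  assumes cont: "\<And>i j. continuous_on UNIV (\<lambda>x. C x $ i $ j)"
    and inv: "\<And>x. invertible (C x)"
    and tr: "\<And>x. transports_pattern G G (C x)"
    and diag: "\<And>i. C x0 $ i $ i \<noteq> 0"
    and nz: "C x $ i $ m \<noteq> 0"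
  shows "dominated G i m"
proof -
  define X where "X = {x. \<forall>i m. C x $ i $ m \<noteq> 0 \<longrightarrow> dominated G i m}"
  have "closed X"
  proof -
    have "X = (\<Inter>(i, m) \<in> {(i, m). \<not> dominated G i m}. {x. C x $ i $ m = 0})"
      by (auto simp: X_def)
    moreover have "closed {x. C x $ i $ m = 0}" for i m
      by (intro closed_Collect_eq cont) auto
    ultimately show ?thesis by auto
  qed
  moreover have "open X"
  proof (subst open_subopen, clarify)
    fix x assume x: "x \<in> X"
    obtain \<rho> where \<rho>: "bij \<rho>" "\<And>i. C x $ i $ \<rho> i \<noteq> 0"
      using invertible_imp_nonzero_transversal[OF inv] by blast
    have "dominated G i (\<rho> i)" for i
      using x \<rho>(2) by (auto simp: X_def)
    note eq = dominated_bij_imp_eq[OF \<rho>(1) this]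
    define U where "U = (\<Inter>i. {y. C y $ i $ \<rho> i \<noteq> 0})"
    have "open U"
      unfolding U_def by (intro open_INT ballI open_Collect_neq cont) auto
    moreover have "x \<in> U"
      using \<rho>(2) by (auto simp: U_def)
    moreover have "U \<subseteq> X"
    proof
      fix y assume y: "y \<in> U"
      have "dominated G i m" if nz: "C y $ i $ m \<noteq> 0" for i m
        unfolding dominated_def
      proof (intro allI conjI impI)
        fix j
        \<comment> \<open>Transport is applied to the entries \<open>(i, m)\<close> and
          \<open>(j, \<rho> j)\<close>. It leads to \<open>G $ m $ \<rho> j\<close>, or to
          \<open>G $ \<rho> j $ m\<close> in the transposed case, and the equal neighbourhoods of
          \<open>\<rho> j\<close> and \<open>j\<close> then remove \<open>\<rho>\<close>.\<close>
        have j: "C y $ j $ \<rho> j \<noteq> 0" using y by (auto simp: U_def)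
        show "G $ m $ j \<noteq> 0" if "G $ i $ j \<noteq> 0"
          using tr[of y] nz j that eq(2)[of m j] unfolding transports_pattern_def by blast
        show "G $ j $ m \<noteq> 0" if "G $ j $ i \<noteq> 0"
          using tr[of y] nz j that eq(1)[of j m] unfolding transports_pattern_def by blast
      qed
      thus "y \<in> X" by (auto simp: X_def)
    qed
    ultimately show "\<exists>T. open T \<and> x \<in> T \<and> T \<subseteq> X" by blast
  qed
  \<comment> \<open>At \<open>x0\<close> the identity is a transversal, so the entries
    \<open>(i, m)\<close> and \<open>(j, j)\<close> give domination directly.\<close>
  moreover have "x0 \<in> X"
    unfolding X_def dominated_def using tr[of x0] diag unfolding transports_pattern_def by blast
  ultimately have "X = UNIV"
    using clopen[of X] by auto
  thus ?thesis
    using nz unfolding X_def by blast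
qed

text \<open>If the partial derivative of \<open>h\<close> in position \<open>(i, m)\<close> vanished
  everywhere, component \<open>i\<close> would be constant on every line parallel to axis
  \<open>m\<close>. Hence an edge of the dependency graph is witnessed by the derivative at some
  point, which depends on the edge.\<close>

lemma dependency_graph_nonzero:
  fixes h :: "real ^ 'n \<Rightarrow> real ^ 'm"
  assumes der: "\<And>x. (h has_derivative (\<lambda>y. C x *v y)) (at x)"
    and nz: "dependency_graph h $ i $ m \<noteq> 0"
  obtains x where "C x $ i $ m \<noteq> 0"
proof (rule ccontr)
  assume "\<not> thesis"
  with that have zero: "C x $ i $ m = 0" for x by blast
  have line: "h x $ i = h (x + s *\<^sub>R axis m 1) $ i" for x s
  proof -
    define g where "g = (\<lambda>s::real. h (x + s *\<^sub>R axis m 1) $ i)"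
    have "(g has_real_derivative 0) (at s)" for s
    proof -
      have "((\<lambda>s. h (x + s *\<^sub>R axis m 1)) has_derivative (\<lambda>r. C (x + s *\<^sub>R axis m 1) *v (r *\<^sub>R axis m 1))) (at s)"
        by (rule has_derivative_compose[OF _ der, of "\<lambda>s. x + s *\<^sub>R axis m 1"])
          (auto intro!: derivative_eq_intros)
      hence "(g has_derivative (\<lambda>r. (C (x + s *\<^sub>R axis m 1) *v (r *\<^sub>R axis m 1)) $ i)) (at s)"
        unfolding g_def by (rule bounded_linear.has_derivative[OF bounded_linear_vec_nth])
      moreover have "(C (x + s *\<^sub>R axis m 1) *v (r *\<^sub>R axis m 1)) $ i = 0" for r
        using zero[of "x + s *\<^sub>R axis m 1"]
        by (auto simp: matrix_vector_mult_def axis_def intro!: sum.neutral)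
      ultimately have "(g has_derivative (\<lambda>r. 0)) (at s)" by simp
      thus ?thesis
        by (simp add: has_field_derivative_def lambda_zero[symmetric])
    qed
    hence "g 0 = g s"
      using DERIV_isconst_all by blast
    thus ?thesis by (simp add: g_def)
  qed
  \<comment> \<open>The coordinate \<open>m\<close> is overwritten by 0, so the undefined value of
    the restricted function there never enters; the point obtained lies on the line through
    \<open>x\<close> parallel to axis \<open>m\<close>.\<close>
  define hbar where "hbar = (\<lambda>r. h (\<chi> k. if k = m then 0 else r k) $ i)"
  have "h x $ i = hbar (restrict (\<lambda>k. x $ k) (- {m}))" for x
  proof -
    have "x + (- x $ m) *\<^sub>R axis m 1 = (\<chi> k. if k = m then 0 else restrict (\<lambda>k. x $ k) (- {m}) k)"
      by (auto simp: vec_eq_iff axis_def)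
    thus ?thesis
      using line[of x "- x $ m"] by (simp add: hbar_def)
  qed
  hence "dependency_graph h $ i $ m = 0"
    by (auto simp: dependency_graph_def)
  with nz show False by simp
qed

lemma permutation_matrix_orthogonal:
  fixes P :: "real ^ 'n ^ 'n"
  assumes P: "P = (\<chi> i j. if j = \<pi> i then 1 else 0)" and \<pi>: "bij \<pi>"
  shows "P ** transpose P = mat 1" "transpose P ** P = mat 1"
proof -
  have "(P ** transpose P) $ a $ b = mat 1 $ a $ b" for a b
  proof -
    have "(P ** transpose P) $ a $ b = mat 1 $ \<pi> a $ \<pi> b"
      using permutation_conj_nth[OF P, of "mat 1" a b] by simp
    thus ?thesis
      using inj_eq[OF bij_is_inj[OF \<pi>], of a b] by (simp add: mat_def)
  qed
  thus *: "P ** transpose P = mat 1"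
    by (simp add: vec_eq_iff)
  show "transpose P ** P = mat 1"
    using * matrix_left_right_inverse by blast
qed

text \<open>This isolates what remains once the probabilistic part is done: only a continuous,
  invertible Jacobian and pointwise transport of patterns enter. The inclusion of patterns needs the
  transversal at 0 alone; preservation concerns all points and goes through domination.\<close>

theorem pattern_identification:
  fixes v :: "real ^ 'n \<Rightarrow> real ^ 'n"
  assumes der: "\<And>u. (v has_derivative (\<lambda>y. J u *v y)) (at u)"
    and cont: "\<And>i j. continuous_on UNIV (\<lambda>u. J u $ i $ j)"
    and inv: "\<And>u. invertible (J u)"
    and tr: "\<And>u. transports_pattern G H (J u)"
    and bin: "binary_matrix G" "binary_matrix H"
  obtains \<pi> P where "bij \<pi>" "P = (\<chi> i j. if j = \<pi> i then 1 else 0)"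
    "pattern_le (P ** G ** transpose P) H"
    "norm0 H \<le> norm0 G \<Longrightarrow> H = P ** G ** transpose P"
    "norm0 H \<le> norm0 G \<Longrightarrow> preserving_map G (\<lambda>x. v (P *v x))"
    "norm0 H \<le> norm0 G \<Longrightarrow> preserving_map (transpose G) (\<lambda>x. v (P *v x))"
proof -
  obtain \<sigma> where \<sigma>: "bij \<sigma>" "\<And>i. J 0 $ i $ \<sigma> i \<noteq> 0"
    using invertible_imp_nonzero_transversal[OF inv] by blast
  \<comment> \<open>The inverse is taken because row \<open>\<pi> a\<close> of \<open>J 0\<close>
    has its transversal entry in column \<open>a\<close>; this makes
    \<open>P ** G ** transpose P\<close> the relabelling that fits under \<open>H\<close>.\<close>
  define \<pi> where "\<pi> = Hilbert_Choice.inv \<sigma>"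
  define P :: "real ^ 'n ^ 'n" where P: "P = (\<chi> i j. if j = \<pi> i then 1 else 0)"
  have \<pi>: "bij \<pi>"
    using \<sigma>(1) by (simp add: \<pi>_def bij_imp_bij_inv)
  have \<sigma>\<pi>: "\<sigma> (\<pi> k) = k" "\<pi> (\<sigma> k) = k" for k
    using \<sigma>(1) by (simp_all add: \<pi>_def bij_is_surj surj_f_inv_f bij_is_inj)
  have le: "pattern_le (P ** G ** transpose P) H"
    unfolding pattern_le_def permutation_conj_nth[OF P]
  proof (intro allI impI)
    fix a b assume "G $ \<pi> a $ \<pi> b \<noteq> 0"
    thus "H $ a $ b \<noteq> 0"
      using tr[of 0] \<sigma>(2)[of "\<pi> a"] \<sigma>(2)[of "\<pi> b"] unfolding transports_pattern_def \<sigma>\<pi> by blast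
  qed
  have eq: "H = P ** G ** transpose P" if "norm0 H \<le> norm0 G"
    using bin that
    by (intro pattern_le_imp_eq[symmetric] le)
      (auto simp: norm0_permutation_conj[OF P \<pi>] binary_matrix_def permutation_conj_nth[OF P])
  \<comment> \<open>\<open>C\<close> is the Jacobian of \<open>v \<circ> P\<close>. Its column
    \<open>m\<close> is column \<open>\<sigma> m\<close> of \<open>J\<close>, so its diagonal at 0
    is the chosen transversal, as the propagation argument requires of its starting point.\<close>
  define C where "C = (\<lambda>x. J (P *v x) ** P)"
  have C_nth: "C x $ i $ m = J (P *v x) $ i $ \<sigma> m" for x i m
  proof -
    have "C x $ i $ m = (\<Sum>k\<in>UNIV. J (P *v x) $ i $ k * (if m = \<pi> k then 1 else 0))"
      by (simp add: C_def matrix_matrix_mult_def P)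
    also have "\<dots> = (\<Sum>k\<in>UNIV. if k = \<sigma> m then J (P *v x) $ i $ k else 0)"
      by (intro sum.cong) (auto simp: \<sigma>\<pi>)
    finally show ?thesis by simp
  qed
  have der_C: "((\<lambda>x. v (P *v x)) has_derivative (\<lambda>y. C x *v y)) (at x)" for x
    unfolding C_def matrix_vector_mul_assoc[symmetric]
    by (rule has_derivative_compose[OF _ der])
      (simp add: bounded_linear_imp_has_derivative)
  have dom: "dominated G i m"
    if small: "norm0 H \<le> norm0 G" and nz: "dependency_graph (\<lambda>x. v (P *v x)) $ i $ m \<noteq> 0" for i m
  proof -
    obtain x where x: "C x $ i $ m \<noteq> 0"
      using dependency_graph_nonzero[OF der_C nz] by blast
    show ?thesis
    proof (rule transports_pattern_self_dominated[of C _ 0, OF _ _ _ _ x])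
      show "continuous_on UNIV (\<lambda>x. C x $ i $ j)" for i j
        unfolding C_nth
        by (rule continuous_on_compose2[OF cont]) (auto intro!: linear_continuous_on)
      show "invertible (C x)" for x
      proof -
        have "invertible P"
          using permutation_matrix_orthogonal[OF P \<pi>] unfolding invertible_def by blast
        thus ?thesis
          unfolding C_def using inv by (intro invertible_mult) auto
      qed
      show "transports_pattern G G (C x)" for x
        unfolding transports_pattern_def
      proof (intro allI impI)
        fix i j k l assume "C x $ i $ k \<noteq> 0" "C x $ j $ l \<noteq> 0" "G $ i $ j \<noteq> 0"
        hence "H $ \<sigma> k $ \<sigma> l \<noteq> 0"
          using tr[of "P *v x"] unfolding transports_pattern_def C_nth by blast
        thus "G $ k $ l \<noteq> 0"
          by (simp add: eq[OF small] permutation_conj_nth[OF P] \<sigma>\<pi>)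
      qed
      show "C 0 $ i $ i \<noteq> 0" for i
        using \<sigma>(2) by (simp add: C_nth)
    qed
  qed
  show thesis
  proof (rule that[OF \<pi> P le eq])
    assume small: "norm0 H \<le> norm0 G"
    show "preserving_map G (\<lambda>x. v (P *v x))"
      unfolding preserving_map_def
      by (rule preserving_matrixI) (use dom[OF small] in \<open>auto simp: dominated_def\<close>)
    show "preserving_map (transpose G) (\<lambda>x. v (P *v x))"
      unfolding preserving_map_def
      by (rule preserving_matrixI) (use dom[OF small] in \<open>auto simp: dominated_def transpose_def\<close>)
  qed
qed

section \<open>Maps of class \<open>C\<^sup>1\<close>\<close>

lemma Ck_open_1_iff:
  "Ck_open 1 U f \<longleftrightarrow>
     (\<forall>x\<in>U. f differentiable (at x)) \<and> (\<forall>h. continuous_on U (\<lambda>x. frechet_derivative f (at x) h))"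
  by (simp add: One_nat_def)

lemma Ck_on_UNIV_iff: "Ck_on k UNIV f \<longleftrightarrow> Ck_open k UNIV f"
proof
  assume "Ck_on k UNIV f"
  then obtain U g where "UNIV \<subseteq> U" "Ck_open k U g" "\<forall>x. g x = f x"
    unfolding Ck_on_def by auto
  hence "U = UNIV" "g = f" by auto
  thus "Ck_open k UNIV f" using \<open>Ck_open k U g\<close> by simp
qed (auto simp: Ck_on_def)

lemma Ck_open_1_imp_continuous_on: "Ck_open 1 U f \<Longrightarrow> continuous_on U f"
  unfolding Ck_open_1_iff
  by (meson continuous_at_imp_continuous_on differentiable_imp_continuous_within)

text \<open>The class is defined by continuity of the derivative in each fixed direction, whereas
  the chain rule evaluates the derivative of \<open>g\<close> in a direction that moves with
  \<open>x\<close>. Expanding that direction in the basis leaves a finite sum of products of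
  continuous functions.\<close>

lemma Ck_open_1_compose:
  assumes g: "Ck_open 1 U g" and f: "Ck_open 1 V f" and sub: "f ` V \<subseteq> U"
  shows "Ck_open 1 V (\<lambda>x. g (f x))"
  unfolding Ck_open_1_iff
proof (intro conjI ballI allI)
  have der: "((\<lambda>x. g (f x)) has_derivative
      (\<lambda>h. frechet_derivative g (at (f x)) (frechet_derivative f (at x) h))) (at x)" if "x \<in> V" for x
    using that g f sub unfolding Ck_open_1_iff
    by (intro has_derivative_compose[of f _ x UNIV g]) (auto simp: frechet_derivative_works)
  show "(\<lambda>x. g (f x)) differentiable (at x)" if "x \<in> V" for x
    using der[OF that] differentiable_def by blast
  fix h
  have "continuous_on V (\<lambda>x. \<Sum>b\<in>Basis. (frechet_derivative f (at x) h \<bullet> b) *\<^sub>R frechet_derivative g (at (f x)) b)"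
    using f g sub Ck_open_1_imp_continuous_on[OF f] unfolding Ck_open_1_iff
    by (intro continuous_on_sum continuous_on_scaleR continuous_on_inner continuous_on_const)
       (auto intro: continuous_on_compose2[of U "\<lambda>y. frechet_derivative g (at y) _"])
  moreover have "frechet_derivative (\<lambda>x. g (f x)) (at x) h =
      (\<Sum>b\<in>Basis. (frechet_derivative f (at x) h \<bullet> b) *\<^sub>R frechet_derivative g (at (f x)) b)" if "x \<in> V" for x
  proof -
    have "linear (frechet_derivative g (at (f x)))"
      using g sub that unfolding Ck_open_1_iff by (intro linear_frechet_derivative) auto
    hence "frechet_derivative g (at (f x)) (\<Sum>b\<in>Basis. (y \<bullet> b) *\<^sub>R b) =
        (\<Sum>b\<in>Basis. (y \<bullet> b) *\<^sub>R frechet_derivative g (at (f x)) b)" for y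
      by (simp add: linear_sum linear_scale)
    hence "frechet_derivative g (at (f x)) y =
        (\<Sum>b\<in>Basis. (y \<bullet> b) *\<^sub>R frechet_derivative g (at (f x)) b)" for y
      unfolding euclidean_representation .
    thus ?thesis
      unfolding frechet_derivative_at[OF der[OF that], symmetric] .
  qed
  ultimately show "continuous_on V (\<lambda>x. frechet_derivative (\<lambda>x. g (f x)) (at x) h)"
    by (simp cong: continuous_on_cong)
qed

lemma Ck_open_1_linear:
  assumes "bounded_linear f"
  shows "Ck_open 1 UNIV f"
proof -
  have "frechet_derivative f (at x) = f" for x
    by (rule frechet_derivative_at[OF bounded_linear_imp_has_derivative[OF assms], symmetric])
  thus ?thesis
    unfolding Ck_open_1_iff using assms bounded_linear_imp_differentiable by auto
qed

section \<open>Diffeomorphisms of the whole space\<close>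

lemma diffeomorphism_UNIV_iff:
  "diffeomorphism UNIV UNIV v \<longleftrightarrow> bij v \<and> Ck_open 1 UNIV v \<and> Ck_open 1 UNIV (inv v)"
  by (auto simp: diffeomorphism_def Ck_on_UNIV_iff)

lemma diffeomorphism_UNIVD:
  assumes "diffeomorphism UNIV UNIV v"
  shows "bij v" "Ck_open 1 UNIV v" "Ck_open 1 UNIV (inv v)"
  using assms unfolding diffeomorphism_UNIV_iff by blast+

lemma diffeomorphism_UNIV_compose:
  assumes "diffeomorphism UNIV UNIV f" "diffeomorphism UNIV UNIV g"
  shows "diffeomorphism UNIV UNIV (\<lambda>x. f (g x))"
proof -
  note f = diffeomorphism_UNIVD[OF assms(1)] and g = diffeomorphism_UNIVD[OF assms(2)]
  have "inv (\<lambda>x. f (g x)) = (\<lambda>x. inv g (inv f x))"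
    using o_inv_distrib[OF f(1) g(1)] by (simp add: o_def)
  moreover have "bij (\<lambda>x. f (g x))"
    using bij_comp[OF g(1) f(1)] by (simp add: o_def)
  moreover have "Ck_open 1 UNIV (\<lambda>x. f (g x))" "Ck_open 1 UNIV (\<lambda>x. inv g (inv f x))"
    by (rule Ck_open_1_compose[OF f(2) g(2) subset_UNIV] Ck_open_1_compose[OF g(3) f(3) subset_UNIV])+
  ultimately show ?thesis
    unfolding diffeomorphism_UNIV_iff by (simp only:)
qed

text \<open>The image of \<open>f\<close> need not be open, so \<open>inv f\<close> is of class
  \<open>C1\<close> on it only through an extension \<open>g\<close> to an open set. Since
  \<open>f'\<close> takes values in the same image, \<open>g \<circ> f'\<close> is the desired map
  on the whole space.\<close>

lemma Ck_open_1_inv_compose: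
  assumes f: "diffeomorphism UNIV (range f) f" and f': "diffeomorphism UNIV (range f') f'"
    and range: "range f = range f'"
  shows "Ck_open 1 UNIV (inv f \<circ> f')"
proof -
  obtain U g where g: "range f \<subseteq> U" "Ck_open 1 U g" "\<forall>x\<in>range f. g x = inv f x"
    using f unfolding diffeomorphism_def Ck_on_def by auto
  have "Ck_open 1 UNIV f'"
    using f' unfolding diffeomorphism_def Ck_on_UNIV_iff by blast
  moreover have "range f' \<subseteq> U"
    using g(1) unfolding range .
  ultimately have "Ck_open 1 UNIV (\<lambda>x. g (f' x))"
    by (rule Ck_open_1_compose[OF g(2)])
  moreover have "g (f' x) = inv f (f' x)" for x
    using g(3) unfolding range by blast
  ultimately show ?thesis
    by (simp add: o_def)
qed

lemma diffeomorphism_inv_compose: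
  assumes f: "diffeomorphism UNIV (range f) f" and f': "diffeomorphism UNIV (range f') f'"
    and range: "range f = range f'"
  shows "diffeomorphism UNIV UNIV (inv f \<circ> f')"
proof -
  have inj: "inj f" "inj f'"
    using f f' by (auto simp: diffeomorphism_def bij_betw_def)
  have *: "inv f' (f (inv f (f' x))) = x" "inv f (f' (inv f' (f y))) = y" for x y
  proof -
    have "f' x \<in> range f" "f y \<in> range f'" using range by auto
    thus "inv f' (f (inv f (f' x))) = x" "inv f (f' (inv f' (f y))) = y"
      using inj by (simp_all add: f_inv_into_f)
  qed
  have bij: "bij (inv f \<circ> f')"
    by (rule o_bij[of "inv f' \<circ> f"]) (auto simp: fun_eq_iff *)
  moreover have "inv (inv f \<circ> f') = inv f' \<circ> f"
    by (rule inv_unique_comp) (auto simp: fun_eq_iff *)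
  ultimately show ?thesis
    unfolding diffeomorphism_UNIV_iff
    using Ck_open_1_inv_compose[OF assms] Ck_open_1_inv_compose[OF f' f range[symmetric]] by simp
qed

section \<open>The Jacobian of a diffeomorphism\<close>

context
  fixes v :: "real ^ 'n \<Rightarrow> real ^ 'n"
  assumes v: "diffeomorphism UNIV UNIV v"
begin

lemma diffeomorphism_has_derivative: "(v has_derivative (\<lambda>h. jacobian v (at u) *v h)) (at u)"
  using diffeomorphism_UNIVD(2)[OF v] unfolding Ck_open_1_iff jacobian_works by blast

lemma diffeomorphism_continuous_jacobian: "continuous_on UNIV (\<lambda>u. jacobian v (at u) $ i $ j)"
proof -
  have "continuous_on UNIV (\<lambda>u. frechet_derivative v (at u) (axis j 1) $ i)"
    using diffeomorphism_UNIVD(2)[OF v] unfolding Ck_open_1_iff by (intro continuous_on_component) blast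
  thus ?thesis
    by (simp add: jacobian_def matrix_def)
qed

lemma diffeomorphism_continuous_on: "continuous_on S v"
  by (rule continuous_on_subset[OF Ck_open_1_imp_continuous_on[OF diffeomorphism_UNIVD(2)[OF v]] subset_UNIV])

text \<open>The chain rule for \<open>inv v \<circ> v\<close> exhibits the Jacobian of
  \<open>inv v\<close> at \<open>v u\<close> as a left inverse.\<close>

lemma diffeomorphism_invertible_jacobian: "invertible (jacobian v (at u))"
proof -
  have "(inv v has_derivative (\<lambda>h. jacobian (inv v) (at (v u)) *v h)) (at (v u))"
    using diffeomorphism_UNIVD(3)[OF v] unfolding Ck_open_1_iff jacobian_works by blast
  from has_derivative_compose[OF diffeomorphism_has_derivative this]
  have "((\<lambda>x. inv v (v x)) has_derivative
      (\<lambda>h. jacobian (inv v) (at (v u)) *v (jacobian v (at u) *v h))) (at u)" .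
  moreover have "(\<lambda>x. inv v (v x)) = (\<lambda>x. x)"
    using v by (auto simp: diffeomorphism_UNIV_iff bij_is_inj)
  ultimately have "(\<lambda>h. jacobian (inv v) (at (v u)) *v (jacobian v (at u) *v h)) = (\<lambda>h. h)"
    using has_derivative_unique[OF _ has_derivative_ident] by metis
  hence "(jacobian (inv v) (at (v u)) ** jacobian v (at u)) *v h = mat 1 *v h" for h
    by (simp add: matrix_vector_mul_assoc[symmetric] fun_eq_iff)
  hence "jacobian (inv v) (at (v u)) ** jacobian v (at u) = mat 1"
    using matrix_eq by blast
  thus ?thesis
    using invertible_left_inverse by blast
qed

lemma diffeomorphism_det_jacobian_nonzero: "det (jacobian v (at u)) \<noteq> 0"
  using diffeomorphism_invertible_jacobian invertible_det_nz by blast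

lemma diffeomorphism_continuous_det: "continuous_on UNIV (\<lambda>u. det (jacobian v (at u)))"
  unfolding det_def
  by (intro continuous_on_sum continuous_on_mult continuous_on_prod continuous_on_const
      diffeomorphism_continuous_jacobian)

end


section \<open>The Hessian of the log-density\<close>

lemma differentiable_compose_at:
  assumes "f differentiable (at x)" "g differentiable (at (f x))"
  shows "(\<lambda>x. g (f x)) differentiable (at x)"
  using differentiable_chain_at[OF assms] by (simp add: o_def)

lemma partial_deriv_eq:
  assumes "(F has_derivative F') (at x)"
  shows "partial_deriv b F x = F' b"
proof -
  have "((\<lambda>h. F (x + h *\<^sub>R b)) has_derivative (\<lambda>h. F' (h *\<^sub>R b))) (at 0)"
    by (rule has_derivative_compose[of "\<lambda>h. x + h *\<^sub>R b"])
      (use assms in \<open>auto intro!: derivative_eq_intros\<close>)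
  moreover have "(\<lambda>h. F' (h *\<^sub>R b)) = (*) (F' b)"
    using has_derivative_linear[OF assms] by (auto simp: linear_scale)
  ultimately show ?thesis
    unfolding partial_deriv_def by (intro DERIV_imp_deriv) (simp add: has_field_derivative_def)
qed

text \<open>The derivative \<open>L\<close> of \<open>\<iota>\<close> is the same at every point, so
  the partial derivative in \<open>y\<close> is the derivative of \<open>g\<close> in the fixed
  direction \<open>L (1, 0)\<close>, which is again differentiable. The map \<open>\<iota>\<close>
  covers both smoothness cases: it appends a fixed action sequence in the continuous case and is the
  identity in the discrete one.\<close>

lemma C2_affine_partial:
  fixes g :: "'c::euclidean_space \<Rightarrow> real" and \<iota> :: "real \<times> 'b::euclidean_space \<Rightarrow> 'c"
  assumes g: "Ck_open 2 U g" and \<iota>: "\<And>p. \<iota> p \<in> U" "\<And>p. (\<iota> has_derivative L) (at p)"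
  obtains D where "\<And>p. (\<lambda>p. g (\<iota> p)) differentiable (at p)" "\<And>p. D differentiable (at p)"
    "\<And>y z. ((\<lambda>y. g (\<iota> (y, z))) has_real_derivative D (y, z)) (at y)"
proof
  have C2: "g differentiable (at x)" "(\<lambda>x. frechet_derivative g (at x) h) differentiable (at x)"
    if "x \<in> U" for x h
    using g that by (simp_all add: numeral_2_eq_2)
  have der: "((\<lambda>p. g (\<iota> p)) has_derivative (\<lambda>h. frechet_derivative g (at (\<iota> p)) (L h))) (at p)" for p
    using C2(1)[OF \<iota>(1)] unfolding frechet_derivative_works
    by (rule has_derivative_compose[OF \<iota>(2)])
  show "(\<lambda>p. g (\<iota> p)) differentiable (at p)" for p
    using der differentiable_def by blast
  let ?D = "\<lambda>p. frechet_derivative g (at (\<iota> p)) (L (1, 0))"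
  have "\<iota> differentiable (at p)" for p
    using \<iota>(2) differentiable_def by blast
  thus "?D differentiable (at p)" for p
    using differentiable_compose_at[of \<iota> p "\<lambda>x. frechet_derivative g (at x) (L (1, 0))"] C2(2)[OF \<iota>(1)] by blast
  fix y z
  have "((\<lambda>y. g (\<iota> (y, z))) has_derivative (\<lambda>h. frechet_derivative g (at (\<iota> (y, z))) (L (h, 0)))) (at y)"
    by (rule has_derivative_compose[OF _ der]) (auto intro!: derivative_eq_intros)
  moreover have "(\<lambda>h. frechet_derivative g (at (\<iota> (y, z))) (L (h, 0))) = (*) (?D (y, z))"
  proof
    fix h
    have "linear (\<lambda>h. frechet_derivative g (at (\<iota> (y, z))) (L h))"
      using der has_derivative_linear by blast
    from linear_scale[OF this, of h "(1, 0)"]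
    show "frechet_derivative g (at (\<iota> (y, z))) (L (h, 0)) = ?D (y, z) * h"
      by simp
  qed
  ultimately show "((\<lambda>y. g (\<iota> (y, z))) has_real_derivative ?D (y, z)) (at y)"
    by (simp only: has_field_derivative_def)
qed

text \<open>For fixed \<open>a\<close> all points \<open>(y, z, a)\<close> lie in the open domain of
  the extension. Differentiability in \<open>(y, z)\<close> is therefore the ordinary one, even when
  entries of \<open>a\<close> are boundary points of the action set.\<close>

lemma smooth_model_factor:
  fixes M :: "('z::finite, 'x::finite, 'a::finite, 't::{finite,linorder}) latent_model"
  assumes smooth: "smooth_model A M" and a: "a \<in> actions_before A t"
  obtains D where "\<And>p. (\<lambda>(y, z). factor M t i y z a) differentiable (at p)"
    "\<And>p. D differentiable (at p)"
    "\<And>y z. ((\<lambda>y. factor M t i y z a) has_real_derivative D (y, z)) (at y)"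
  using smooth unfolding smooth_model_def
proof (elim disjE conjE)
  assume "\<forall>t i. Ck_on 2 (UNIV \<times> UNIV \<times> actions_before A t) (\<lambda>(y, z, a). factor M t i y z a)"
  then obtain U g where g: "UNIV \<times> UNIV \<times> actions_before A t \<subseteq> U" "Ck_open 2 U g"
    "\<forall>x\<in>UNIV \<times> UNIV \<times> actions_before A t. g x = (\<lambda>(y, z, a). factor M t i y z a) x"
    unfolding Ck_on_def by blast
  let ?\<iota> = "\<lambda>p :: real \<times> ('z, 't) trajectory. (fst p, snd p, a)"
  have eq: "g (y, z, a) = factor M t i y z a" for y z
    using g(3) a by auto
  have "(?\<iota> has_derivative (\<lambda>p. (fst p, snd p, 0))) (at p)" for p
    by (auto intro!: derivative_eq_intros)
  from C2_affine_partial[OF g(2) _ this] g(1) a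
  obtain D where "\<And>p. (\<lambda>p. g (?\<iota> p)) differentiable (at p)" "\<And>p. D differentiable (at p)"
    "\<And>y z. ((\<lambda>y. g (?\<iota> (y, z))) has_real_derivative D (y, z)) (at y)"
    by blast
  moreover have "(\<lambda>p. g (?\<iota> p)) = (\<lambda>(y, z). factor M t i y z a)"
    by (auto simp: eq)
  ultimately show thesis
    using that[of D] by (simp add: eq)
next
  assume "\<forall>t i. \<forall>a \<in> actions_before A t. Ck_on 2 UNIV (\<lambda>(y, z). factor M t i y z a)"
  hence "Ck_open 2 UNIV (\<lambda>(y, z). factor M t i y z a)"
    using a by (auto simp: Ck_on_UNIV_iff)
  from C2_affine_partial[OF this _ has_derivative_ident]
  obtain D where "\<And>p. (\<lambda>(y, z). factor M t i y z a) differentiable (at p)" "\<And>p. D differentiable (at p)"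
    "\<And>y z. ((\<lambda>y. (\<lambda>(y, z). factor M t i y z a) (y, z)) has_real_derivative D (y, z)) (at y)"
    by auto
  thus thesis
    using that[of D] by simp
qed

text \<open>The derivative of the log-factor in its own coordinate. As the density factorizes, it is
  the whole partial derivative of the log-density in coordinate \<open>i\<close>, so row
  \<open>i\<close> of the Hessian is the gradient of this function in a column of the
  history.\<close>

definition score ::
  "('z::finite, 'x::finite, 'a::finite, 't::{finite,linorder}) latent_model \<Rightarrow>
    't \<Rightarrow> 'z \<Rightarrow> ('a, 't) trajectory \<Rightarrow> real \<times> ('z, 't) trajectory \<Rightarrow> real" where
  "score M t i a = (\<lambda>(y, z). deriv (\<lambda>y. ln (factor M t i y z a)) y)"

section \<open>Scores and Hessians of one model\<close>

context
  fixes M :: "('z::finite, 'x::finite, 'a::finite, 't::{finite,linorder}) latent_model"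
    and A :: "(real ^ 'a) set"
  assumes M: "graphical_model A M" "smooth_model A M"
begin

lemma factor_pos: "a \<in> actions_before A t \<Longrightarrow> factor M t i y z a > 0"
  using M(1) unfolding graphical_model_def by blast

lemma factor_cong:
  assumes "a \<in> actions_before A t" "a' \<in> actions_before A t"
    "\<And>s j. s < t \<Longrightarrow> Gz M $ i $ j \<noteq> 0 \<Longrightarrow> z $ s $ j = z' $ s $ j" "\<And>s. s \<le> t \<Longrightarrow> a $ s = a' $ s"
  shows "factor M t i y z a = factor M t i y z' a'"
proof -
  have "(\<forall>s<t. \<forall>j. Gz M $ i $ j = 1 \<longrightarrow> z $ s $ j = z' $ s $ j) \<longrightarrow>
        (\<forall>s\<le>t. \<forall>l. Ga M $ i $ l = 1 \<longrightarrow> a $ s $ l = a' $ s $ l) \<longrightarrow>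
        factor M t i y z a = factor M t i y z' a'"
    using M(1) assms(1,2) unfolding graphical_model_def by blast
  thus ?thesis
    using assms(3,4) by auto
qed

lemma trans_density_cong:
  assumes "a \<in> actions_before A t" "a' \<in> actions_before A t"
    "\<And>s. s < t \<Longrightarrow> z $ s = z' $ s" "\<And>s. s \<le> t \<Longrightarrow> a $ s = a' $ s"
  shows "trans_density M t w z a = trans_density M t w z' a'"
  unfolding trans_density_def using assms by (intro prod.cong factor_cong) auto

lemma trans_density_pos: "a \<in> actions_before A t \<Longrightarrow> trans_density M t w z a > 0"
  unfolding trans_density_def by (intro prod_pos) (auto simp: factor_pos)

lemma ln_trans_density:
  "a \<in> actions_before A t \<Longrightarrow> ln (trans_density M t w z a) = (\<Sum>i\<in>UNIV. ln (factor M t i (w $ i) z a))"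
  unfolding trans_density_def using factor_pos[of a t] by (intro ln_prod) (metis less_irrefl UNIV_I finite)+

context
  fixes a :: "('a, 't) trajectory" and t :: 't
  assumes a: "a \<in> actions_before A t"
begin

lemma factor_differentiable: "(\<lambda>(y, z). factor M t i y z a) differentiable (at p)"
  using smooth_model_factor[OF M(2) a] by metis

lemma score_works:
  "((\<lambda>y. ln (factor M t i y z a)) has_real_derivative score M t i a (y, z)) (at y)"
  "score M t i a differentiable (at p)"
proof -
  obtain D where D: "\<And>p. (\<lambda>(y, z). factor M t i y z a) differentiable (at p)"
    "\<And>p. D differentiable (at p)"
    "\<And>y z. ((\<lambda>y. factor M t i y z a) has_real_derivative D (y, z)) (at y)"
    using smooth_model_factor[OF M(2) a] by metis
  have *: "((\<lambda>y. ln (factor M t i y z a)) has_real_derivative D (y, z) / factor M t i y z a) (at y)" for y z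
    using D(3)[of z y] factor_pos[OF a, of i y z] by (auto intro!: derivative_eq_intros)
  hence eq: "score M t i a (y, z) = D (y, z) / factor M t i y z a" for y z
    by (simp add: score_def DERIV_imp_deriv)
  show "((\<lambda>y. ln (factor M t i y z a)) has_real_derivative score M t i a (y, z)) (at y)"
    using * by (simp add: eq)
  have "(\<lambda>p. D p / (\<lambda>(y, z). factor M t i y z a) p) differentiable (at p)"
    using D(1,2) factor_pos[OF a, of i "fst p" "snd p"]
    by (intro differentiable_divide) (auto simp: case_prod_beta[of _ p])
  moreover have "(\<lambda>p. D p / (\<lambda>(y, z). factor M t i y z a) p) = score M t i a"
    by (auto simp: eq)
  ultimately show "score M t i a differentiable (at p)" by simp
qed

lemma ln_trans_density_has_derivative:
  "((\<lambda>w. ln (trans_density M t w z a)) has_derivative (\<lambda>h. \<Sum>i\<in>UNIV. score M t i a (w $ i, z) * h $ i)) (at w)"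
  unfolding ln_trans_density[OF a]
proof (intro has_derivative_sum)
  fix i
  have "((\<lambda>y. ln (factor M t i y z a)) has_derivative (*) (score M t i a (w $ i, z))) (at (w $ i))"
    using score_works(1) by (simp add: has_field_derivative_def)
  from has_derivative_compose[OF bounded_linear.has_derivative[OF bounded_linear_vec_nth has_derivative_ident] this]
  show "((\<lambda>w. ln (factor M t i (w $ i) z a)) has_derivative (\<lambda>h. score M t i a (w $ i, z) * h $ i)) (at w)" .
qed

lemma hessian_zz_nth:
  "hessian_zz M t \<tau> w z a $ i $ j = partial_deriv (axis \<tau> (axis j 1)) (\<lambda>z. score M t i a (w $ i, z)) z"
proof -
  have "partial_deriv (axis i 1) (\<lambda>w. ln (trans_density M t w z a)) w = score M t i a (w $ i, z)" for z
    unfolding partial_deriv_eq[OF ln_trans_density_has_derivative]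
    by (simp add: axis_def mult_delta_right)
  thus ?thesis
    by (simp add: hessian_zz_def)
qed

text \<open>If \<open>Gz M $ i $ j = 0\<close>, moving coordinate \<open>j\<close> of column
  \<open>\<tau>\<close> does not change factor \<open>i\<close>, so the score is constant in that
  direction.\<close>

lemma hessian_zz_mem_masked_space:
  assumes "\<tau> < t"
  shows "hessian_zz M t \<tau> w z a \<in> masked_space (Gz M)"
  unfolding masked_space_def mem_Collect_eq
proof (intro allI impI)
  fix i j assume G: "Gz M $ i $ j = 0"
  have "factor M t i y (z + h *\<^sub>R axis \<tau> (axis j 1)) a = factor M t i y z a" for y h
    by (rule factor_cong[OF a a]) (use G in \<open>auto simp: axis_def\<close>)
  hence "score M t i a (y, z + h *\<^sub>R axis \<tau> (axis j 1)) = score M t i a (y, z)" for y h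
    by (simp add: score_def)
  thus "hessian_zz M t \<tau> w z a $ i $ j = 0"
    by (simp add: hessian_zz_nth partial_deriv_def)
qed

lemma score_has_derivative_history:
  "((\<lambda>z. score M t i a (y, z)) has_derivative frechet_derivative (\<lambda>z. score M t i a (y, z)) (at z)) (at z)"
proof -
  have "(\<lambda>z. score M t i a (y, z)) differentiable (at z)"
  proof (rule differentiable_compose_at[OF _ score_works(2)])
    have "((\<lambda>z. (y, z)) has_derivative (\<lambda>h. (0, h))) (at z)"
      by (intro has_derivative_Pair has_derivative_const has_derivative_ident)
    thus "(\<lambda>z. (y, z)) differentiable (at z)"
      using differentiable_def by blast
  qed
  thus ?thesis
    by (simp add: frechet_derivative_works)
qed

end

end

text \<open>In differences of log-densities over two histories the Jacobian term cancels; this is why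
  \<open>v\<close> need only be once differentiable.\<close>

lemma hessian_zz_change_of_variables:
  fixes M M' :: "('z::finite, 'x::finite, 'a::finite, 't::{finite,linorder}) latent_model"
    and v :: "real ^ 'z \<Rightarrow> real ^ 'z"
  assumes M: "graphical_model A M" "smooth_model A M" and M': "graphical_model A M'" "smooth_model A M'"
    and a: "a \<in> actions_before A t"
    and der: "\<And>u. (v has_derivative (\<lambda>h. J u *v h)) (at u)" and det: "\<And>u. det (J u) \<noteq> 0"
    and eq: "\<And>w z. trans_density M' t w z a = trans_density M t (v w) (\<chi> s. v (z $ s)) a * \<bar>det (J w)\<bar>"
  shows "hessian_zz M' t \<tau> w z a =
    transpose (J w) ** hessian_zz M t \<tau> (v w) (\<chi> s. v (z $ s)) a ** J (z $ \<tau>)"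
proof -
  define V where "V = (\<lambda>z :: ('z, 't) trajectory. \<chi> s. v (z $ s))"
  define S where "S = (\<lambda>k z. score M t k a (v w $ k, z))"
  have ln_eq: "ln (trans_density M' t w z a) = ln (trans_density M t (v w) (V z) a) + ln \<bar>det (J w)\<bar>" for w z
    unfolding eq V_def using ln_mult_pos[OF trans_density_pos[OF M a], of "\<bar>det (J w)\<bar>"] det[of w] by simp
  have derM: "((\<lambda>w. ln (trans_density M t (v w) z a)) has_derivative
      (\<lambda>h. \<Sum>k\<in>UNIV. S k z * (J w *v h) $ k)) (at w)" for z
    unfolding S_def by (rule has_derivative_compose[OF der ln_trans_density_has_derivative[OF M a]])
  \<comment> \<open>The zero history is an arbitrary fixed reference. The same difference of
    log-densities is differentiated in \<open>w\<close> once on each side of the identity, and the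
    two derivatives are compared on axis \<open>i\<close>.\<close>
  have score': "score M' t i a (w $ i, z) - score M' t i a (w $ i, 0) =
      (\<Sum>k\<in>UNIV. (S k (V z) - S k (V 0)) * J w $ k $ i)" for i z
  proof -
    define F where "F = (\<lambda>w. ln (trans_density M' t w z a) - ln (trans_density M' t w 0 a))"
    define D where "D = (\<lambda>h :: real ^ 'z. \<Sum>i\<in>UNIV. (score M' t i a (w $ i, z) - score M' t i a (w $ i, 0)) * h $ i)"
    define D2 where "D2 = (\<lambda>h. \<Sum>k\<in>UNIV. (S k (V z) - S k (V 0)) * (J w *v h) $ k)"
    have "(F has_derivative D) (at w)"
      unfolding F_def D_def left_diff_distrib sum_subtractf
      by (intro has_derivative_diff ln_trans_density_has_derivative[OF M' a])
    moreover have "F = (\<lambda>w. ln (trans_density M t (v w) (V z) a) - ln (trans_density M t (v w) (V 0) a))"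
    proof
      fix w show "F w = ln (trans_density M t (v w) (V z) a) - ln (trans_density M t (v w) (V 0) a)"
        using ln_eq[of w z] ln_eq[of w 0] unfolding F_def by linarith
    qed
    hence "(F has_derivative D2) (at w)"
      unfolding D2_def left_diff_distrib sum_subtractf by (simp only:) (intro has_derivative_diff derM)
    ultimately have "D (axis i 1) = D2 (axis i 1)"
      using has_derivative_unique by metis
    moreover have "D (axis i 1) = score M' t i a (w $ i, z) - score M' t i a (w $ i, 0)"
      by (simp add: D_def axis_def mult_delta_right)
    moreover have "D2 (axis i 1) = (\<Sum>k\<in>UNIV. (S k (V z) - S k (V 0)) * J w $ k $ i)"
      by (simp add: D2_def matrix_vector_mult_basis column_def)
    ultimately show ?thesis by simp
  qed
  have "hessian_zz M' t \<tau> w z a $ i $ j =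
    (transpose (J w) ** hessian_zz M t \<tau> (v w) (V z) a ** J (z $ \<tau>)) $ i $ j" for i j
  proof -
    let ?b = "axis \<tau> (axis j 1) :: ('z, 't) trajectory"
    define S' where "S' = (\<lambda>k. frechet_derivative (S k) (at (V z)))"
    have S': "(S k has_derivative S' k) (at (V z))" for k
      unfolding S_def S'_def by (rule score_has_derivative_history[OF M a])
    define H where "H = hessian_zz M t \<tau> (v w) (V z) a"
    have H: "H $ k $ l = S' k (axis \<tau> (axis l 1))" for k l
      unfolding H_def hessian_zz_nth[OF M a] using partial_deriv_eq[OF S'] by (simp add: S_def)
    \<comment> \<open>\<open>V\<close> acts column by column, so its derivative is block
      diagonal.\<close>
    have V': "(V has_derivative (\<lambda>h. \<chi> s. J (z $ s) *v (h $ s))) (at z)"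
      unfolding V_def
    proof (subst has_derivative_componentwise_within, clarify)
      fix b :: "('z, 't) trajectory" assume "b \<in> Basis"
      then obtain s c where b: "b = axis s c" "c \<in> Basis" by (auto simp: Basis_vec_def)
      have "((\<lambda>z. v (z $ s)) has_derivative (\<lambda>h. J (z $ s) *v (h $ s))) (at z)"
        by (rule has_derivative_compose[OF bounded_linear.has_derivative[OF bounded_linear_vec_nth has_derivative_ident] der])
      hence "((\<lambda>z. v (z $ s) \<bullet> c) has_derivative (\<lambda>h. (J (z $ s) *v (h $ s)) \<bullet> c)) (at z)"
        by (rule has_derivative_inner_left)
      thus "((\<lambda>x. (\<chi> s. v (x $ s)) \<bullet> b) has_derivative (\<lambda>x. (\<chi> s. J (z $ s) *v x $ s) \<bullet> b)) (at z)"
        by (simp add: b inner_axis)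
    qed
    have "((\<lambda>z. score M' t i a (w $ i, z)) has_derivative
        (\<lambda>h. \<Sum>k\<in>UNIV. S' k (\<chi> s. J (z $ s) *v (h $ s)) * J w $ k $ i)) (at z)"
    proof -
      have "(\<lambda>z. score M' t i a (w $ i, z)) =
          (\<lambda>z. score M' t i a (w $ i, 0) + (\<Sum>k\<in>UNIV. (S k (V z) - S k (V 0)) * J w $ k $ i))"
      proof
        fix z
        show "score M' t i a (w $ i, z) =
            score M' t i a (w $ i, 0) + (\<Sum>k\<in>UNIV. (S k (V z) - S k (V 0)) * J w $ k $ i)"
          using score'[of i z] by linarith
      qed
      moreover have "((\<lambda>z. S k (V z)) has_derivative (\<lambda>h. S' k (\<chi> s. J (z $ s) *v (h $ s)))) (at z)" for k
        by (rule has_derivative_compose[OF V' S'])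
      hence "((\<lambda>z. score M' t i a (w $ i, 0) + (\<Sum>k\<in>UNIV. (S k (V z) - S k (V 0)) * J w $ k $ i)) has_derivative
          (\<lambda>h. 0 + (\<Sum>k\<in>UNIV. (S' k (\<chi> s. J (z $ s) *v (h $ s)) - 0) * J w $ k $ i))) (at z)"
        by (intro has_derivative_add has_derivative_sum has_derivative_mult_left has_derivative_diff has_derivative_const)
      ultimately show ?thesis
        by simp
    qed
    hence "hessian_zz M' t \<tau> w z a $ i $ j = (\<Sum>k\<in>UNIV. S' k (\<chi> s. J (z $ s) *v (?b $ s)) * J w $ k $ i)"
      unfolding hessian_zz_nth[OF M' a] by (rule partial_deriv_eq)
    also have "\<dots> = (\<Sum>k\<in>UNIV. (\<Sum>l\<in>UNIV. J (z $ \<tau>) $ l $ j * H $ k $ l) * J w $ k $ i)"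
    proof -
      \<comment> \<open>The direction of coordinate \<open>j\<close> in column \<open>\<tau>\<close>
        is sent to column \<open>j\<close> of \<open>J (z $ \<tau>)\<close>, placed at time
        \<open>\<tau>\<close>. Expanding it along the axes expresses the derivative through the
        entries of \<open>H\<close>.\<close>
      have "(\<chi> s. J (z $ s) *v (?b $ s)) = (\<Sum>l\<in>UNIV. J (z $ \<tau>) $ l $ j *\<^sub>R axis \<tau> (axis l 1))"
      proof -
        have "(\<chi> s. J (z $ s) *v (?b $ s)) $ s $ l =
            (\<Sum>l\<in>UNIV. J (z $ \<tau>) $ l $ j *\<^sub>R axis \<tau> (axis l 1)) $ s $ l" for s l
          by (cases "s = \<tau>") (simp_all add: axis_def matrix_vector_mult_def mult_delta_right)
        thus ?thesis
          unfolding vec_eq_iff by blast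
      qed
      hence "S' k (\<chi> s. J (z $ s) *v (?b $ s)) = (\<Sum>l\<in>UNIV. J (z $ \<tau>) $ l $ j * H $ k $ l)" for k
        using has_derivative_linear[OF S', of k] by (simp add: linear_sum linear_scale H)
      thus ?thesis by simp
    qed
    also have "\<dots> = (transpose (J w) ** H ** J (z $ \<tau>)) $ i $ j"
      unfolding matrix_matrix_mult_def transpose_def
      by (simp add: sum_distrib_left sum_distrib_right mult_ac) (rule sum.swap)
    finally show ?thesis by (simp add: H_def)
  qed
  thus ?thesis
    by (simp add: vec_eq_iff V_def)
qed

section \<open>Change of variables\<close>

text \<open>The Leibniz terms correspond under conjugation of permutations by \<open>f\<close>,
  which preserves the sign. The two index types differ, hence the transfer by
  \<open>map_permutation\<close>.\<close>

lemma det_reindex: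
  fixes A :: "real ^ 'n ^ 'n" and f :: "'m::finite \<Rightarrow> 'n"
  assumes "bij f"
  shows "det (\<chi> i j. A $ f i $ f j) = det A"
  unfolding det_def
proof (rule sum.reindex_bij_witness[of _ "map_permutation UNIV (inv f)" "map_permutation UNIV f"])
  have inj: "inj f" "inj (inv f)"
    using assms by (auto simp: bij_is_inj bij_imp_bij_inv)
  have comp: "inv f \<circ> f = id" "f \<circ> inv f = id"
    using assms by (simp_all add: bij_is_inj bij_is_surj flip: surj_iff)
  fix p :: "'m \<Rightarrow> 'm" assume p: "p \<in> {p. p permutes UNIV}"
  show "map_permutation UNIV f p \<in> {p. p permutes UNIV}"
    using map_permutation_permutes[of f UNIV UNIV p] assms p by auto
  show "map_permutation UNIV (inv f) (map_permutation UNIV f p) = p"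
    using p map_permutation_compose_inv[of f UNIV UNIV p "inv f"] assms inj by (auto simp: bij_is_inj)
  have "(\<Prod>k\<in>UNIV. A $ k $ map_permutation UNIV f p k) = (\<Prod>i\<in>UNIV. A $ f i $ map_permutation UNIV f p (f i))"
    using prod.reindex_bij_betw[OF assms, of "\<lambda>k. A $ k $ map_permutation UNIV f p k"] by simp
  also have "\<dots> = (\<Prod>i\<in>UNIV. A $ f i $ f (p i))"
    using inj by (simp add: map_permutation_apply)
  finally show "of_int (sign (map_permutation UNIV f p)) * (\<Prod>i\<in>UNIV. A $ i $ map_permutation UNIV f p i) =
      of_int (sign p) * (\<Prod>i\<in>UNIV. (\<chi> i j. A $ f i $ f j) $ i $ p i)"
    using sign_map_permutation[OF inj(1), of p] p by simp
next
  have inj: "inj f" "inj (inv f)" and bij: "bij (inv f)"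
    using assms by (auto simp: bij_is_inj bij_imp_bij_inv)
  fix q :: "'n \<Rightarrow> 'n" assume q: "q \<in> {p. p permutes UNIV}"
  show "map_permutation UNIV (inv f) q \<in> {p. p permutes UNIV}"
    using map_permutation_permutes[of "inv f" UNIV UNIV q] bij q by auto
  show "map_permutation UNIV f (map_permutation UNIV (inv f) q) = q"
    using q map_permutation_compose_inv[of "inv f" UNIV UNIV q f] bij assms
    by (auto simp: bij_is_surj surj_f_inv_f)
qed

text \<open>The change of variables theorem of the library is restricted to well-ordered index types, hence
  the following well-ordered copy of an arbitrary finite type.\<close>

typedef 'a ordered_copy = "UNIV :: 'a set" morphisms original ordered_copy
  by auto

instance ordered_copy :: (finite) finite
proof
  have "(UNIV :: 'a ordered_copy set) = range ordered_copy"
    by (metis surjI original_inverse)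
  thus "finite (UNIV :: 'a ordered_copy set)"
    by (metis finite finite_imageI)
qed

instantiation ordered_copy :: (finite) linorder
begin

definition "x \<le> y \<longleftrightarrow> to_nat (original x) \<le> to_nat (original y)"
definition "x < y \<longleftrightarrow> to_nat (original x) < to_nat (original y)"

instance
  by standard (auto simp: less_eq_ordered_copy_def less_ordered_copy_def original_inject)

end

instance ordered_copy :: (finite) wellorder
proof
  fix P :: "'a ordered_copy \<Rightarrow> bool" and x
  assume step: "\<And>x. (\<And>y. y < x \<Longrightarrow> P y) \<Longrightarrow> P x"
  show "P x"
    by (induction "to_nat (original x)" arbitrary: x rule: less_induct)
       (rule step, auto simp: less_ordered_copy_def)
qed

text \<open>Agreement on boxes suffices. The preimage \<open>S\<close> of a box is mapped
  bijectively onto it, and the measure of the image is the integral of the absolute Jacobian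
  determinant over \<open>S\<close>. In this orientation no Jacobian of the inverse appears.\<close>

lemma lborel_eq_distr_diffeomorphism_wellorder:
  fixes v :: "real ^ 'n::{finite,wellorder} \<Rightarrow> real ^ 'n::_"
  assumes v: "diffeomorphism UNIV UNIV v"
  shows "lborel = distr (density lborel (\<lambda>x. ennreal \<bar>det (jacobian v (at x))\<bar>)) borel v"
proof (rule lborel_eqI)
  fix l u :: "(real, 'n) vec"
  assume le: "\<And>b. b \<in> Basis \<Longrightarrow> l \<bullet> b \<le> u \<bullet> b"
  have [measurable]: "v \<in> borel_measurable borel" "(\<lambda>x. det (jacobian v (at x))) \<in> borel_measurable borel"
    by (intro borel_measurable_continuous_onI diffeomorphism_continuous_on[OF v] diffeomorphism_continuous_det[OF v])+
  define S where "S = v -` box l u"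
  have S [measurable]: "S \<in> sets borel"
    unfolding S_def using measurable_sets[of v borel borel "box l u"] by simp
  have img: "v ` S = box l u"
    using diffeomorphism_UNIVD(1)[OF v] by (simp add: S_def bij_is_surj surj_image_vimage_eq)
  have "((\<lambda>x. \<bar>det (matrix (\<lambda>h. jacobian v (at x) *v h))\<bar>) has_integral measure lebesgue (box l u)) S"
  proof (subst has_measure_differentiable_image[symmetric, where f = v])
    show "S \<in> sets lebesgue" using S by simp
    show "(v has_derivative (*v) (jacobian v (at x))) (at x within S)" for x
      using diffeomorphism_has_derivative[OF v] has_derivative_at_withinI by blast
    show "inj_on v S"
      using diffeomorphism_UNIVD(1)[OF v] by (meson bij_is_inj inj_on_subset subset_UNIV)
    show "v ` S \<in> lmeasurable \<and> measure lebesgue (v ` S) = measure lebesgue (box l u)"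
      unfolding img by simp
  qed
  from nn_integral_has_integral_lebesgue'[OF _ this]
  have *: "(\<integral>\<^sup>+x. ennreal \<bar>det (jacobian v (at x))\<bar> * indicator S x \<partial>lborel) = ennreal (measure lebesgue (box l u))"
    by (simp add: matrix_of_matrix_vector_mul)
  have "emeasure (distr (density lborel (\<lambda>x. ennreal \<bar>det (jacobian v (at x))\<bar>)) borel v) (box l u) =
      (\<integral>\<^sup>+x. ennreal \<bar>det (jacobian v (at x))\<bar> * indicator S x \<partial>lborel)"
    by (simp add: emeasure_distr emeasure_density S_def[symmetric])
  also have "\<dots> = (\<Prod>b\<in>Basis. (u - l) \<bullet> b)"
    unfolding * using le by (simp add: measure_lborel_box)
  finally show "emeasure (distr (density lborel (\<lambda>x. ennreal \<bar>det (jacobian v (at x))\<bar>)) borel v) (box l u) =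
      (\<Prod>b\<in>Basis. (u - l) \<bullet> b)" .
qed simp

lemma lborel_reindex:
  fixes f :: "'m::finite \<Rightarrow> 'n::finite"
  assumes "bij f"
  shows "lborel = distr lborel borel (\<lambda>x :: real ^ 'n. \<chi> i. x $ f i)"
proof (rule lborel_eqI)
  fix l u :: "real ^ 'm"
  assume le: "\<And>b. b \<in> Basis \<Longrightarrow> l \<bullet> b \<le> u \<bullet> b"
  define g where "g = inv f"
  have fg: "f (g k) = k" "g (f i) = i" for k i
    using assms by (simp_all add: g_def bij_is_surj surj_f_inv_f bij_is_inj)
  have [measurable]: "(\<lambda>x :: real ^ 'n. \<chi> i. x $ f i) \<in> borel_measurable borel"
    by (intro borel_measurable_continuous_onI continuous_intros)
  have vim: "(\<lambda>x :: real ^ 'n. \<chi> i. x $ f i) -` box l u = box (\<chi> k. l $ g k) (\<chi> k. u $ g k)"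
    by (auto simp: mem_box_cart) (metis fg)+
  have le': "l $ i \<le> u $ i" for i
    using le[of "axis i 1"] by (simp add: inner_axis)
  have prod: "(\<Prod>b\<in>Basis. (y - x) \<bullet> b) = (\<Prod>i\<in>UNIV. y $ i - x $ i)" for x y :: "real ^ 'k"
  proof -
    have "(\<Prod>b\<in>Basis. (y - x) \<bullet> b) = (\<Prod>b\<in>(\<lambda>i. axis i 1) ` UNIV. (y - x) \<bullet> b)"
      by (rule prod.cong) (auto simp: Basis_vec_def)
    also have "\<dots> = (\<Prod>i\<in>UNIV. (y - x) \<bullet> axis i 1)"
      by (subst prod.reindex) (auto simp: inj_on_def axis_eq_axis)
    finally show ?thesis by (simp add: inner_axis)
  qed
  have "emeasure (distr lborel borel (\<lambda>x :: real ^ 'n. \<chi> i. x $ f i)) (box l u) =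
      emeasure lborel (box (\<chi> k. l $ g k) (\<chi> k. u $ g k))"
    by (simp add: emeasure_distr vim)
  also have "\<dots> = ennreal (\<Prod>k\<in>UNIV. u $ g k - l $ g k)"
  proof -
    have "(\<chi> k. l $ g k) \<bullet> b \<le> (\<chi> k. u $ g k) \<bullet> b" if "b \<in> Basis" for b :: "real ^ 'n"
      using that by (auto simp: Basis_vec_def inner_axis le')
    thus ?thesis
      by (simp add: prod)
  qed
  also have "(\<Prod>k\<in>UNIV. u $ g k - l $ g k) = (\<Prod>i\<in>UNIV. u $ i - l $ i)"
    using prod.reindex_bij_betw[of g UNIV UNIV "\<lambda>i. u $ i - l $ i"] bij_imp_bij_inv[OF assms]
    by (simp add: g_def)
  finally show "emeasure (distr lborel borel (\<lambda>x :: real ^ 'n. \<chi> i. x $ f i)) (box l u) =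
      ennreal (\<Prod>b\<in>Basis. (u - l) \<bullet> b)"
    by (simp add: prod)
qed simp

text \<open>The map is conjugated by the coordinate relabellings \<open>R\<close> and
  \<open>L\<close>. These preserve Lebesgue measure, and the Jacobians at corresponding points
  differ only by a simultaneous relabelling of rows and columns, so the determinants agree.\<close>

theorem lborel_eq_distr_diffeomorphism:
  fixes v :: "real ^ 'n \<Rightarrow> real ^ 'n"
  assumes v: "diffeomorphism UNIV UNIV v"
  shows "lborel = distr (density lborel (\<lambda>x. ennreal \<bar>det (jacobian v (at x))\<bar>)) borel v"
proof -
  define R where "R = (\<lambda>x :: real ^ 'n. \<chi> i :: 'n ordered_copy. x $ original i)"
  define L where "L = (\<lambda>x :: real ^ 'n ordered_copy. \<chi> i. x $ ordered_copy i)"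
  have RL: "R (L x) = x" "L (R y) = y" for x y
    by (simp_all add: R_def L_def vec_eq_iff original_inverse ordered_copy_inverse)
  have bij: "bij (original :: 'n ordered_copy \<Rightarrow> 'n)" "bij (ordered_copy :: 'n \<Rightarrow> 'n ordered_copy)"
    by (rule o_bij[of ordered_copy] o_bij[of original], auto simp: original_inverse ordered_copy_inverse)+
  have lin: "linear R" "linear L"
    by (auto simp: R_def L_def linear_iff vec_eq_iff)
  hence bl: "bounded_linear R" "bounded_linear L"
    by (auto simp: linear_conv_bounded_linear)
  have C1: "Ck_open 1 UNIV (\<lambda>x. R (v (L x)))" "Ck_open 1 UNIV (\<lambda>x. R (inv v (L x)))"
    using Ck_open_1_compose[OF Ck_open_1_linear[OF bl(1)] Ck_open_1_compose[OF _ Ck_open_1_linear[OF bl(2)] subset_UNIV] subset_UNIV]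
      diffeomorphism_UNIVD(2,3)[OF v] by auto
  have vi: "v (inv v x) = x" "inv v (v x) = x" for x
    using diffeomorphism_UNIVD(1)[OF v] by (simp_all add: bij_is_surj surj_f_inv_f bij_is_inj)
  define v' where "v' = (\<lambda>x. R (v (L x)))"
  have "inv v' = (\<lambda>x. R (inv v (L x)))"
    unfolding v'_def by (rule inv_unique_comp) (auto simp: fun_eq_iff RL vi)
  moreover have "bij v'"
    unfolding v'_def by (rule o_bij[of "\<lambda>x. R (inv v (L x))"]) (auto simp: fun_eq_iff RL vi)
  ultimately have v': "diffeomorphism UNIV UNIV v'"
    unfolding diffeomorphism_UNIV_iff using C1 by (simp only: v'_def)
  have det: "det (jacobian v' (at (R x))) = det (jacobian v (at x))" for x
  proof -
    have "(v' has_derivative (\<lambda>h. R (jacobian v (at x) *v (L h)))) (at (R x))"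
      unfolding v'_def
      using has_derivative_compose[OF bounded_linear_imp_has_derivative[OF bl(2)]
          has_derivative_compose[OF diffeomorphism_has_derivative[OF v] bounded_linear_imp_has_derivative[OF bl(1)]], of "R x"]
      by (simp only: RL)
    hence "frechet_derivative v' (at (R x)) = (\<lambda>h. R (jacobian v (at x) *v (L h)))"
      using frechet_derivative_at by metis
    moreover have "L (axis j 1) = axis (original j) 1" for j
    proof -
      have "(L (axis j 1)) $ k = (axis (original j) 1 :: real ^ 'n) $ k" for k
        using ordered_copy_inverse[of k] original_inverse[of j] by (auto simp: L_def axis_def)
      thus ?thesis by (simp add: vec_eq_iff)
    qed
    ultimately have "jacobian v' (at (R x)) = (\<chi> i j. jacobian v (at x) $ original i $ original j)"
      by (simp add: jacobian_def[of v'] matrix_def R_def matrix_vector_mult_basis column_def)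
    thus ?thesis
      using det_reindex[OF bij(1)] by metis
  qed
  have [measurable]: "v \<in> borel_measurable borel" "v' \<in> borel_measurable borel"
      "(\<lambda>x. det (jacobian v (at x))) \<in> borel_measurable borel"
      "(\<lambda>x. det (jacobian v' (at x))) \<in> borel_measurable borel"
    by (intro borel_measurable_continuous_onI diffeomorphism_continuous_on[OF v] diffeomorphism_continuous_det[OF v]
        diffeomorphism_continuous_on[OF v'] diffeomorphism_continuous_det[OF v'])+
  have [measurable]: "R \<in> borel_measurable borel" "L \<in> borel_measurable borel"
    using bl by (auto intro: borel_measurable_continuous_onI linear_continuous_on)
  have lR: "lborel = distr lborel borel R" and lL: "lborel = distr lborel borel L"
    unfolding R_def L_def by (rule lborel_reindex bij)+
  have "lborel = distr (lborel :: (real ^ 'n ordered_copy) measure) borel L"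
    by (rule lL)
  also have "(lborel :: (real ^ 'n ordered_copy) measure) =
      distr (density (distr lborel borel R) (\<lambda>x. ennreal \<bar>det (jacobian v' (at x))\<bar>)) borel v'"
    using lborel_eq_distr_diffeomorphism_wellorder[OF v'] lR by metis
  also have "density (distr lborel borel R) (\<lambda>x. ennreal \<bar>det (jacobian v' (at x))\<bar>) =
      distr (density lborel (\<lambda>x. ennreal \<bar>det (jacobian v (at x))\<bar>)) borel R"
    by (subst density_distr) (simp_all add: det)
  also have "distr (distr (distr (density lborel (\<lambda>x. ennreal \<bar>det (jacobian v (at x))\<bar>)) borel R) borel v') borel L =
      distr (density lborel (\<lambda>x. ennreal \<bar>det (jacobian v (at x))\<bar>)) borel v"
    by (subst distr_distr, simp, simp)+ (simp add: v'_def RL o_def)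
  finally show ?thesis .
qed

section \<open>Lebesgue measure on trajectories\<close>

lemma Basis_vec_image: "(Basis :: ('v::euclidean_space ^ 't::finite) set) = (\<lambda>(t, c). axis t c) ` (UNIV \<times> Basis)"
  by (auto simp: Basis_vec_def)

lemma prod_Basis_vec:
  "(\<Prod>b\<in>Basis. g b) = (\<Prod>t\<in>UNIV. \<Prod>c\<in>Basis. g (axis t c :: 'v::euclidean_space ^ 't::finite))"
proof -
  have "inj_on (\<lambda>(t, c). axis t c :: 'v ^ 't) (UNIV \<times> Basis)"
    by (auto simp: inj_on_def axis_eq_axis nonzero_Basis)
  thus ?thesis
    unfolding Basis_vec_image by (subst prod.reindex) (simp_all add: prod.cartesian_product case_prod_beta)
qed

lemma mem_box_vec:
  fixes x :: "'v::euclidean_space ^ 't::finite"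
  shows "x \<in> box l u \<longleftrightarrow> (\<forall>t. x $ t \<in> box (l $ t) (u $ t))"
  by (auto simp: mem_box Basis_vec_def inner_axis)

lemma borel_measurable_vec_lambda:
  fixes f :: "'a \<Rightarrow> 't::finite \<Rightarrow> 'v::euclidean_space"
  assumes "\<And>t. (\<lambda>x. f x t) \<in> borel_measurable M"
  shows "(\<lambda>x. \<chi> t. f x t) \<in> borel_measurable M"
  using assms
  by (subst borel_measurable_euclidean_space) (auto simp: Basis_vec_def inner_axis)

lemma measurable_vec_nth [measurable]: "(\<lambda>x :: 'v::euclidean_space ^ 't::finite. x $ t) \<in> borel_measurable borel"
  by (intro borel_measurable_continuous_onI continuous_intros)

lemma product_sigma_finite_lborel: "product_sigma_finite (\<lambda>_. lborel)"
  by (simp add: product_sigma_finite_def lborel.sigma_finite_measure_axioms)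

text \<open>This identification allows the columns of a trajectory to be integrated separately, one
  time at a time.\<close>

lemma lborel_vec:
  "lborel = distr (PiM UNIV (\<lambda>_::'t::finite. lborel :: 'v::euclidean_space measure)) borel (\<lambda>f. \<chi> t. f t)"
proof (rule lborel_eqI)
  interpret product_sigma_finite "\<lambda>_::'t. lborel :: 'v measure"
    by (rule product_sigma_finite_lborel)
  fix l u :: "'v ^ 't"
  assume le: "\<And>b. b \<in> Basis \<Longrightarrow> l \<bullet> b \<le> u \<bullet> b"
  have [measurable]: "(\<lambda>f. \<chi> t. f t) \<in> PiM UNIV (\<lambda>_::'t. lborel :: 'v measure) \<rightarrow>\<^sub>M borel"
    by (intro borel_measurable_vec_lambda) simp
  have vim: "(\<lambda>f. \<chi> t. f t) -` box l u \<inter> space (PiM UNIV (\<lambda>_::'t. lborel :: 'v measure)) =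
      Pi\<^sub>E UNIV (\<lambda>t. box (l $ t) (u $ t))"
    by (auto simp: mem_box_vec space_PiM PiE_def Pi_def extensional_def)
  have le': "l $ t \<bullet> c \<le> u $ t \<bullet> c" if "c \<in> Basis" for t c
    using le[of "axis t c"] that by (auto simp: inner_axis Basis_vec_def)
  have "emeasure (distr (PiM UNIV (\<lambda>_::'t. lborel)) borel (\<lambda>f. \<chi> t. f t)) (box l u) =
      (\<Prod>t\<in>UNIV. emeasure lborel (box (l $ t) (u $ t)))"
    by (simp add: emeasure_distr vim emeasure_PiM)
  also have "\<dots> = (\<Prod>t\<in>UNIV. ennreal (\<Prod>c\<in>Basis. (u $ t - l $ t) \<bullet> c))"
    using le' by simp
  also have "\<dots> = ennreal (\<Prod>b\<in>Basis. (u - l) \<bullet> b)"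
    unfolding prod_Basis_vec using le'
    by (subst prod_ennreal) (auto intro!: prod_nonneg simp: inner_axis inner_diff_left)
  finally show "emeasure (distr (PiM UNIV (\<lambda>_::'t. lborel)) borel (\<lambda>f. \<chi> t. f t)) (box l u) =
      ennreal (\<Prod>b\<in>Basis. (u - l) \<bullet> b)" .
qed simp

lemma nn_integral_lborel_vec:
  fixes f :: "'v::euclidean_space ^ 't::finite \<Rightarrow> ennreal"
  assumes "f \<in> borel_measurable borel"
  shows "(\<integral>\<^sup>+z. f z \<partial>lborel) = (\<integral>\<^sup>+g. f (\<chi> t. g t) \<partial>PiM UNIV (\<lambda>_. lborel))"
  by (subst lborel_vec, subst nn_integral_distr) (auto intro!: borel_measurable_vec_lambda assms)

lemma nn_integral_lborel_vec_prod:
  fixes f :: "'t::finite \<Rightarrow> 'v::euclidean_space \<Rightarrow> ennreal"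
  assumes [measurable]: "\<And>t. f t \<in> borel_measurable borel"
  shows "(\<integral>\<^sup>+z. (\<Prod>t\<in>UNIV. f t (z $ t)) \<partial>lborel) = (\<Prod>t\<in>UNIV. \<integral>\<^sup>+w. f t w \<partial>lborel)"
proof -
  interpret product_sigma_finite "\<lambda>_::'t. lborel :: 'v measure"
    by (rule product_sigma_finite_lborel)
  show ?thesis
    by (subst nn_integral_lborel_vec) (simp_all add: product_nn_integral_prod)
qed

text \<open>The preimage of a box is a product of preimages and the density is a product, so the
  integral splits over the columns. The change of variables for trajectories thus follows from that
  for one column, without a determinant of the columnwise map.\<close>

lemma lborel_eq_distr_columnwise:
  fixes v :: "'v::euclidean_space \<Rightarrow> 'v" and g :: "'v \<Rightarrow> ennreal"
  assumes v [measurable]: "v \<in> borel_measurable borel" and g [measurable]: "g \<in> borel_measurable borel"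
    and eq: "lborel = distr (density lborel g) borel v"
  shows "lborel = distr (density lborel (\<lambda>z. \<Prod>t\<in>UNIV. g (z $ t))) borel (\<lambda>z :: 'v ^ 't::finite. \<chi> t. v (z $ t))"
proof (rule lborel_eqI)
  fix l u :: "'v ^ 't"
  assume le: "\<And>b. b \<in> Basis \<Longrightarrow> l \<bullet> b \<le> u \<bullet> b"
  have le': "l $ t \<bullet> c \<le> u $ t \<bullet> c" if "c \<in> Basis" for t c
    using le[of "axis t c"] that by (auto simp: inner_axis Basis_vec_def)
  have [measurable]: "(\<lambda>z :: 'v ^ 't. \<chi> t. v (z $ t)) \<in> borel_measurable borel"
    by (intro borel_measurable_vec_lambda) simp
  have "emeasure (distr (density lborel (\<lambda>z. \<Prod>t\<in>UNIV. g (z $ t))) borel (\<lambda>z :: 'v ^ 't. \<chi> t. v (z $ t))) (box l u) =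
      (\<integral>\<^sup>+z. (\<Prod>t\<in>UNIV. g (z $ t)) * indicator ((\<lambda>z :: 'v ^ 't. \<chi> t. v (z $ t)) -` box l u) z \<partial>lborel)"
    using measurable_sets[of "\<lambda>z :: 'v ^ 't. \<chi> t. v (z $ t)" borel borel "box l u"]
    by (simp add: emeasure_distr emeasure_density)
  also have "\<dots> = (\<integral>\<^sup>+z. (\<Prod>t\<in>UNIV. g (z $ t) * indicator (v -` box (l $ t) (u $ t)) (z $ t)) \<partial>lborel)"
  proof (intro nn_integral_cong)
    fix z :: "'v ^ 't"
    have "indicator ((\<lambda>z :: 'v ^ 't. \<chi> t. v (z $ t)) -` box l u) z =
        (\<Prod>t\<in>UNIV. indicator (v -` box (l $ t) (u $ t)) (z $ t) :: ennreal)"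
      by (auto simp: indicator_def mem_box_vec prod.neutral)
    thus "(\<Prod>t\<in>UNIV. g (z $ t)) * indicator ((\<lambda>z :: 'v ^ 't. \<chi> t. v (z $ t)) -` box l u) z =
        (\<Prod>t\<in>UNIV. g (z $ t) * indicator (v -` box (l $ t) (u $ t)) (z $ t))"
      by (simp add: prod.distrib)
  qed
  also have "\<dots> = (\<Prod>t\<in>UNIV. \<integral>\<^sup>+w. g w * indicator (v -` box (l $ t) (u $ t)) w \<partial>lborel)"
  proof (rule nn_integral_lborel_vec_prod)
    have [measurable]: "v -` box (l $ t) (u $ t) \<in> sets borel" for t
      using measurable_sets[OF v, of "box (l $ t) (u $ t)"] by simp
    show "(\<lambda>w. g w * indicator (v -` box (l $ t) (u $ t)) w) \<in> borel_measurable borel" for t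
      by measurable
  qed
  also have "\<dots> = (\<Prod>t\<in>UNIV. emeasure lborel (box (l $ t) (u $ t)))"
  proof (rule prod.cong)
    fix t
    have [measurable]: "v -` box (l $ t) (u $ t) \<in> sets borel"
      using measurable_sets[OF v, of "box (l $ t) (u $ t)"] by simp
    have "emeasure lborel (box (l $ t) (u $ t)) = emeasure (distr (density lborel g) borel v) (box (l $ t) (u $ t))"
      using eq by metis
    also have "\<dots> = (\<integral>\<^sup>+w. g w * indicator (v -` box (l $ t) (u $ t)) w \<partial>lborel)"
      by (simp add: emeasure_distr emeasure_density)
    finally show "(\<integral>\<^sup>+w. g w * indicator (v -` box (l $ t) (u $ t)) w \<partial>lborel) = emeasure lborel (box (l $ t) (u $ t))" ..
  qed simp
  also have "\<dots> = (\<Prod>t\<in>UNIV. ennreal (\<Prod>c\<in>Basis. (u $ t - l $ t) \<bullet> c))"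
    using le' by simp
  also have "\<dots> = ennreal (\<Prod>b\<in>Basis. (u - l) \<bullet> b)"
    unfolding prod_Basis_vec using le'
    by (subst prod_ennreal) (auto intro!: prod_nonneg simp: inner_axis inner_diff_left)
  finally show "emeasure (distr (density lborel (\<lambda>z. \<Prod>t\<in>UNIV. g (z $ t))) borel (\<lambda>z :: 'v ^ 't. \<chi> t. v (z $ t))) (box l u) =
      ennreal (\<Prod>b\<in>Basis. (u - l) \<bullet> b)" .
qed simp

text \<open>The factors are integrated out one by one, the last time first.\<close>

lemma nn_integral_causal_prod:
  fixes p :: "'t::{finite,linorder} \<Rightarrow> 'v::euclidean_space \<Rightarrow> ('v, 't) vec \<Rightarrow> ennreal"
  assumes meas: "\<And>t. (\<lambda>(w, z). p t w z) \<in> borel_measurable borel"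
    and causal: "\<And>t w z z'. (\<And>s. s < t \<Longrightarrow> z $ s = z' $ s) \<Longrightarrow> p t w z = p t w z'"
    and int: "\<And>t z. (\<integral>\<^sup>+w. p t w z \<partial>lborel) = 1"
  shows "(\<integral>\<^sup>+z. (\<Prod>t\<in>UNIV. p t (z $ t) z) \<partial>lborel) = 1"
proof -
  interpret product_sigma_finite "\<lambda>_::'t. lborel :: 'v measure"
    by (rule product_sigma_finite_lborel)
  \<comment> \<open>Missing times are filled with 0, which turns a function on \<open>I\<close> into
    a trajectory and gives the induction a statement for every finite \<open>I\<close>.\<close>
  define Z where "Z = (\<lambda>I (f :: 't \<Rightarrow> 'v). \<chi> s. if s \<in> I then f s else 0)"
  have Z [measurable]: "Z I \<in> PiM I (\<lambda>_. lborel) \<rightarrow>\<^sub>M borel" for I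
    unfolding Z_def
  proof (intro borel_measurable_vec_lambda)
    show "(\<lambda>f. if t \<in> I then f t else 0) \<in> PiM I (\<lambda>_::'t. lborel :: 'v measure) \<rightarrow>\<^sub>M borel" for t
      by (cases "t \<in> I") auto
  qed
  have p_meas: "(\<lambda>x. p t (f x) (g x)) \<in> borel_measurable M"
    if "f \<in> M \<rightarrow>\<^sub>M borel" "g \<in> M \<rightarrow>\<^sub>M borel" for t f g and M :: "'k measure"
    using measurable_compose[OF borel_measurable_Pair[OF that] meas[of t]] by simp
  have "(\<integral>\<^sup>+f. (\<Prod>t\<in>I. p t (f t) (Z I f)) \<partial>PiM I (\<lambda>_. lborel)) = 1" if "finite I" for I
    using that
  proof (induction I rule: finite_linorder_max_induct)
    case empty
    show ?case by (simp add: space_PiM nn_integral_const PiM_empty)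
  next
    case (insert b I)
    have b: "b \<notin> I" using insert.hyps(2) by auto
    have "(\<integral>\<^sup>+f. (\<Prod>t\<in>insert b I. p t (f t) (Z (insert b I) f)) \<partial>PiM (insert b I) (\<lambda>_. lborel)) =
        (\<integral>\<^sup>+x. (\<integral>\<^sup>+y. (\<Prod>t\<in>insert b I. p t ((x(b := y)) t) (Z (insert b I) (x(b := y)))) \<partial>lborel) \<partial>PiM I (\<lambda>_. lborel))"
    proof (rule product_nn_integral_insert[OF insert.hyps(1) b])
      show "(\<lambda>f. \<Prod>t\<in>insert b I. p t (f t) (Z (insert b I) f)) \<in> borel_measurable (PiM (insert b I) (\<lambda>_. lborel))"
        by (intro borel_measurable_prod_ennreal p_meas Z) auto
    qed
    also have "\<dots> = (\<integral>\<^sup>+x. (\<integral>\<^sup>+y. p b y (Z I x) * (\<Prod>t\<in>I. p t (x t) (Z I x)) \<partial>lborel) \<partial>PiM I (\<lambda>_. lborel))"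
    proof (intro nn_integral_cong)
      fix x y
      \<comment> \<open>Column \<open>b\<close> is read only by factors at times after
        \<open>b\<close>, and none of these is present because \<open>b\<close> is the maximum; it
        may thus be reset to its default.\<close>
      have shift: "p t ((x(b := y)) t) (Z (insert b I) (x(b := y))) = p t ((x(b := y)) t) (Z I x)" if "t \<le> b" for t
        using that by (intro causal) (auto simp: Z_def)
      have "(\<Prod>t\<in>insert b I. p t ((x(b := y)) t) (Z (insert b I) (x(b := y)))) =
          (\<Prod>t\<in>insert b I. p t ((x(b := y)) t) (Z I x))"
        using insert.hyps(2) by (intro prod.cong refl shift) auto
      also have "\<dots> = p b y (Z I x) * (\<Prod>t\<in>I. p t ((x(b := y)) t) (Z I x))"
        using insert.hyps(1) b by simp
      also have "(\<Prod>t\<in>I. p t ((x(b := y)) t) (Z I x)) = (\<Prod>t\<in>I. p t (x t) (Z I x))"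
        using b by (intro prod.cong) auto
      finally show "(\<Prod>t\<in>insert b I. p t ((x(b := y)) t) (Z (insert b I) (x(b := y)))) =
          p b y (Z I x) * (\<Prod>t\<in>I. p t (x t) (Z I x))" .
    qed
    also have "\<dots> = (\<integral>\<^sup>+x. (\<Prod>t\<in>I. p t (x t) (Z I x)) \<partial>PiM I (\<lambda>_. lborel))"
      by (intro nn_integral_cong, subst nn_integral_multc) (auto intro!: p_meas simp: int)
    finally show ?case using insert.IH by simp
  qed
  from this[of UNIV] have "(\<integral>\<^sup>+f. (\<Prod>t\<in>UNIV. p t (f t) (\<chi> t. f t)) \<partial>PiM UNIV (\<lambda>_. lborel)) = 1"
    by (simp add: Z_def)
  moreover have "(\<lambda>z. \<Prod>t\<in>UNIV. p t (z $ t) z) \<in> borel_measurable borel"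
    by (intro borel_measurable_prod_ennreal p_meas) auto
  ultimately show ?thesis
    by (simp add: nn_integral_lborel_vec)
qed

section \<open>Gaussian deconvolution\<close>

lemma measure_eqI_box:
  fixes M N :: "'a::euclidean_space measure"
  assumes "finite_measure M" "sets M = sets borel" "sets N = sets borel"
    and eq: "\<And>l u. emeasure M (box l u) = emeasure N (box l u)"
  shows "M = N"
proof (rule measure_eqI_generator_eq)
  let ?E = "range (\<lambda>(a, b). box a b :: 'a set)"
  show "Int_stable ?E"
    by (auto simp: Int_stable_def box_Int_box)
  show "?E \<subseteq> Pow UNIV" "sets M = sigma_sets UNIV ?E" "sets N = sigma_sets UNIV ?E"
    by (simp_all add: borel_eq_box assms)
  let ?A = "\<lambda>n::nat. box (- (real n *\<^sub>R One)) (real n *\<^sub>R One) :: 'a set"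
  show "range ?A \<subseteq> ?E" "(\<Union>i. ?A i) = UNIV"
    unfolding UN_box_eq_UNIV by auto
  show "emeasure M (?A i) \<noteq> \<infinity>" for i
    using finite_measure.emeasure_finite[OF assms(1)] by simp
qed (use eq in auto)

text \<open>The slab \<open>H\<close> in the proof is invariant under translation along \<open>b\<close>, so cutting with it commutes
  with adding the noise and leaves a one-dimensional deconvolution of the marginals along \<open>b\<close>.\<close>

lemma gaussian_deconvolution_direction:
  fixes M\<^sub>1 M\<^sub>2 :: "'a::euclidean_space measure"
  assumes fin: "finite_measure M\<^sub>1" "finite_measure M\<^sub>2"
    and sets: "sets M\<^sub>1 = sets borel" "sets M\<^sub>2 = sets borel" and b: "b \<in> Basis"
    and eq: "distr (M\<^sub>1 \<Otimes>\<^sub>M std_normal_distribution) borel (\<lambda>(x, n). x + (s * n) *\<^sub>R b) =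
             distr (M\<^sub>2 \<Otimes>\<^sub>M std_normal_distribution) borel (\<lambda>(x, n). x + (s * n) *\<^sub>R b)"
  shows "M\<^sub>1 = M\<^sub>2"
proof (rule measure_eqI_box[OF fin(1) sets])
  fix l u :: 'a
  define H where "H = {x. \<forall>c\<in>Basis - {b}. l \<bullet> c < x \<bullet> c \<and> x \<bullet> c < u \<bullet> c}"
  have H [measurable]: "H \<in> sets borel"
    unfolding H_def by measurable
  define N where "N = std_normal_distribution"
  interpret N: prob_space N
    unfolding N_def using real_dist_normal_dist by (simp add: real_distribution_def)
  have sets_N [measurable_cong]: "sets N = sets borel"
    by (simp add: N_def)
  have inner_shift: "(x + r *\<^sub>R b) \<bullet> b = x \<bullet> b + r" and H_shift: "x + r *\<^sub>R b \<in> H \<longleftrightarrow> x \<in> H" for x r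
    using b by (auto simp: H_def inner_add_left inner_Basis)
  \<comment> \<open>The characteristic function of the marginal along \<open>b\<close> of
    \<open>M\<close> restricted to \<open>H\<close>, a finite measure of arbitrary mass.\<close>
  define \<Phi> where "\<Phi> = (\<lambda>M t. LINT x|M. indicator H x *\<^sub>R iexp (t * (x \<bullet> b)))"
  have conv: "(LINT y|distr (M \<Otimes>\<^sub>M N) borel (\<lambda>(x, n). x + (s * n) *\<^sub>R b). indicator H y *\<^sub>R iexp (t * (y \<bullet> b))) =
      \<Phi> M t * char N (t * s)"
    if "finite_measure M" and [measurable_cong]: "sets M = sets borel" for M t
  proof -
    interpret M: finite_measure M by fact
    interpret MN: pair_sigma_finite M N ..
    interpret MN': finite_measure "M \<Otimes>\<^sub>M N"
      by (rule finite_measure_pair_measure) unfold_locales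
    let ?f = "\<lambda>(x, n). indicator H x *\<^sub>R (iexp (t * (x \<bullet> b)) * iexp (t * s * n))"
    have int: "integrable (M \<Otimes>\<^sub>M N) ?f"
      by (rule MN'.integrable_const_bound[of _ 1])
         (auto simp: norm_mult indicator_def split: if_splits)
    have "(LINT y|distr (M \<Otimes>\<^sub>M N) borel (\<lambda>(x, n). x + (s * n) *\<^sub>R b). indicator H y *\<^sub>R iexp (t * (y \<bullet> b))) =
        (LINT p|(M \<Otimes>\<^sub>M N). (case p of (x, n) \<Rightarrow> indicator H (x + (s * n) *\<^sub>R b) *\<^sub>R iexp (t * ((x + (s * n) *\<^sub>R b) \<bullet> b))))"
      by (subst integral_distr) (simp_all add: case_prod_beta')
    also have "\<dots> = (LINT p|(M \<Otimes>\<^sub>M N). ?f p)"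
    proof (intro Bochner_Integration.integral_cong refl, clarify)
      fix x n
      have "iexp (t * (x \<bullet> b + s * n)) = iexp (t * (x \<bullet> b)) * iexp (t * s * n)"
        by (simp add: distrib_left exp_add mult.assoc)
      thus "indicator H (x + (s * n) *\<^sub>R b) *\<^sub>R iexp (t * ((x + (s * n) *\<^sub>R b) \<bullet> b)) =
          indicator H x *\<^sub>R (iexp (t * (x \<bullet> b)) * iexp (t * s * n))"
        unfolding inner_shift indicator_def H_shift by (simp only:)
    qed
    also have "\<dots> = (LINT x|M. LINT n|N. ?f (x, n))"
      by (rule MN.integral_fst'[OF int, symmetric])
    also have "\<dots> = (LINT x|M. (indicator H x *\<^sub>R iexp (t * (x \<bullet> b))) * char N (t * s))"
      by (intro Bochner_Integration.integral_cong) (simp_all add: char_def)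
    also have "\<dots> = \<Phi> M t * char N (t * s)"
      unfolding \<Phi>_def by (rule integral_mult_left_zero)
    finally show ?thesis .
  qed
  have \<Phi>_eq: "\<Phi> M\<^sub>1 t = \<Phi> M\<^sub>2 t" for t
  proof -
    have "\<Phi> M\<^sub>1 t * char N (t * s) = \<Phi> M\<^sub>2 t * char N (t * s)"
      unfolding conv[OF fin(1) sets(1), symmetric] conv[OF fin(2) sets(2), symmetric] eq[folded N_def] ..
    \<comment> \<open>The value is that of a real Gaussian at \<open>t * s\<close>, never zero;
      \<open>s = 0\<close> is included, so the noiseless case is treated uniformly.\<close>
    moreover have "char N (t * s) \<noteq> 0"
      by (simp add: N_def char_std_normal_distribution)
    ultimately show ?thesis by simp
  qed
  \<comment> \<open>The mass of the slab is the value of \<open>\<Phi>\<close> at 0, hence common to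
    both measures. It is the constant needed to normalise, and if it is 0 both measures vanish on
    the box.\<close>
  define c where "c = measure M\<^sub>1 H"
  have \<Phi>0: "\<Phi> M 0 = complex_of_real (measure M H)" if "finite_measure M" and "sets M = sets borel" for M
  proof -
    have "\<Phi> M 0 = (LINT x|M. complex_of_real (indicator H x))"
      by (simp add: \<Phi>_def scaleR_conv_of_real)
    thus ?thesis
      using H that(2) sets_eq_imp_space_eq[OF that(2)] by simp
  qed
  have c: "measure M\<^sub>1 H = c" "measure M\<^sub>2 H = c"
  proof -
    have "complex_of_real (measure M\<^sub>1 H) = complex_of_real (measure M\<^sub>2 H)"
      unfolding \<Phi>0[OF fin(1) sets(1), symmetric] \<Phi>0[OF fin(2) sets(2), symmetric] by (rule \<Phi>_eq)
    thus "measure M\<^sub>1 H = c" "measure M\<^sub>2 H = c"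
      unfolding c_def of_real_eq_iff by simp_all
  qed
  have box: "box l u = H \<inter> {x. x \<bullet> b \<in> {l \<bullet> b<..<u \<bullet> b}}"
    using b by (auto simp: H_def mem_box)
  show "emeasure M\<^sub>1 (box l u) = emeasure M\<^sub>2 (box l u)"
  proof (cases "c = 0")
    case True
    have "emeasure M (box l u) = 0" if "finite_measure M" "sets M = sets borel" "measure M H = c" for M
    proof -
      have "emeasure M (box l u) \<le> emeasure M H"
        using that(2) by (intro emeasure_mono) (auto simp: box)
      thus ?thesis
        using that True finite_measure.emeasure_eq_measure[OF that(1)] by simp
    qed
    thus ?thesis
      using fin sets c by simp
  next
    case False
    hence c_pos: "c > 0" using c(1) measure_nonneg[of M\<^sub>1 H] by linarith
    \<comment> \<open>Uniqueness of characteristic functions is a statement about probability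
      measures, hence the division by \<open>c\<close>. On the open interval from
      \<open>l \<bullet> b\<close> to \<open>u \<bullet> b\<close> the normalised marginal recovers
      the mass of the box.\<close>
    define L where "L = (\<lambda>M. distr (density M (\<lambda>x. ennreal (indicator H x / c))) borel (\<lambda>x. x \<bullet> b))"
    have L_emeasure: "emeasure (L M) B = ennreal (1 / c) * emeasure M (H \<inter> {x. x \<bullet> b \<in> B})"
      if [measurable_cong]: "sets M = sets borel" and [measurable]: "B \<in> sets borel" for M B
    proof -
      have sp: "space M = UNIV" using sets_eq_imp_space_eq[OF that(1)] by simp
      have [measurable]: "{x. x \<bullet> b \<in> B} \<in> sets borel"
        using measurable_sets[of "\<lambda>x. x \<bullet> b" borel borel B] by (simp add: vimage_def)
      have "emeasure (L M) B = (\<integral>\<^sup>+x. ennreal (indicator H x / c) * indicator {x. x \<bullet> b \<in> B} x \<partial>M)"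
        unfolding L_def by (simp add: emeasure_distr emeasure_density sp vimage_def)
      also have "\<dots> = (\<integral>\<^sup>+x. ennreal (1 / c) * indicator (H \<inter> {x. x \<bullet> b \<in> B}) x \<partial>M)"
        by (intro nn_integral_cong) (auto simp: indicator_def)
      also have "\<dots> = ennreal (1 / c) * emeasure M (H \<inter> {x. x \<bullet> b \<in> B})"
        by (simp add: nn_integral_cmult_indicator)
      finally show ?thesis .
    qed
    have L_distr: "real_distribution (L M)"
      if "finite_measure M" "sets M = sets borel" "measure M H = c" for M
    proof -
      have "emeasure (L M) (space (L M)) = ennreal (1 / c) * ennreal c"
        using L_emeasure[OF that(2), of UNIV] finite_measure.emeasure_eq_measure[OF that(1), of H] that(3)
        by (simp add: L_def)
      also have "\<dots> = 1"
        using c_pos by (simp flip: ennreal_mult)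
      finally show ?thesis
        by (intro real_distribution.intro prob_spaceI real_distribution_axioms.intro) (simp_all add: L_def)
    qed
    have L_char: "char (L M) t = (1 / c) * \<Phi> M t" if [measurable_cong]: "sets M = sets borel" for M t
    proof -
      have "char (L M) t = (LINT x|density M (\<lambda>x. ennreal (indicator H x / c)). iexp (t * (x \<bullet> b)))"
        unfolding L_def char_def by (subst integral_distr) auto
      also have "\<dots> = (LINT x|M. (indicator H x / c) *\<^sub>R iexp (t * (x \<bullet> b)))"
        using c_pos by (subst integral_density) auto
      also have "\<dots> = (LINT x|M. complex_of_real (1 / c) * (indicator H x *\<^sub>R iexp (t * (x \<bullet> b))))"
        by (intro Bochner_Integration.integral_cong) (auto simp: scaleR_conv_of_real)
      also have "\<dots> = (1 / c) * \<Phi> M t"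
        unfolding \<Phi>_def by (rule integral_mult_right_zero)
      finally show ?thesis .
    qed
    have "L M\<^sub>1 = L M\<^sub>2"
      by (intro Levy_uniqueness L_distr fin sets c ext) (simp add: L_char sets \<Phi>_eq)
    hence "ennreal (1 / c) * emeasure M\<^sub>1 (box l u) = ennreal (1 / c) * emeasure M\<^sub>2 (box l u)"
      using L_emeasure[OF sets(1), of "{l \<bullet> b<..<u \<bullet> b}"] L_emeasure[OF sets(2), of "{l \<bullet> b<..<u \<bullet> b}"]
      unfolding box by simp
    thus ?thesis
      using c_pos by (simp add: ennreal_mult_cancel_left)
  qed
qed

section \<open>Noise with several independent components\<close>

lemma prob_space_std_normal: "prob_space std_normal_distribution"
  using real_dist_normal_dist by (simp add: real_distribution_def)

lemma product_sigma_finite_std_normal: "product_sigma_finite (\<lambda>_. std_normal_distribution)"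
  unfolding product_sigma_finite_def
  using prob_space_std_normal by (simp add: prob_space_imp_sigma_finite)

lemma nn_integral_distr_pair:
  assumes "sigma_finite_measure N" and f: "(\<lambda>(x, y). f x y) \<in> M \<Otimes>\<^sub>M N \<rightarrow>\<^sub>M K" and g: "g \<in> borel_measurable K"
  shows "(\<integral>\<^sup>+z. g z \<partial>distr (M \<Otimes>\<^sub>M N) K (\<lambda>(x, y). f x y)) = (\<integral>\<^sup>+x. \<integral>\<^sup>+y. g (f x y) \<partial>N \<partial>M)"
proof -
  interpret sigma_finite_measure N by fact
  have "(\<integral>\<^sup>+z. g z \<partial>distr (M \<Otimes>\<^sub>M N) K (\<lambda>(x, y). f x y)) = (\<integral>\<^sup>+p. g ((\<lambda>(x, y). f x y) p) \<partial>(M \<Otimes>\<^sub>M N))"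
    by (rule nn_integral_distr[OF f]) (simp add: g)
  also have "\<dots> = (\<integral>\<^sup>+x. \<integral>\<^sup>+y. g ((\<lambda>(x, y). f x y) (x, y)) \<partial>N \<partial>M)"
    by (rule nn_integral_fst[OF measurable_compose[OF f g], symmetric])
  finally show ?thesis by simp
qed

lemma emeasure_distr_pair:
  assumes "sigma_finite_measure N" "(\<lambda>(x, y). f x y) \<in> M \<Otimes>\<^sub>M N \<rightarrow>\<^sub>M K" "X \<in> sets K"
  shows "emeasure (distr (M \<Otimes>\<^sub>M N) K (\<lambda>(x, y). f x y)) X = (\<integral>\<^sup>+x. \<integral>\<^sup>+y. indicator X (f x y) \<partial>N \<partial>M)"
  using nn_integral_distr_pair[OF assms(1,2), of "indicator X"] assms(3) by simp

text \<open>Noise is removed one basis direction at a time, so that only one-dimensional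
  characteristic functions are ever compared.\<close>

lemma gaussian_deconvolution:
  fixes M\<^sub>1 M\<^sub>2 :: "'a::euclidean_space measure"
  assumes "finite I" "I \<subseteq> Basis"
    and "finite_measure M\<^sub>1" "finite_measure M\<^sub>2" "sets M\<^sub>1 = sets borel" "sets M\<^sub>2 = sets borel"
    and "distr (M\<^sub>1 \<Otimes>\<^sub>M PiM I (\<lambda>_. std_normal_distribution)) borel (\<lambda>(x, f). x + s *\<^sub>R (\<Sum>b\<in>I. f b *\<^sub>R b)) =
         distr (M\<^sub>2 \<Otimes>\<^sub>M PiM I (\<lambda>_. std_normal_distribution)) borel (\<lambda>(x, f). x + s *\<^sub>R (\<Sum>b\<in>I. f b *\<^sub>R b))"
  shows "M\<^sub>1 = M\<^sub>2"
  using assms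
proof (induction I arbitrary: M\<^sub>1 M\<^sub>2 rule: finite_induct)
  case empty
  let ?Q = "PiM {} (\<lambda>_::'a. std_normal_distribution)"
  \<comment> \<open>Without directions the added vector is 0, and the law is the first marginal of a
    product with a probability measure.\<close>
  have "distr (M \<Otimes>\<^sub>M ?Q) borel (\<lambda>(x, f). x + s *\<^sub>R (\<Sum>b\<in>{}. f b *\<^sub>R b)) = M"
    if "sets M = sets borel" for M :: "'a measure"
  proof -
    interpret P: prob_space ?Q
      by (intro prob_space_PiM prob_space_std_normal)
    show ?thesis
    proof (rule measure_eqI)
      fix X assume "X \<in> sets (distr (M \<Otimes>\<^sub>M ?Q) borel
        (\<lambda>(x, f). x + s *\<^sub>R (\<Sum>b\<in>{}. f b *\<^sub>R b)))"
      hence X: "X \<in> sets M" using that by simp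
      have [measurable]: "fst \<in> M \<Otimes>\<^sub>M ?Q \<rightarrow>\<^sub>M borel"
        using measurable_fst measurable_cong_sets[OF refl that] by blast
      have "emeasure (distr (M \<Otimes>\<^sub>M ?Q) borel fst) X =
          emeasure (M \<Otimes>\<^sub>M ?Q) (X \<times> space ?Q)"
      proof -
        have "fst -` X \<inter> space (M \<Otimes>\<^sub>M ?Q) =
            X \<times> space ?Q"
          using sets.sets_into_space[OF X] by (auto simp: space_pair_measure)
        thus ?thesis
          using X that by (simp add: emeasure_distr)
      qed
      also have "\<dots> = emeasure M X"
        using X by (subst P.emeasure_pair_measure_Times) (auto simp: P.emeasure_space_1)
      finally show "emeasure (distr (M \<Otimes>\<^sub>M ?Q) borel
        (\<lambda>(x, f). x + s *\<^sub>R (\<Sum>b\<in>{}. f b *\<^sub>R b))) X = emeasure M X"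
        by (simp add: case_prod_beta')
    qed (simp add: that)
  qed
  note * = this
  show ?case
    using empty.prems(6) unfolding *[OF empty.prems(4)] *[OF empty.prems(5)] .
next
  case (insert b I)
  interpret P: product_sigma_finite "\<lambda>_::'a. std_normal_distribution"
    by (rule product_sigma_finite_std_normal)
  interpret PI: prob_space "PiM I (\<lambda>_::'a. std_normal_distribution)"
    by (intro prob_space_PiM prob_space_std_normal)
  interpret PbI: prob_space "PiM (insert b I) (\<lambda>_::'a. std_normal_distribution)"
    by (intro prob_space_PiM prob_space_std_normal)
  note sigma_N = prob_space_imp_sigma_finite[OF prob_space_std_normal]
  \<comment> \<open>\<open>T M\<close> is \<open>M\<close> blurred along the directions in
    \<open>I\<close>. Independence splits the noise along \<open>insert b I\<close> into this blur
    and a further one along \<open>b\<close>; the latter is cancelled first, and the induction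
    hypothesis handles \<open>T\<close>.\<close>
  define T where "T = (\<lambda>M :: 'a measure. distr (M \<Otimes>\<^sub>M PiM I (\<lambda>_. std_normal_distribution)) borel
    (\<lambda>(x, f). x + s *\<^sub>R (\<Sum>b\<in>I. f b *\<^sub>R b)))"
  have T: "finite_measure (T M)" "sets (T M) = sets borel"
    "distr (T M \<Otimes>\<^sub>M std_normal_distribution) borel (\<lambda>(x, n). x + (s * n) *\<^sub>R b) =
     distr (M \<Otimes>\<^sub>M PiM (insert b I) (\<lambda>_. std_normal_distribution)) borel (\<lambda>(x, f). x + s *\<^sub>R (\<Sum>b\<in>insert b I. f b *\<^sub>R b))"
    if "finite_measure M" and [measurable_cong]: "sets M = sets borel" for M :: "'a measure"
  proof -
    interpret M: finite_measure M by fact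
    interpret MI: finite_measure "M \<Otimes>\<^sub>M PiM I (\<lambda>_. std_normal_distribution)"
      by (rule finite_measure_pair_measure) unfold_locales
    have meas [measurable]: "(\<lambda>(x, f). x + s *\<^sub>R (\<Sum>b\<in>J. f b *\<^sub>R b)) \<in> M \<Otimes>\<^sub>M PiM J (\<lambda>_. std_normal_distribution) \<rightarrow>\<^sub>M borel" for J
      by measurable
    show fin: "finite_measure (T M)"
      unfolding T_def by (intro MI.finite_measure_distr) measurable
    show sets_T [measurable_cong]: "sets (T M) = sets borel"
      by (simp add: T_def)
    interpret TM: finite_measure "T M" by (rule fin)
    show "distr (T M \<Otimes>\<^sub>M std_normal_distribution) borel (\<lambda>(x, n). x + (s * n) *\<^sub>R b) =
      distr (M \<Otimes>\<^sub>M PiM (insert b I) (\<lambda>_. std_normal_distribution)) borel (\<lambda>(x, f). x + s *\<^sub>R (\<Sum>b\<in>insert b I. f b *\<^sub>R b))"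
    proof (rule measure_eqI)
      fix X assume "X \<in> sets (distr (T M \<Otimes>\<^sub>M std_normal_distribution) borel (\<lambda>(x, n). x + (s * n) *\<^sub>R b))"
      hence X [measurable]: "X \<in> sets borel" by simp
      have "emeasure (distr (T M \<Otimes>\<^sub>M std_normal_distribution) borel (\<lambda>(x, n). x + (s * n) *\<^sub>R b)) X =
          (\<integral>\<^sup>+y. \<integral>\<^sup>+n. indicator X (y + (s * n) *\<^sub>R b) \<partial>std_normal_distribution \<partial>T M)"
        by (rule emeasure_distr_pair[OF sigma_N]) measurable
      also have "\<dots> = (\<integral>\<^sup>+x. \<integral>\<^sup>+f. \<integral>\<^sup>+n. indicator X (x + s *\<^sub>R (\<Sum>b\<in>I. f b *\<^sub>R b) + (s * n) *\<^sub>R b)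
          \<partial>std_normal_distribution \<partial>PiM I (\<lambda>_. std_normal_distribution) \<partial>M)"
        unfolding T_def
        by (rule nn_integral_distr_pair[OF prob_space_imp_sigma_finite[OF PI.prob_space_axioms] meas]) measurable
      also have "\<dots> = (\<integral>\<^sup>+x. \<integral>\<^sup>+f. indicator X (x + s *\<^sub>R (\<Sum>b\<in>insert b I. f b *\<^sub>R b))
          \<partial>PiM (insert b I) (\<lambda>_. std_normal_distribution) \<partial>M)"
      proof (intro nn_integral_cong)
        fix x
        have "(\<Sum>c\<in>insert b I. (f(b := n)) c *\<^sub>R c) = n *\<^sub>R b + (\<Sum>c\<in>I. f c *\<^sub>R c)" for f n
        proof -
          have "(\<Sum>c\<in>I. (f(b := n)) c *\<^sub>R c) = (\<Sum>c\<in>I. f c *\<^sub>R c)"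
            using insert.hyps by (intro sum.cong) auto
          thus ?thesis
            using insert.hyps by simp
        qed
        hence shift: "x + s *\<^sub>R (\<Sum>c\<in>I. f c *\<^sub>R c) + (s * n) *\<^sub>R b = x + s *\<^sub>R (\<Sum>c\<in>insert b I. (f(b := n)) c *\<^sub>R c)" for f n
          by (simp add: algebra_simps)
        show "(\<integral>\<^sup>+f. \<integral>\<^sup>+n. indicator X (x + s *\<^sub>R (\<Sum>b\<in>I. f b *\<^sub>R b) + (s * n) *\<^sub>R b)
            \<partial>std_normal_distribution \<partial>PiM I (\<lambda>_. std_normal_distribution)) =
          (\<integral>\<^sup>+f. indicator X (x + s *\<^sub>R (\<Sum>b\<in>insert b I. f b *\<^sub>R b)) \<partial>PiM (insert b I) (\<lambda>_. std_normal_distribution))"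
          unfolding shift by (rule P.product_nn_integral_insert[OF insert.hyps(1,2), symmetric]) measurable
      qed
      also have "\<dots> = emeasure (distr (M \<Otimes>\<^sub>M PiM (insert b I) (\<lambda>_. std_normal_distribution)) borel
          (\<lambda>(x, f). x + s *\<^sub>R (\<Sum>b\<in>insert b I. f b *\<^sub>R b))) X"
        by (rule emeasure_distr_pair[OF prob_space_imp_sigma_finite[OF PbI.prob_space_axioms] meas X, symmetric])
      finally show "emeasure (distr (T M \<Otimes>\<^sub>M std_normal_distribution) borel (\<lambda>(x, n). x + (s * n) *\<^sub>R b)) X =
        emeasure (distr (M \<Otimes>\<^sub>M PiM (insert b I) (\<lambda>_. std_normal_distribution)) borel
          (\<lambda>(x, f). x + s *\<^sub>R (\<Sum>b\<in>insert b I. f b *\<^sub>R b))) X" .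
    qed simp
  qed
  have "T M\<^sub>1 = T M\<^sub>2"
  proof (rule gaussian_deconvolution_direction[where b = b and s = s])
    show "b \<in> Basis" using insert.prems(1) by simp
    show "distr (T M\<^sub>1 \<Otimes>\<^sub>M std_normal_distribution) borel (\<lambda>(x, n). x + (s * n) *\<^sub>R b) =
        distr (T M\<^sub>2 \<Otimes>\<^sub>M std_normal_distribution) borel (\<lambda>(x, n). x + (s * n) *\<^sub>R b)"
      unfolding T(3)[OF insert.prems(2,4)] T(3)[OF insert.prems(3,5)] by (rule insert.prems(6))
  qed (rule T insert.prems)+
  moreover have "I \<subseteq> Basis" using insert.prems(1) by simp
  ultimately show ?case
    unfolding T_def using insert.IH insert.prems(2-5) by blast
qed

text \<open>Independent standard normal coefficients on the basis vectors have the product density,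
  as a comparison on boxes shows. This is the form in which noise can be removed direction by
  direction.\<close>

lemma noise_law_eq:
  "(noise_law \<sigma>2 :: ('x::finite, 't::finite) trajectory measure) =
     distr (PiM Basis (\<lambda>_. std_normal_distribution)) borel (\<lambda>f. sqrt \<sigma>2 *\<^sub>R (\<Sum>b\<in>Basis. f b *\<^sub>R b))"
proof -
  interpret P: product_sigma_finite "\<lambda>_::('x, 't) trajectory. std_normal_distribution"
    by (rule product_sigma_finite_std_normal)
  interpret PP: prob_space "PiM Basis (\<lambda>_::('x, 't) trajectory. std_normal_distribution)"
    by (intro prob_space_PiM prob_space_std_normal)
  have meas [measurable]: "(\<lambda>f. \<Sum>b\<in>Basis. f b *\<^sub>R b) \<in>
      PiM Basis (\<lambda>_::('x, 't) trajectory. std_normal_distribution) \<rightarrow>\<^sub>M borel"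
    by measurable
  have "distr (PiM Basis (\<lambda>_. std_normal_distribution)) borel (\<lambda>f. \<Sum>b\<in>Basis. f b *\<^sub>R b) =
      density lborel (\<lambda>n :: ('x, 't) trajectory. ennreal (\<Prod>t\<in>UNIV. \<Prod>k\<in>UNIV. std_normal_density (n $ t $ k)))"
  proof (rule measure_eqI_box)
    show "finite_measure (distr (PiM Basis (\<lambda>_. std_normal_distribution)) borel
        (\<lambda>f. \<Sum>b\<in>Basis. f b *\<^sub>R b :: ('x, 't) trajectory))"
      by (intro PP.finite_measure_distr meas)
    fix l u :: "('x, 't) trajectory"
    have vim: "(\<lambda>f. \<Sum>b\<in>Basis. f b *\<^sub>R b) -` box l u \<inter> space (PiM Basis (\<lambda>_. std_normal_distribution)) =
        Pi\<^sub>E Basis (\<lambda>b. {l \<bullet> b<..<u \<bullet> b})"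
      by (auto simp: mem_box space_PiM PiE_def Pi_def)
    have "emeasure (distr (PiM Basis (\<lambda>_. std_normal_distribution)) borel (\<lambda>f. \<Sum>b\<in>Basis. f b *\<^sub>R b)) (box l u) =
        (\<Prod>b\<in>Basis. emeasure std_normal_distribution {l \<bullet> b<..<u \<bullet> b})"
      by (simp add: emeasure_distr vim P.emeasure_PiM)
    also have "\<dots> = (\<Prod>b\<in>Basis. \<integral>\<^sup>+r. ennreal (std_normal_density r) * indicator {l \<bullet> b<..<u \<bullet> b} r \<partial>lborel)"
      by (simp add: emeasure_density)
    also have "\<dots> = (\<integral>\<^sup>+n. (\<Prod>b\<in>Basis. ennreal (std_normal_density (n \<bullet> b)) * indicator {l \<bullet> b<..<u \<bullet> b} (n \<bullet> b)) \<partial>lborel)"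
      by (rule nn_integral_lborel_prod[symmetric]) auto
    also have "\<dots> = (\<integral>\<^sup>+n. ennreal (\<Prod>t\<in>UNIV. \<Prod>k\<in>UNIV. std_normal_density (n $ t $ k)) * indicator (box l u) n \<partial>lborel)"
    proof (intro nn_integral_cong)
      fix n :: "('x, 't) trajectory"
      have "(\<Prod>t\<in>UNIV. \<Prod>k\<in>UNIV. std_normal_density (n $ t $ k)) = (\<Prod>b\<in>Basis. std_normal_density (n \<bullet> b))"
        by (simp add: prod_Basis_vec inner_axis)
      moreover have "indicator (box l u) n = (\<Prod>b\<in>Basis. indicator {l \<bullet> b<..<u \<bullet> b} (n \<bullet> b) :: ennreal)"
        by (auto simp: indicator_def mem_box prod.neutral)
      ultimately show "(\<Prod>b\<in>Basis. ennreal (std_normal_density (n \<bullet> b)) * indicator {l \<bullet> b<..<u \<bullet> b} (n \<bullet> b)) =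
          ennreal (\<Prod>t\<in>UNIV. \<Prod>k\<in>UNIV. std_normal_density (n $ t $ k)) * indicator (box l u) n"
        by (simp add: prod.distrib prod_ennreal)
    qed
    also have "\<dots> = emeasure (density lborel (\<lambda>n. ennreal (\<Prod>t\<in>UNIV. \<Prod>k\<in>UNIV. std_normal_density (n $ t $ k)))) (box l u)"
      by (subst emeasure_density) auto
    finally show "emeasure (distr (PiM Basis (\<lambda>_. std_normal_distribution)) borel (\<lambda>f. \<Sum>b\<in>Basis. f b *\<^sub>R b)) (box l u) =
      emeasure (density lborel (\<lambda>n. ennreal (\<Prod>t\<in>UNIV. \<Prod>k\<in>UNIV. std_normal_density (n $ t $ k)))) (box l u)" .
  qed simp_all
  hence "noise_law \<sigma>2 = distr (distr (PiM Basis (\<lambda>_. std_normal_distribution)) borel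
      (\<lambda>f. \<Sum>b\<in>Basis. f b *\<^sub>R b :: ('x, 't) trajectory)) borel (\<lambda>n. sqrt \<sigma>2 *\<^sub>R n)"
    by (simp only: noise_law_def)
  thus ?thesis
    by (simp add: distr_distr o_def)
qed

theorem noise_deconvolution:
  fixes M\<^sub>1 M\<^sub>2 :: "('x::finite, 't::finite) trajectory measure"
  assumes fin: "finite_measure M\<^sub>1" "finite_measure M\<^sub>2" and sets: "sets M\<^sub>1 = sets borel" "sets M\<^sub>2 = sets borel"
    and eq: "distr (M\<^sub>1 \<Otimes>\<^sub>M noise_law \<sigma>2) borel (\<lambda>(x, n). x + n) =
             distr (M\<^sub>2 \<Otimes>\<^sub>M noise_law \<sigma>2) borel (\<lambda>(x, n). x + n)"
  shows "M\<^sub>1 = M\<^sub>2"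
proof -
  let ?P = "PiM Basis (\<lambda>_::('x, 't) trajectory. std_normal_distribution)"
  let ?g = "\<lambda>f. sqrt \<sigma>2 *\<^sub>R (\<Sum>b\<in>Basis. f b *\<^sub>R b) :: ('x, 't) trajectory"
  interpret P: prob_space ?P
    by (intro prob_space_PiM prob_space_std_normal)
  have g [measurable]: "?g \<in> ?P \<rightarrow>\<^sub>M borel"
    by measurable
  have noise: "distr (M \<Otimes>\<^sub>M noise_law \<sigma>2) borel (\<lambda>(x, n). x + n) =
      distr (M \<Otimes>\<^sub>M ?P) borel (\<lambda>(x, f). x + ?g f)"
    if "finite_measure M" and [measurable_cong]: "sets M = sets borel" for M :: "('x, 't) trajectory measure"
  proof -
    interpret M: finite_measure M by fact
    interpret D: prob_space "distr ?P borel ?g"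
      by (intro P.prob_space_distr g)
    have id: "distr M borel (\<lambda>x. x) = M"
      by (rule distr_id2) (simp add: that)
    have "M \<Otimes>\<^sub>M noise_law \<sigma>2 = distr M borel (\<lambda>x. x) \<Otimes>\<^sub>M distr ?P borel ?g"
      by (simp only: noise_law_eq id)
    also have "\<dots> = distr (M \<Otimes>\<^sub>M ?P) (borel \<Otimes>\<^sub>M borel) (\<lambda>(x, f). (x, ?g f))"
      by (rule pair_measure_distr) (auto intro: D.sigma_finite_measure_axioms)
    finally show ?thesis
      by (simp add: distr_distr o_def case_prod_beta')
  qed
  have "distr (M\<^sub>1 \<Otimes>\<^sub>M ?P) borel (\<lambda>(x, f). x + ?g f) = distr (M\<^sub>2 \<Otimes>\<^sub>M ?P) borel (\<lambda>(x, f). x + ?g f)"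
    unfolding noise[OF fin(1) sets(1), symmetric] noise[OF fin(2) sets(2), symmetric] by (rule eq)
  thus ?thesis
    by (rule gaussian_deconvolution[OF finite_Basis subset_refl fin sets])
qed

section \<open>From observations to the latent law\<close>

text \<open>Nonempty open sets have positive measure. This device upgrades almost-everywhere
  statements to pointwise ones: for continuous densities, for the images of the mixing maps and for
  the transport of patterns.\<close>

lemma AE_open_imp_empty:
  fixes S :: "'a::euclidean_space set"
  assumes "open S" "AE x in lebesgue. x \<notin> S"
  shows "S = {}"
proof -
  have "S \<in> sets borel"
    using assms(1) by simp
  hence "S \<in> sets lebesgue" by simp
  hence "S \<in> null_sets lebesgue"
    using assms(2) by (simp add: AE_iff_null_sets)
  hence "negligible S"
    by (simp add: negligible_iff_null_sets)
  thus ?thesis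
    using open_not_negligible[OF assms(1)] by blast
qed

lemma AE_lborel_continuous_imp_eq:
  fixes f g :: "'a::euclidean_space \<Rightarrow> real"
  assumes "continuous_on UNIV f" "continuous_on UNIV g" "AE x in lborel. f x = g x"
  shows "f x = g x"
proof -
  have "AE x in lebesgue. f x = g x"
    using assms(3) by (rule AE_completion)
  hence "AE x in lebesgue. x \<notin> {x. f x \<noteq> g x}"
    by simp
  moreover have "open {x. f x \<noteq> g x}"
    using assms(1,2) by (rule open_Collect_neq)
  ultimately have "{x. f x \<noteq> g x} = {}"
    using AE_open_imp_empty by blast
  thus ?thesis by blast
qed

text \<open>Writing Lebesgue measure as a pushforward along \<open>v\<close> puts both sides in the
  form of pushforwards along \<open>v\<close>; the left inverse \<open>w\<close> undoes these.
  Densities are unique only up to null sets, hence the conclusion almost everywhere.\<close>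

lemma density_cancel_diffeomorphism:
  fixes v :: "'a::euclidean_space \<Rightarrow> 'a"
  assumes [measurable]: "v \<in> borel_measurable borel" "w \<in> borel_measurable borel"
      "J \<in> borel_measurable borel" "d \<in> borel_measurable borel" "d' \<in> borel_measurable borel"
    and inv: "\<And>x. w (v x) = x"
    and cov: "lborel = distr (density lborel J) borel v"
    and eq: "distr (density lborel d') borel v = density lborel d"
  shows "AE x in lborel. d' x = J x * d (v x)"
proof -
  have "distr (density lborel d') borel v = density (distr (density lborel J) borel v) d"
    using eq cov by metis
  also have "\<dots> = distr (density lborel (\<lambda>x. J x * d (v x))) borel v"
    by (subst density_distr) (simp_all add: density_density_eq)
  finally have "distr (distr (density lborel d') borel v) borel w =
      distr (distr (density lborel (\<lambda>x. J x * d (v x))) borel v) borel w"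
    by (rule arg_cong)
  hence "distr (density lborel d') borel (\<lambda>x. x) = distr (density lborel (\<lambda>x. J x * d (v x))) borel (\<lambda>x. x)"
    by (simp add: distr_distr o_def inv)
  hence "density lborel d' = density lborel (\<lambda>x. J x * d (v x))"
    by (simp add: distr_id2)
  thus ?thesis
    by (subst (asm) sigma_finite_measure.density_unique_iff[OF lborel.sigma_finite_measure_axioms]) auto
qed

text \<open>The joint identity determines the products over all initial segments of time, and the
  factor at \<open>t\<close> is the quotient of the product over times up to \<open>t\<close> by the
  positive product over times before \<open>t\<close>.\<close>

lemma causal_prod_unique:
  fixes p q :: "'t::{finite,linorder} \<Rightarrow> 'v::euclidean_space \<Rightarrow> ('v, 't) vec \<Rightarrow> real"
  assumes pos: "\<And>t w z. p t w z > 0" "\<And>t w z. q t w z > 0"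
    and causal: "\<And>t w z z'. (\<And>s. s < t \<Longrightarrow> z $ s = z' $ s) \<Longrightarrow> p t w z = p t w z'"
      "\<And>t w z z'. (\<And>s. s < t \<Longrightarrow> z $ s = z' $ s) \<Longrightarrow> q t w z = q t w z'"
    and meas: "\<And>t z. (\<lambda>w. p t w z) \<in> borel_measurable borel" "\<And>t z. (\<lambda>w. q t w z) \<in> borel_measurable borel"
    and int: "\<And>t z. (\<integral>\<^sup>+w. ennreal (p t w z) \<partial>lborel) = 1" "\<And>t z. (\<integral>\<^sup>+w. ennreal (q t w z) \<partial>lborel) = 1"
    and eq: "\<And>z. (\<Prod>t\<in>UNIV. p t (z $ t) z) = (\<Prod>t\<in>UNIV. q t (z $ t) z)"
  shows "p t w z = q t w z"
proof -
  define upd where "upd = (\<lambda>z b (w :: 'v). (\<chi> s. if s = b then w else z $ s) :: ('v, 't) vec)"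
  have split: "(\<Prod>t\<in>insert b I. r t (upd z b w $ t) (upd z b w)) = r b w z * (\<Prod>t\<in>I. r t (z $ t) z)"
    if r: "\<And>t w z z'. (\<And>s. s < t \<Longrightarrow> z $ s = z' $ s) \<Longrightarrow> r t w z = r t w z'" and I: "\<And>t. t \<in> I \<Longrightarrow> t < b"
    for r :: "'t \<Rightarrow> 'v \<Rightarrow> ('v, 't) vec \<Rightarrow> real" and z b w I
  proof -
    have upd: "r t y (upd z b w) = r t y z" if "t \<le> b" for t y
      using that by (intro r) (auto simp: upd_def)
    have "b \<notin> I" using I by blast
    hence "(\<Prod>t\<in>insert b I. r t (upd z b w $ t) (upd z b w)) =
        r b w (upd z b w) * (\<Prod>t\<in>I. r t (upd z b w $ t) (upd z b w))"
      by (subst prod.insert) (auto simp: upd_def)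
    moreover have "(\<Prod>t\<in>I. r t (upd z b w $ t) (upd z b w)) = (\<Prod>t\<in>I. r t (z $ t) z)"
    proof (rule prod.cong)
      fix t assume "t \<in> I"
      with I have "t < b" by blast
      hence "upd z b w $ t = z $ t" by (auto simp: upd_def)
      thus "r t (upd z b w $ t) (upd z b w) = r t (z $ t) z"
        using upd[of t "z $ t"] \<open>t < b\<close> by simp
    qed simp
    ultimately show ?thesis
      using upd[of b w] by simp
  qed
  \<comment> \<open>\<open>K\<close> is the up-closed set of times already integrated out. The
    induction adds a new minimum \<open>b\<close>, which is the latest of the remaining times, so no
    remaining factor has column \<open>b\<close> in its history.\<close>
  have marginal: "(\<Prod>t\<in>-K. p t (z $ t) z) = (\<Prod>t\<in>-K. q t (z $ t) z)"
    if "finite K" "\<And>s t. s \<in> K \<Longrightarrow> s \<le> t \<Longrightarrow> t \<in> K" for K z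
    using that
  proof (induction K arbitrary: z rule: finite_linorder_min_induct)
    case empty
    show ?case using eq by simp
  next
    case (insert b A)
    define I where "I = - insert b A"
    have A_up: "t \<in> A" if "s \<in> A" "s \<le> t" for s t
      using insert.prems[of s t] insert.hyps(2) that by auto
    have I_less: "t < b" if "t \<in> I" for t
    proof -
      have "\<not> b \<le> t"
        using insert.prems[of b t] that by (auto simp: I_def)
      thus ?thesis by simp
    qed
    have "b \<notin> A" using insert.hyps(2) by auto
    hence A: "- A = insert b I" by (auto simp: I_def)
    have "(\<integral>\<^sup>+w. ennreal (p b w z) * ennreal (\<Prod>t\<in>I. p t (z $ t) z) \<partial>lborel) =
        (\<integral>\<^sup>+w. ennreal (q b w z) * ennreal (\<Prod>t\<in>I. q t (z $ t) z) \<partial>lborel)"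
    \<comment> \<open>The induction hypothesis is used at every trajectory obtained by writing
      \<open>w\<close> into column \<open>b\<close>; integrating over \<open>w\<close> then removes
      factor \<open>b\<close> on both sides, as it has integral 1.\<close>
    proof (intro nn_integral_cong)
      fix w
      have "(\<Prod>t\<in>-A. p t (upd z b w $ t) (upd z b w)) = (\<Prod>t\<in>-A. q t (upd z b w $ t) (upd z b w))"
        by (rule insert.IH) (rule A_up)
      hence "p b w z * (\<Prod>t\<in>I. p t (z $ t) z) = q b w z * (\<Prod>t\<in>I. q t (z $ t) z)"
        unfolding A using split[of p, OF causal(1) I_less] split[of q, OF causal(2) I_less] by simp
      thus "ennreal (p b w z) * ennreal (\<Prod>t\<in>I. p t (z $ t) z) = ennreal (q b w z) * ennreal (\<Prod>t\<in>I. q t (z $ t) z)"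
        using pos by (simp add: ennreal_mult'[symmetric] less_imp_le)
    qed
    hence "ennreal (\<Prod>t\<in>I. p t (z $ t) z) = ennreal (\<Prod>t\<in>I. q t (z $ t) z)"
      using meas by (simp add: nn_integral_multc int)
    moreover have "(\<Prod>t\<in>I. p t (z $ t) z) \<ge> 0" "(\<Prod>t\<in>I. q t (z $ t) z) \<ge> 0"
      using pos by (auto intro!: prod_nonneg simp: less_imp_le)
    ultimately show ?case
      by (simp add: I_def)
  qed
  have sets: "- {t<..} = insert t {..<t}" "- {t..} = {..<t}"
    by auto
  have "(\<Prod>s\<in>insert t {..<t}. p s (upd z t w $ s) (upd z t w)) = (\<Prod>s\<in>insert t {..<t}. q s (upd z t w $ s) (upd z t w))"
    unfolding sets(1)[symmetric] by (rule marginal) auto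
  moreover have past: "(\<Prod>s<t. p s (z $ s) z) = (\<Prod>s<t. q s (z $ s) z)"
    unfolding sets(2)[symmetric] by (rule marginal) auto
  moreover have "(\<Prod>s\<in>insert t {..<t}. p s (upd z t w $ s) (upd z t w)) = p t w z * (\<Prod>s<t. p s (z $ s) z)"
    by (rule split[where r = p, OF causal(1)]) auto
  moreover have "(\<Prod>s\<in>insert t {..<t}. q s (upd z t w $ s) (upd z t w)) = q t w z * (\<Prod>s<t. q s (z $ s) z)"
    by (rule split[where r = q, OF causal(2)]) auto
  ultimately have "p t w z * (\<Prod>s<t. q s (z $ s) z) = q t w z * (\<Prod>s<t. q s (z $ s) z)"
    by (simp only:)
  moreover have "(\<Prod>s<t. q s (z $ s) z) > 0"
    using pos by (intro prod_pos) auto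
  ultimately show ?thesis
    using mult_right_cancel less_irrefl by metis
qed

section \<open>Densities and laws of one model\<close>

context
  fixes M :: "('z::finite, 'x::finite, 'a::finite, 't::{finite,linorder}) latent_model"
    and A :: "(real ^ 'a) set"
  assumes M: "graphical_model A M" "smooth_model A M"
begin

lemma mixing_C1: "Ck_open 1 UNIV (mixing M)"
  using M(1) unfolding graphical_model_def diffeomorphism_def Ck_on_UNIV_iff by blast

lemma mixing_diffeomorphism: "diffeomorphism UNIV (range (mixing M)) (mixing M)"
  using M(1) unfolding graphical_model_def by blast

lemma mixing_inj: "inj (mixing M)"
  using mixing_diffeomorphism unfolding diffeomorphism_def bij_betw_def by blast

lemma mixing_closed: "closed (range (mixing M))"
  using M(1) unfolding graphical_model_def by blast

lemma mixing_continuous_on: "continuous_on S (mixing M)"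
  by (rule continuous_on_subset[OF Ck_open_1_imp_continuous_on[OF mixing_C1] subset_UNIV])

lemma mixing_measurable [measurable]: "mixing M \<in> borel_measurable borel"
  by (rule borel_measurable_continuous_onI[OF mixing_continuous_on])

lemma trans_density_continuous:
  assumes "a \<in> actions_before A t"
  shows "continuous_on UNIV (\<lambda>(w, z). trans_density M t w z a)"
proof -
  have cont: "continuous_on UNIV (\<lambda>(y, z). factor M t i y z a)" for i
    using factor_differentiable[OF M assms, of i]
    by (intro continuous_at_imp_continuous_on ballI differentiable_imp_continuous_within)
  have "continuous_on UNIV (\<lambda>p. case (fst p $ i, snd p) of (y, z) \<Rightarrow> factor M t i y z a)" for i
    by (rule continuous_on_compose2[OF cont]) (auto intro!: continuous_intros)
  hence "continuous_on UNIV (\<lambda>p. \<Prod>i\<in>UNIV. factor M t i (fst p $ i) (snd p) a)"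
    by (intro continuous_on_prod) simp
  thus ?thesis
    by (simp add: trans_density_def case_prod_beta')
qed

lemma nn_integral_trans_density:
  assumes "a \<in> actions_before A t"
  shows "(\<integral>\<^sup>+w. ennreal (trans_density M t w z a) \<partial>lborel) = 1"
proof -
  have meas: "(\<lambda>(y, z). factor M t i y z a) \<in> borel_measurable borel"
    and int: "(\<integral>\<^sup>+y. ennreal (factor M t i y z a) \<partial>lborel) = 1" for i
    using M(1) assms unfolding graphical_model_def by blast+
  have [measurable]: "(\<lambda>y. factor M t i y z a) \<in> borel_measurable borel" for i
    using measurable_compose[OF _ meas[of i], of "\<lambda>y. (y, z)" borel] by (simp add: borel_measurable_Pair)
  have "(\<integral>\<^sup>+w. ennreal (trans_density M t w z a) \<partial>lborel) =
      (\<integral>\<^sup>+w. (\<Prod>i\<in>UNIV. ennreal (factor M t i (w $ i) z a)) \<partial>lborel)"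
    using factor_pos[OF M assms] by (simp add: trans_density_def prod_ennreal less_imp_le)
  also have "\<dots> = (\<Prod>i\<in>UNIV. \<integral>\<^sup>+y. ennreal (factor M t i y z a) \<partial>lborel)"
    by (rule nn_integral_lborel_vec_prod) simp
  finally show ?thesis by (simp add: int)
qed

context
  fixes a :: "('a, 't) trajectory"
  assumes a: "\<And>t. a $ t \<in> A"
begin

lemma actions_mem: "a \<in> actions_before A t"
  using a by (simp add: actions_before_def)

lemma joint_density_continuous: "continuous_on UNIV (\<lambda>z. \<Prod>t\<in>UNIV. trans_density M t (z $ t) z a)"
proof (rule continuous_on_prod)
  fix t
  have "continuous_on UNIV (\<lambda>z. (\<lambda>(w, z). trans_density M t w z a) (z $ t, z))"
    by (rule continuous_on_compose2[OF trans_density_continuous[OF actions_mem]]) (auto intro!: continuous_intros)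
  thus "continuous_on UNIV (\<lambda>z. trans_density M t (z $ t) z a)" by simp
qed

lemma joint_density_pos: "(\<Prod>t\<in>UNIV. trans_density M t (z $ t) z a) > 0"
  by (intro prod_pos) (simp add: trans_density_pos[OF M actions_mem])

lemma joint_density_measurable [measurable]:
  "(\<lambda>z. \<Prod>t\<in>UNIV. trans_density M t (z $ t) z a) \<in> borel_measurable borel"
  by (rule borel_measurable_continuous_onI[OF joint_density_continuous])

lemma prob_space_latent_law: "prob_space (latent_law M a)"
proof (rule prob_spaceI)
  have "(\<integral>\<^sup>+z. (\<Prod>t\<in>UNIV. ennreal (trans_density M t (z $ t) z a)) \<partial>lborel) = 1"
  proof (rule nn_integral_causal_prod)
    show "(\<lambda>(w, z). ennreal (trans_density M t w z a)) \<in> borel_measurable borel" for t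
      using borel_measurable_continuous_onI[OF trans_density_continuous[OF actions_mem[of t]]]
      by (simp add: case_prod_beta')
    show "ennreal (trans_density M t w z a) = ennreal (trans_density M t w z' a)"
      if "\<And>s. s < t \<Longrightarrow> z $ s = z' $ s" for t w z z'
      using trans_density_cong[OF M actions_mem actions_mem that refl] by simp
  qed (rule nn_integral_trans_density[OF actions_mem])
  moreover have "emeasure (latent_law M a) (space (latent_law M a)) =
      (\<integral>\<^sup>+z. ennreal (\<Prod>t\<in>UNIV. trans_density M t (z $ t) z a) \<partial>lborel)"
    by (simp add: latent_law_def emeasure_density)
  ultimately show "emeasure (latent_law M a) (space (latent_law M a)) = 1"
    using trans_density_pos[OF M actions_mem] by (simp add: prod_ennreal less_imp_le)
qed

lemma sets_latent_law [measurable_cong]: "sets (latent_law M a) = sets borel"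
  by (simp add: latent_law_def)

lemma mixing_columns_measurable [measurable]:
  "(\<lambda>z :: ('z, 't) trajectory. \<chi> t. mixing M (z $ t)) \<in> borel_measurable borel"
  by (intro borel_measurable_vec_lambda) simp

text \<open>The noise enters additively after mixing, so the observation law is the convolution of
  the noiseless law with the noise, as deconvolution expects.\<close>

lemma observation_law_eq:
  "observation_law \<sigma>2 M a =
     distr (distr (latent_law M a) borel (\<lambda>z. \<chi> t. mixing M (z $ t)) \<Otimes>\<^sub>M noise_law \<sigma>2) borel (\<lambda>(x, n). x + n)"
proof (rule measure_eqI)
  interpret P: prob_space "PiM Basis (\<lambda>_::('x, 't) trajectory. std_normal_distribution)"
    by (intro prob_space_PiM prob_space_std_normal)
  have "prob_space (noise_law \<sigma>2 :: ('x, 't) trajectory measure)"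
    unfolding noise_law_eq by (rule P.prob_space_distr) measurable
  hence \<sigma>: "sigma_finite_measure (noise_law \<sigma>2 :: ('x, 't) trajectory measure)"
    by (rule prob_space_imp_sigma_finite)
  have [measurable_cong]: "sets (noise_law \<sigma>2 :: ('x, 't) trajectory measure) = sets borel"
    by (simp add: noise_law_def)
  interpret N: sigma_finite_measure "noise_law \<sigma>2 :: ('x, 't) trajectory measure"
    by (rule \<sigma>)
  fix X assume "X \<in> sets (observation_law \<sigma>2 M a)"
  hence X [measurable]: "X \<in> sets borel"
    by (simp add: observation_law_def)
  have plus: "(\<chi> t. mixing M (z $ t) + n $ t) = (\<chi> t. mixing M (z $ t)) + n" for z :: "('z, 't) trajectory" and n
    by (simp add: vec_eq_iff)
  have "emeasure (observation_law \<sigma>2 M a) X =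
      (\<integral>\<^sup>+z. \<integral>\<^sup>+n. indicator X ((\<chi> t. mixing M (z $ t)) + n) \<partial>noise_law \<sigma>2 \<partial>latent_law M a)"
    unfolding observation_law_def plus by (rule emeasure_distr_pair[OF \<sigma>]) measurable
  also have "\<dots> = (\<integral>\<^sup>+x. \<integral>\<^sup>+n. indicator X (x + n) \<partial>noise_law \<sigma>2 \<partial>distr (latent_law M a) borel (\<lambda>z. \<chi> t. mixing M (z $ t)))"
    by (subst nn_integral_distr) auto
  also have "\<dots> = emeasure (distr (distr (latent_law M a) borel (\<lambda>z. \<chi> t. mixing M (z $ t)) \<Otimes>\<^sub>M noise_law \<sigma>2) borel (\<lambda>(x, n). x + n)) X"
    by (rule emeasure_distr_pair[OF \<sigma>, symmetric]) measurable
  finally show "emeasure (observation_law \<sigma>2 M a) X =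
    emeasure (distr (distr (latent_law M a) borel (\<lambda>z. \<chi> t. mixing M (z $ t)) \<Otimes>\<^sub>M noise_law \<sigma>2) borel (\<lambda>(x, n). x + n)) X" .
qed (simp add: observation_law_def)

end

text \<open>Closedness makes the image a Borel set, and the inverse is continuous on it; extended by
  0, it can be applied to laws of observations.\<close>

lemma inv_mixing_measurable:
  "(\<lambda>x. if x \<in> range (mixing M) then inv (mixing M) x else 0) \<in> borel_measurable borel"
proof (rule borel_measurable_continuous_on_if)
  obtain U g where g: "range (mixing M) \<subseteq> U" "Ck_open 1 U g" "\<forall>x\<in>range (mixing M). g x = inv (mixing M) x"
    using mixing_diffeomorphism unfolding diffeomorphism_def Ck_on_def by blast
  have "continuous_on (range (mixing M)) g"
    by (rule continuous_on_subset[OF Ck_open_1_imp_continuous_on[OF g(2)] g(1)])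
  thus "continuous_on (range (mixing M)) (inv (mixing M))"
    by (rule continuous_on_eq) (use g(3) in blast)
qed (use mixing_closed in auto)

end

text \<open>A value of \<open>mixing M'\<close> off the closed image of \<open>mixing M\<close>
  would give a nonempty open set of latent trajectories. It has positive mass under
  \<open>M'\<close>, whose joint density is positive, while \<open>M\<close> never produces the
  corresponding observations.\<close>

lemma range_mixing_subset:
  fixes M M' :: "('z::finite, 'x::finite, 'a::finite, 't::{finite,linorder}) latent_model"
  assumes M: "graphical_model A M" "smooth_model A M" and M': "graphical_model A M'" "smooth_model A M'"
    and a: "\<And>t. a $ t \<in> A"
    and eq: "distr (latent_law M a) borel (\<lambda>z. \<chi> t. mixing M (z $ t)) =
             distr (latent_law M' a) borel (\<lambda>z. \<chi> t. mixing M' (z $ t))"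
  shows "range (mixing M') \<subseteq> range (mixing M)"
proof (rule ccontr)
  assume "\<not> ?thesis"
  then obtain w where w: "mixing M' w \<notin> range (mixing M)" by blast
  \<comment> \<open>Any time serves; index types are nonempty.\<close>
  obtain t :: 't where True by simp
  let ?F = "\<lambda>z :: ('z, 't) trajectory. \<chi> t. mixing M (z $ t)"
  let ?F' = "\<lambda>z :: ('z, 't) trajectory. \<chi> t. mixing M' (z $ t)"
  define E where "E = {x :: ('x, 't) trajectory. x $ t \<in> - range (mixing M)}"
  define S where "S = {z :: ('z, 't) trajectory. mixing M' (z $ t) \<in> - range (mixing M)}"
  have "open E"
    unfolding E_def vimage_def[symmetric]
    by (intro open_vimage continuous_intros) (use mixing_closed[OF M] in auto)
  hence E [measurable]: "E \<in> sets borel" by simp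
  have "continuous_on UNIV (\<lambda>z :: ('z, 't) trajectory. mixing M' (z $ t))"
    by (rule continuous_on_compose2[OF mixing_continuous_on[OF M', of UNIV]]) (auto intro!: continuous_intros)
  hence "open S"
    unfolding S_def vimage_def[symmetric]
    by (intro open_vimage) (use mixing_closed[OF M] in auto)
  hence S [measurable]: "S \<in> sets borel" by simp
  note [measurable] = mixing_columns_measurable[OF M a] mixing_columns_measurable[OF M' a]
  have "?F -` E = {}" "?F' -` E = S"
    by (auto simp: E_def S_def)
  hence "emeasure (latent_law M' a) S = 0"
    using arg_cong[OF eq, of "\<lambda>N. emeasure N E"]
    by (simp add: emeasure_distr latent_law_def)
  hence "S \<in> null_sets (latent_law M' a)"
    using S by (auto simp: null_sets_def latent_law_def)
  hence "AE z in lborel. z \<in> S \<longrightarrow> ennreal (\<Prod>t\<in>UNIV. trans_density M' t (z $ t) z a) = 0"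
    unfolding latent_law_def using joint_density_measurable[OF M' a] by (subst (asm) null_sets_density_iff) auto
  hence "AE z in lborel. z \<notin> S"
  proof (rule AE_mp, intro AE_I2 impI)
    fix z assume "z \<in> S \<longrightarrow> ennreal (\<Prod>t\<in>UNIV. trans_density M' t (z $ t) z a) = 0"
    thus "z \<notin> S"
      using joint_density_pos[OF M' a, of z] by (auto simp: ennreal_eq_0_iff)
  qed
  hence "S = {}"
    using AE_open_imp_empty[OF \<open>open S\<close>] AE_completion by blast
  moreover have "(\<chi> s. w) \<in> S"
    using w by (simp add: S_def)
  ultimately show False by blast
qed

theorem obs_equiv_imp_diff_equiv:
  fixes M M' :: "('z::finite, 'x::finite, 'a::finite, 't::{finite,linorder}) latent_model"
  assumes M: "graphical_model A M" "smooth_model A M" and M': "graphical_model A M'" "smooth_model A M'"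
    and "A \<noteq> {}" and obs: "obs_equiv \<sigma>2 A M M'"
  shows "diff_equiv A M M'" and "diffeomorphism UNIV UNIV (entanglement M M')"
proof -
  define v where "v = entanglement M M'"
  define V where "V = (\<lambda>z :: ('z, 't) trajectory. \<chi> t. v (z $ t))"
  have law_eq: "distr (latent_law M a) borel (\<lambda>z. \<chi> t. mixing M (z $ t)) =
      distr (latent_law M' a) borel (\<lambda>z. \<chi> t. mixing M' (z $ t))" if a: "\<And>t. a $ t \<in> A" for a :: "('a, 't) trajectory"
  proof (rule noise_deconvolution)
    show "finite_measure (distr (latent_law M a) borel (\<lambda>z. \<chi> t. mixing M (z $ t)))"
      by (intro finite_measure.finite_measure_distr prob_space.axioms prob_space_latent_law[OF M a])
         (use mixing_columns_measurable[OF M a] in \<open>simp add: latent_law_def\<close>)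
    show "finite_measure (distr (latent_law M' a) borel (\<lambda>z. \<chi> t. mixing M' (z $ t)))"
      by (intro finite_measure.finite_measure_distr prob_space.axioms prob_space_latent_law[OF M' a])
         (use mixing_columns_measurable[OF M' a] in \<open>simp add: latent_law_def\<close>)
    have "observation_law \<sigma>2 M a = observation_law \<sigma>2 M' a"
      using obs a unfolding obs_equiv_def by blast
    thus "distr (distr (latent_law M a) borel (\<lambda>z. \<chi> t. mixing M (z $ t)) \<Otimes>\<^sub>M noise_law \<sigma>2) borel (\<lambda>(x, n). x + n) =
        distr (distr (latent_law M' a) borel (\<lambda>z. \<chi> t. mixing M' (z $ t)) \<Otimes>\<^sub>M noise_law \<sigma>2) borel (\<lambda>(x, n). x + n)"
      unfolding observation_law_eq[OF M a] observation_law_eq[OF M' a] .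
  qed simp_all
  obtain a\<^sub>0 where a\<^sub>0: "a\<^sub>0 \<in> A" using \<open>A \<noteq> {}\<close> by blast
  have range: "range (mixing M) = range (mixing M')"
  proof -
    have 0: "(\<chi> t. a\<^sub>0 :: ('a, 't) trajectory) $ t \<in> A" for t using a\<^sub>0 by simp
    show ?thesis
      using range_mixing_subset[OF M M' 0 law_eq[OF 0]] range_mixing_subset[OF M' M 0 law_eq[OF 0, symmetric]] by blast
  qed
  show v: "diffeomorphism UNIV UNIV (entanglement M M')"
    unfolding entanglement_def
    by (rule diffeomorphism_inv_compose[OF mixing_diffeomorphism[OF M] mixing_diffeomorphism[OF M'] range])
  hence v: "diffeomorphism UNIV UNIV v" by (simp only: v_def)
  note vD = diffeomorphism_UNIVD[OF v]
  have fv: "mixing M (v w) = mixing M' w" for w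
  proof -
    have "mixing M' w \<in> range (mixing M)" unfolding range by blast
    thus ?thesis by (simp add: v_def entanglement_def f_inv_into_f)
  qed
  define J where "J = (\<lambda>w. \<bar>det (jacobian v (at w))\<bar>)"
  have J_cont: "continuous_on UNIV J"
    unfolding J_def by (intro continuous_on_rabs diffeomorphism_continuous_det[OF v])
  have J_pos: "J w > 0" for w
    using diffeomorphism_det_jacobian_nonzero[OF v] by (simp add: J_def)
  have cov: "lborel = distr (density lborel (\<lambda>w. ennreal (J w))) borel v"
    unfolding J_def by (rule lborel_eq_distr_diffeomorphism[OF v])
  have v_meas [measurable]: "v \<in> borel_measurable borel" "inv v \<in> borel_measurable borel"
    by (intro borel_measurable_continuous_onI Ck_open_1_imp_continuous_on vD)+
  have J_meas [measurable]: "J \<in> borel_measurable borel"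
    by (rule borel_measurable_continuous_onI[OF J_cont])
  have V_cont: "continuous_on UNIV V"
    unfolding V_def
  proof (rule continuous_on_vec_lambda)
    show "continuous_on UNIV (\<lambda>z :: ('z, 't) trajectory. v (z $ t))" for t
      by (rule continuous_on_compose2[OF diffeomorphism_continuous_on[OF v, of UNIV]]) (auto intro!: continuous_intros)
  qed
  hence V_meas: "V \<in> borel_measurable borel"
    by (rule borel_measurable_continuous_onI)
  define W where "W = (\<lambda>z :: ('z, 't) trajectory. \<chi> t. inv v (z $ t))"
  have W_meas: "W \<in> borel_measurable borel"
    unfolding W_def by (intro borel_measurable_vec_lambda) simp
  have WV: "W (V z) = z" for z
    using vD(1) by (simp add: W_def V_def vec_eq_iff bij_is_inj)
  have joint: "(\<Prod>t\<in>UNIV. trans_density M' t (z $ t) z a) =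
      (\<Prod>t\<in>UNIV. trans_density M t (v (z $ t)) (V z) a * J (z $ t))"
    if a: "\<And>t. a $ t \<in> A" for a :: "('a, 't) trajectory" and z
  proof -
    define d where "d = (\<lambda>z. \<Prod>t\<in>UNIV. trans_density M t (z $ t) z a)"
    define d' where "d' = (\<lambda>z. \<Prod>t\<in>UNIV. trans_density M' t (z $ t) z a)"
    \<comment> \<open>Applied to every column, \<open>g\<close> recovers the latent trajectory of
      \<open>M\<close> from its noiseless observation and turns that of \<open>M'\<close> into the
      image \<open>V z\<close>. Equality of the observed laws becomes a statement about latent
      laws.\<close>
    define g where "g = (\<lambda>x. if x \<in> range (mixing M) then inv (mixing M) x else 0)"
    define G where "G = (\<lambda>x :: ('x, 't) trajectory. \<chi> t. g (x $ t))"
    have g_meas [measurable]: "g \<in> borel_measurable borel"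
      unfolding g_def by (rule inv_mixing_measurable[OF M])
    have G_meas [measurable]: "G \<in> borel_measurable borel"
      unfolding G_def by (intro borel_measurable_vec_lambda) simp
    have d_cont: "continuous_on UNIV d" "continuous_on UNIV d'"
      unfolding d_def d'_def by (rule joint_density_continuous[OF M a] joint_density_continuous[OF M' a])+
    have d_meas [measurable]: "d \<in> borel_measurable borel" "d' \<in> borel_measurable borel"
      by (rule borel_measurable_continuous_onI, rule d_cont)+
    have d_pos: "d z > 0" "d' z > 0" for z
      unfolding d_def d'_def by (rule joint_density_pos[OF M a] joint_density_pos[OF M' a])+
    note [measurable] = mixing_columns_measurable[OF M a] mixing_columns_measurable[OF M' a]
    have laws: "latent_law M a = density lborel (\<lambda>z. ennreal (d z))" "latent_law M' a = density lborel (\<lambda>z. ennreal (d' z))"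
      by (simp_all add: latent_law_def d_def d'_def)
    have GF: "G (\<chi> t. mixing M (z $ t)) = z" "G (\<chi> t. mixing M' (z $ t)) = V z" for z
    proof -
      have "g (mixing M w) = w" for w
        by (simp add: g_def mixing_inj[OF M])
      thus "G (\<chi> t. mixing M (z $ t)) = z" "G (\<chi> t. mixing M' (z $ t)) = V z"
        by (simp_all add: G_def V_def fv[symmetric])
    qed
    have "distr (distr (latent_law M a) borel (\<lambda>z. \<chi> t. mixing M (z $ t))) borel G =
        distr (distr (latent_law M' a) borel (\<lambda>z. \<chi> t. mixing M' (z $ t))) borel G"
      by (simp only: law_eq[OF a])
    hence "distr (latent_law M a) borel (\<lambda>z. z) = distr (latent_law M' a) borel V"
      unfolding laws by (simp add: distr_distr o_def GF)
    hence law: "distr (density lborel (\<lambda>z. ennreal (d' z))) borel V = density lborel (\<lambda>z. ennreal (d z))"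
      unfolding laws by (simp add: distr_id2)
    have "AE z in lborel. ennreal (d' z) = (\<Prod>t\<in>UNIV. ennreal (J (z $ t))) * ennreal (d (V z))"
    proof (rule density_cancel_diffeomorphism[OF V_meas W_meas _ _ _ WV _ law])
      show "lborel = distr (density lborel (\<lambda>z :: ('z, 't) trajectory. \<Prod>t\<in>UNIV. ennreal (J (z $ t)))) borel V"
        unfolding V_def by (rule lborel_eq_distr_columnwise[OF _ _ cov]) simp_all
    qed simp_all
    hence ae: "AE z in lborel. d' z = (\<Prod>t\<in>UNIV. J (z $ t)) * d (V z)"
    proof (rule AE_mp, intro AE_I2 impI)
      fix z assume "ennreal (d' z) = (\<Prod>t\<in>UNIV. ennreal (J (z $ t))) * ennreal (d (V z))"
      hence "ennreal (d' z) = ennreal ((\<Prod>t\<in>UNIV. J (z $ t)) * d (V z))"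
        using J_pos d_pos by (simp add: prod_ennreal ennreal_mult' less_imp_le prod_nonneg)
      thus "d' z = (\<Prod>t\<in>UNIV. J (z $ t)) * d (V z)"
        using J_pos d_pos by (subst (asm) ennreal_inj) (auto intro!: mult_nonneg_nonneg prod_nonneg simp: less_imp_le)
    qed
    have "continuous_on UNIV (\<lambda>z :: ('z, 't) trajectory. J (z $ t))" for t
      by (rule continuous_on_compose2[OF J_cont]) (auto intro!: continuous_intros)
    moreover have "continuous_on UNIV (\<lambda>z. d (V z))"
      by (rule continuous_on_compose2[OF d_cont(1) V_cont]) auto
    ultimately have "continuous_on UNIV (\<lambda>z. (\<Prod>t\<in>UNIV. J (z $ t)) * d (V z))"
      by (intro continuous_on_mult continuous_on_prod) auto
    from AE_lborel_continuous_imp_eq[OF d_cont(2) this ae]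
    have "d' z = (\<Prod>t\<in>UNIV. J (z $ t)) * d (V z)" .
    thus ?thesis
      by (simp add: d_def d'_def prod.distrib V_def mult.commute)
  qed
  have "trans_density M' t w z a = trans_density M t (v w) (V z) a * J w" if a: "a \<in> actions_before A t" for t w z a
  proof -
    \<comment> \<open>Observational equivalence speaks of full action sequences, but
      \<open>a\<close> is controlled only up to time \<open>t\<close>. The later entries are filled
      with \<open>a\<^sub>0\<close>, which the densities at time \<open>t\<close> do not
      see.\<close>
    define a' where "a' = (\<chi> s. if s \<le> t then a $ s else a\<^sub>0)"
    have a': "a' $ s \<in> A" for s
      using a a\<^sub>0 by (auto simp: a'_def actions_before_def)
    note mem = actions_mem[OF M a']
    \<comment> \<open>The transformed transition of \<open>M\<close> is again causal, positive and
      normalised; its integral is 1 by the change of variables in the current column alone.\<close>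
    have "trans_density M' t w z a' = trans_density M t (v w) (V z) a' * J w"
    proof (rule causal_prod_unique[where p = "\<lambda>t w z. trans_density M' t w z a'" and
          q = "\<lambda>t w z. trans_density M t (v w) (V z) a' * J w"])
      show "trans_density M' t w z a' > 0" "trans_density M t (v w) (V z) a' * J w > 0" for t w z
        using trans_density_pos[OF M' mem] trans_density_pos[OF M mem] J_pos by simp_all
      show "trans_density M' t w z a' = trans_density M' t w z' a'"
        if "\<And>s. s < t \<Longrightarrow> z $ s = z' $ s" for t w z z'
        by (rule trans_density_cong[OF M' mem mem that refl])
      show "trans_density M t (v w) (V z) a' * J w = trans_density M t (v w) (V z') a' * J w"
        if "\<And>s. s < t \<Longrightarrow> z $ s = z' $ s" for t w z z'
        using trans_density_cong[OF M mem mem, of t "V z" "V z'" "v w"] that by (simp add: V_def)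
      have meas_w: "(\<lambda>w. trans_density N t w z a') \<in> borel_measurable borel"
        if N: "graphical_model A N" "smooth_model A N" for N :: "('z, 'x, 'a, 't) latent_model" and t z
      proof -
        have "continuous_on UNIV (\<lambda>w. (\<lambda>(w, z). trans_density N t w z a') (w, z))"
          by (rule continuous_on_compose2[OF trans_density_continuous[OF N mem]]) (auto intro!: continuous_intros)
        thus ?thesis
          by (intro borel_measurable_continuous_onI) simp
      qed
      note [measurable] = meas_w[OF M] meas_w[OF M']
      show "(\<lambda>w. trans_density M' t w z a') \<in> borel_measurable borel"
        "(\<lambda>w. trans_density M t (v w) (V z) a' * J w) \<in> borel_measurable borel" for t z
        by measurable
      show "(\<integral>\<^sup>+w. ennreal (trans_density M' t w z a') \<partial>lborel) = 1" for t z
        by (rule nn_integral_trans_density[OF M' mem])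
      show "(\<integral>\<^sup>+w. ennreal (trans_density M t (v w) (V z) a' * J w) \<partial>lborel) = 1" for t z
      proof -
        have "1 = (\<integral>\<^sup>+w. ennreal (trans_density M t w (V z) a') \<partial>distr (density lborel (\<lambda>w. ennreal (J w))) borel v)"
          using nn_integral_trans_density[OF M mem, of t "V z"] unfolding cov[symmetric] by simp
        also have "\<dots> = (\<integral>\<^sup>+w. ennreal (J w) * ennreal (trans_density M t (v w) (V z) a') \<partial>lborel)"
          by (simp add: nn_integral_distr nn_integral_density)
        also have "\<dots> = (\<integral>\<^sup>+w. ennreal (trans_density M t (v w) (V z) a' * J w) \<partial>lborel)"
          using J_pos trans_density_pos[OF M mem]
          by (intro nn_integral_cong) (simp add: ennreal_mult less_imp_le mult.commute)
        finally show ?thesis ..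
      qed
      show "(\<Prod>t\<in>UNIV. trans_density M' t (z $ t) z a') = (\<Prod>t\<in>UNIV. trans_density M t (v (z $ t)) (V z) a' * J (z $ t))" for z
        by (rule joint[OF a'])
    qed
    moreover have "trans_density M' t w z a' = trans_density M' t w z a"
      by (rule trans_density_cong[OF M' mem a refl]) (simp add: a'_def)
    moreover have "trans_density M t (v w) (V z) a' = trans_density M t (v w) (V z) a"
      by (rule trans_density_cong[OF M mem a refl]) (simp add: a'_def)
    ultimately show ?thesis by simp
  qed
  thus "diff_equiv A M M'"
    unfolding diff_equiv_def Let_def v_def[symmetric] using range by (simp add: V_def J_def)
qed

section \<open>Identification of the latent graph\<close>

lemma subspace_masked_space: "subspace (masked_space B)"
  by (auto simp: subspace_def masked_space_def)

text \<open>As the current vector and column \<open>\<tau>\<close> agree, both Jacobians are taken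
  at \<open>inv v z\<close>, and the Hessians that span the space of \<open>G\<close> are mapped by
  one linear map \<open>L\<close>. Hessians of \<open>M'\<close> respect its own graph, so the span
  lands in the space of that graph.\<close>

lemma sufficient_influence_transports:
  fixes M M' :: "('z::finite, 'x::finite, 'a::finite, 't::{finite,linorder}) latent_model"
  assumes M: "graphical_model A M" "smooth_model A M" and M': "graphical_model A M'" "smooth_model A M'"
    and equiv: "diff_equiv A M M'" and v: "diffeomorphism UNIV UNIV (entanglement M M')"
    and infl: "sufficient_influence_z A M"
  shows "transports_pattern (Gz M) (Gz M') (jacobian (entanglement M M') (at u))"
proof -
  define v where "v = entanglement M M'"
  note v = v[folded v_def]
  note vD = diffeomorphism_UNIVD[OF v]
  have vi: "v (inv v x) = x" "inv v (v x) = x" for x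
    using vD(1) by (simp_all add: bij_is_surj surj_f_inv_f bij_is_inj)
  define J where "J = (\<lambda>u. jacobian v (at u))"
  define L where "L = (\<lambda>u X. transpose (J u) ** X ** J u)"
  have L_linear: "linear (L u)" for u
    unfolding L_def
    by (intro linearI) (simp_all add: vec_eq_iff matrix_matrix_mult_def sum.distrib distrib_left distrib_right
        sum_distrib_left sum_distrib_right mult_ac)
  have eq: "trans_density M' t w z a = trans_density M t (v w) (\<chi> s. v (z $ s)) a * \<bar>det (J w)\<bar>"
    if a: "a \<in> actions_before A t" for t w z a
  proof -
    \<comment> \<open>Equivalence up to diffeomorphism is stated at the current column of a
      trajectory. Writing \<open>w\<close> into column \<open>t\<close> frees the argument, and
      histories at time \<open>t\<close> ignore that column.\<close>
    define z' where "z' = (\<chi> s. if s = t then w else z $ s)"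
    have "trans_density M' t (z' $ t) z' a =
        trans_density M t (v (z' $ t)) (\<chi> s. v (z' $ s)) a * \<bar>det (J (z' $ t))\<bar>"
      using equiv a unfolding diff_equiv_def Let_def v_def[symmetric] J_def by blast
    moreover have "trans_density M' t w z' a = trans_density M' t w z a"
      by (rule trans_density_cong[OF M' a a]) (auto simp: z'_def)
    moreover have "trans_density M t (v w) (\<chi> s. v (z' $ s)) a = trans_density M t (v w) (\<chi> s. v (z $ s)) a"
      by (rule trans_density_cong[OF M a a]) (auto simp: z'_def)
    ultimately show ?thesis by (simp add: z'_def)
  qed
  \<comment> \<open>The set of points where transport fails. It is open, being a union of sets where
    a continuous entry is nonzero.\<close>
  define B where "B = {u. \<exists>X \<in> masked_space (Gz M). L u X \<notin> masked_space (Gz M')}"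
  have "open B"
  proof -
    have B: "B = (\<Union>X \<in> masked_space (Gz M). \<Union>(i, j) \<in> {(i, j). Gz M' $ i $ j = 0}. {u. L u X $ i $ j \<noteq> 0})"
      by (auto simp: B_def masked_space_def)
    have "continuous_on UNIV (\<lambda>u. L u X $ i $ j)" for X i j
      unfolding L_def matrix_matrix_mult_def transpose_def J_def
      by (simp, intro continuous_on_sum continuous_on_mult continuous_on_const diffeomorphism_continuous_jacobian[OF v])
    hence "open {u. L u X $ i $ j \<noteq> 0}" for X i j
      by (intro open_Collect_neq continuous_on_const)
    thus ?thesis
      unfolding B by (intro open_UN ballI) auto
  qed
  have good: "L (inv v z) X \<in> masked_space (Gz M')"
    if tau: "\<forall>r \<in> {1..n}. \<tau> r < t r \<and> as r \<in> actions_before A (t r) \<and> zs r $ \<tau> r = z"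
      and span: "span ((\<lambda>r. hessian_zz M (t r) (\<tau> r) z (zs r) (as r)) ` {1..n}) = masked_space (Gz M)"
      and X: "X \<in> masked_space (Gz M)"
    for z X n and t \<tau> :: "nat \<Rightarrow> 't" and zs as
  proof -
    let ?u = "inv v z"
    have "L ?u (hessian_zz M (t r) (\<tau> r) z (zs r) (as r)) \<in> masked_space (Gz M')" if r: "r \<in> {1..n}" for r
    proof -
      have as: "as r \<in> actions_before A (t r)" and lt: "\<tau> r < t r" and zs: "zs r $ \<tau> r = z"
        using tau r by auto
      have V: "(\<chi> s. v ((\<chi> s. inv v (zs r $ s)) $ s)) = zs r"
        by (simp add: vi vec_eq_iff)
      \<comment> \<open>The histories supplied by the hypothesis belong to \<open>M\<close>; pulled
        back by \<open>inv v\<close> in each column they become histories of \<open>M'\<close>, with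
        column \<open>\<tau> r\<close> equal to the current vector \<open>inv v z\<close>.\<close>
      have "hessian_zz M' (t r) (\<tau> r) ?u (\<chi> s. inv v (zs r $ s)) (as r) =
          transpose (J ?u) ** hessian_zz M (t r) (\<tau> r) (v ?u) (\<chi> s. v ((\<chi> s. inv v (zs r $ s)) $ s)) (as r) **
          J ((\<chi> s. inv v (zs r $ s)) $ \<tau> r)"
      proof (rule hessian_zz_change_of_variables[OF M M' as])
        show "(v has_derivative (*v) (J u)) (at u)" for u
          unfolding J_def by (rule diffeomorphism_has_derivative[OF v])
        show "det (J u) \<noteq> 0" for u
          unfolding J_def by (rule diffeomorphism_det_jacobian_nonzero[OF v])
      qed (rule eq[OF as])
      also have "\<dots> = L ?u (hessian_zz M (t r) (\<tau> r) z (zs r) (as r))"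
        unfolding V L_def by (simp add: vi zs)
      finally show ?thesis
        using hessian_zz_mem_masked_space[OF M' as lt] by metis
    qed
    hence "span (L ?u ` (\<lambda>r. hessian_zz M (t r) (\<tau> r) z (zs r) (as r)) ` {1..n}) \<subseteq> masked_space (Gz M')"
      by (intro span_minimal subspace_masked_space) auto
    thus ?thesis
      using X unfolding span[symmetric] linear_span_image[OF L_linear] by blast
  qed
  \<comment> \<open>The exceptional null set lives in the variable \<open>z = v u\<close>. The
    preimage of \<open>B\<close> under \<open>inv v\<close> is open and null, hence empty, so null
    sets need not be transported along \<open>v\<close>.\<close>
  have "AE z in lebesgue. z \<notin> inv v -` B"
    using infl unfolding sufficient_influence_z_def
  proof (rule AE_mp, intro AE_I2 impI)
    fix z assume "\<exists>(t :: nat \<Rightarrow> 't) (\<tau> :: nat \<Rightarrow> 't) (zs :: nat \<Rightarrow> ('z, 't) trajectory) (as :: nat \<Rightarrow> ('a, 't) trajectory).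
        (\<forall>r \<in> {1..norm0 (Gz M)}. \<tau> r < t r \<and> as r \<in> actions_before A (t r) \<and> zs r $ \<tau> r = z) \<and>
        span ((\<lambda>r. hessian_zz M (t r) (\<tau> r) z (zs r) (as r)) ` {1..norm0 (Gz M)}) = masked_space (Gz M)"
    thus "z \<notin> inv v -` B"
      using good by (auto simp: B_def)
  qed
  moreover have "open (inv v -` B)"
    by (intro open_vimage \<open>open B\<close> Ck_open_1_imp_continuous_on vD)
  ultimately have "inv v -` B = {}"
    using AE_open_imp_empty by blast
  hence "B = {}"
    using vi by blast
  hence "(\<lambda>X. transpose (J u) ** X ** J u) ` masked_space (Gz M) \<subseteq> masked_space (Gz M')"
    by (auto simp: B_def L_def)
  thus ?thesis
    unfolding J_def v_def by (rule transports_patternI)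
qed

theorem theorem3:
  fixes \<theta> \<theta>' :: "('z::finite, 'x::finite, 'a::finite, 't::{finite,linorder}) latent_model"
    and A :: "(real ^ 'a) set"
    and \<sigma>2 :: real
  assumes "CARD('z) \<le> CARD('x)"
    and "\<sigma>2 \<ge> 0"
    and "A \<noteq> {}"
    and "graphical_model A \<theta>" and "smooth_model A \<theta>"
    and "graphical_model A \<theta>'" and "smooth_model A \<theta>'"
    and "obs_equiv \<sigma>2 A \<theta> \<theta>'"
    and "sufficient_influence_z A \<theta>"
  shows "(\<exists>P. permutation_matrix P \<and> pattern_le (P ** Gz \<theta> ** transpose P) (Gz \<theta>')) \<and>
         (norm0 (Gz \<theta>') \<le> norm0 (Gz \<theta>) \<longrightarrow> z_consistent A \<theta> \<theta>')"
proof -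
  note M = assms(4,5) and M' = assms(6,7)
  define v where "v = entanglement \<theta> \<theta>'"
  note equiv = obs_equiv_imp_diff_equiv[OF M M' assms(3,8)]
  have v: "diffeomorphism UNIV UNIV v"
    unfolding v_def by (rule equiv(2))
  have bin: "binary_matrix (Gz \<theta>)" "binary_matrix (Gz \<theta>')"
    using assms(4,6) unfolding graphical_model_def by blast+
  have tr: "transports_pattern (Gz \<theta>) (Gz \<theta>') (jacobian v (at u))" for u
    unfolding v_def by (rule sufficient_influence_transports[OF M M' equiv assms(9)])
  obtain \<pi> P where \<pi>: "bij \<pi>" and P: "P = (\<chi> i j. if j = \<pi> i then 1 else 0)"
    and le: "pattern_le (P ** Gz \<theta> ** transpose P) (Gz \<theta>')"
    and eq: "norm0 (Gz \<theta>') \<le> norm0 (Gz \<theta>) \<Longrightarrow> Gz \<theta>' = P ** Gz \<theta> ** transpose P"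
    and pres: "norm0 (Gz \<theta>') \<le> norm0 (Gz \<theta>) \<Longrightarrow> preserving_map (Gz \<theta>) (\<lambda>x. v (P *v x))"
      "norm0 (Gz \<theta>') \<le> norm0 (Gz \<theta>) \<Longrightarrow> preserving_map (transpose (Gz \<theta>)) (\<lambda>x. v (P *v x))"
    using pattern_identification[OF diffeomorphism_has_derivative[OF v] diffeomorphism_continuous_jacobian[OF v]
        diffeomorphism_invertible_jacobian[OF v] tr bin] by blast
  have perm: "permutation_matrix P"
    unfolding permutation_matrix_def using \<pi> P by blast
  have orth: "P *v (transpose P *v x) = x" "transpose P *v (P *v x) = x" for x
    unfolding matrix_vector_mul_assoc permutation_matrix_orthogonal[OF P \<pi>] by (rule matrix_vector_mul_lid)+
  have "diffeomorphism UNIV UNIV (\<lambda>x. P *v x)"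
  proof -
    have "bij (\<lambda>x. P *v x)"
      by (rule o_bij[of "\<lambda>x. transpose P *v x"]; rule ext; simp only: o_apply id_apply orth)
    moreover have "inv (\<lambda>x. P *v x) = (\<lambda>x. transpose P *v x)"
      by (rule inv_unique_comp; rule ext; simp only: o_apply id_apply orth)
    moreover have "Ck_open 1 UNIV (\<lambda>x. Q *v x)" for Q :: "real ^ 'z ^ 'z"
      by (rule Ck_open_1_linear) simp
    ultimately show ?thesis
      unfolding diffeomorphism_UNIV_iff by (simp only:)
  qed
  hence c: "diffeomorphism UNIV UNIV (\<lambda>x. v (P *v x))"
    by (rule diffeomorphism_UNIV_compose[OF v])
  \<comment> \<open>The map \<open>c\<close> is \<open>v\<close> precomposed with \<open>P\<close>;
    orthogonality of \<open>P\<close> makes the factorization an identity.\<close>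
  have "entanglement \<theta> \<theta>' = (\<lambda>x. v (P *v x)) \<circ> (\<lambda>x. transpose P *v x)"
    by (rule ext) (simp only: o_apply orth v_def)
  hence "z_consistent A \<theta> \<theta>'" if "norm0 (Gz \<theta>') \<le> norm0 (Gz \<theta>)"
    unfolding z_consistent_def using perm equiv(1) eq[OF that] c pres[OF that] by blast
  thus ?thesis
    using perm le by blast
qed

end
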